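(* Let $\alpha,\beta\in\mathcal{T}_n$. Then $2\alpha=_a 2\beta$ implies $\alpha=_a\beta$.
   Context: $R$ is a $(2^{\aleph_0})^+$-saturated o-minimal expansion of an ordered (hence real closed) field; "definable" means definable in $R$ (with parameters), and $n\ge 1$. $\mathcal{O}$ is the convex hull of $\mathbb{Q}$ in $R$, a valuation ring with maximal ideal $\mathfrak{m}$; by saturation its ordered residue field $\mathcal{O}/\mathfrak{m}$ is $\mathbb{R}$, and $\mathrm{st}\colon\mathcal{O}^n\to\mathbb{R}^n$ is the coordinatewise residue (standard part) map. $B[n]$ is the lattice of bounded definable subsets of $R^n$, and $SB[n]=\{X\in B[n]\colon X\subseteq[-m,m]^n\text{ for some }m\in\mathbb{N}\}$ is the lattice of strongly bounded definable sets. For $X\in SB[n]$, $\mu(X)$ is the $n$-dimensional Lebesgue measure of $\mathrm{st}(X)$. For $X,Y\in SB[n]$ and $\epsilon\in\mathbb{R}^{>0}$, write $X=_\epsilon Y$ iff $\mu(X\triangle Y)<\epsilon$, where $\triangle$ is symmetric difference; write $X=_a Y$ iff $X=_\epsilon Y$ for all $\epsilon\in\mathbb{R}^{>0}$. An $n$-isomorphism is a definable $C^1$-diffeomorphism $f\colon U\to f(U)$ with $U\subseteq R^n$ definable and open (and $f(U)$ open in $R^n$) and with Jacobian determinant satisfying $|Jf(x)|=1$ for all $x\in U$. Equivalence relation $\sim$ on $B[n]$: a definable open partition of a definable $X\subseteq R^n$ is a finite family of pairwise disjoint definable open subsets of $X$ whose union covers $X$ outside of a set of dimension $<n$. For $X,Y\in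 B[n]$, $X\sim Y$ iff there are definable open partitions $\{X_i\}_{i=1}^k$ of $X$ and $\{Y_i\}_{i=1}^k$ of $Y$ and $n$-isomorphisms $f_1,\dots,f_k$ such that $Y_i=f_i(X_i)$ for each $i$. $\mathcal{T}_n=B[n]/\!\sim$ is the semigroup whose addition is given by disjoint union: $\alpha+\beta$ is the class of $X\cup Y$ where $X\in\alpha$, $Y\in\beta$ are disjoint representatives (which exist, e.g. by translating); $2\alpha=\alpha+\alpha$. For $\alpha,\beta\in\mathcal{T}_n$, write $\alpha=_a\beta$ iff there are $X\in\alpha$ and $Y\in\beta$ such that $X,Y\in SB[n]$ and $X=_a Y$. *)

theory Defs
  imports "HOL-Analysis.Analysis"
begin

section \<open>Expansions of an ordered field\<close>

text \<open>
  Formulas over an arbitrary first-order language extending that of ordered rings, with variables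
  named by the type \<open>'v\<close>. A function or relation symbol may be applied to lists of any length, so
  each \<open>f\<close> stands for one symbol per arity. This is no restriction: a symbol with a prescribed
  arity is interpreted by \<open>0\<close>, respectively \<open>False\<close>, on lists of other lengths, and this
  changes neither the definable sets nor the types over a set of parameters.
\<close>

datatype ('f, 'v) trm =
    Var 'v
  | Zero
  | One
  | Minus "('f, 'v) trm"
  | Plus "('f, 'v) trm" "('f, 'v) trm"
  | Times "('f, 'v) trm" "('f, 'v) trm"
  | Fun 'f "('f, 'v) trm list"

datatype ('f, 'r, 'v) form =
    Eq "('f, 'v) trm" "('f, 'v) trm"
  | Less "('f, 'v) trm" "('f, 'v) trm"
  | Rel 'r "('f, 'v) trm list"
  | Neg "('f, 'r, 'v) form"
  | Conj "('f, 'r, 'v) form" "('f, 'r, 'v) form"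
  | Ex 'v "('f, 'r, 'v) form"

record ('a, 'f, 'r) expansion =
  fun_interp :: "'f \<Rightarrow> 'a list \<Rightarrow> 'a"
  rel_interp :: "'r \<Rightarrow> 'a list \<Rightarrow> bool"

primrec trm_val ::
  "('a::linordered_field, 'f, 'r) expansion \<Rightarrow> ('v \<Rightarrow> 'a) \<Rightarrow> ('f, 'v) trm \<Rightarrow> 'a" where
  "trm_val M e (Var v) = e v"
| "trm_val M e Zero = 0"
| "trm_val M e One = 1"
| "trm_val M e (Minus t) = - trm_val M e t"
| "trm_val M e (Plus s t) = trm_val M e s + trm_val M e t"
| "trm_val M e (Times s t) = trm_val M e s * trm_val M e t"
| "trm_val M e (Fun f ts) = fun_interp M f (map (trm_val M e) ts)"

primrec sat ::
  "('a::linordered_field, 'f, 'r) expansion \<Rightarrow> ('v \<Rightarrow> 'a) \<Rightarrow> ('f, 'r, 'v) form \<Rightarrow> bool" where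
  "sat M e (Eq s t) \<longleftrightarrow> trm_val M e s = trm_val M e t"
| "sat M e (Less s t) \<longleftrightarrow> trm_val M e s < trm_val M e t"
| "sat M e (Rel r ts) \<longleftrightarrow> rel_interp M r (map (trm_val M e) ts)"
| "sat M e (Neg \<phi>) \<longleftrightarrow> \<not> sat M e \<phi>"
| "sat M e (Conj \<phi> \<psi>) \<longleftrightarrow> sat M e \<phi> \<and> sat M e \<psi>"
| "sat M e (Ex v \<phi>) \<longleftrightarrow> (\<exists>a. sat M (e(v := a)) \<phi>)"

text \<open>
  Definability with parameters of a set of \<open>'i\<close>-indexed tuples. The variables \<open>Inl i\<close> are the
  coordinates; the free variables among the \<open>Inr k\<close> stand for the parameters, whose values are
  given by \<open>e\<close>.
\<close>

definition definable ::
  "('a::linordered_field, 'f, 'r) expansion \<Rightarrow> ('i \<Rightarrow> 'a) set \<Rightarrow> bool" where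
  "definable M S \<longleftrightarrow>
     (\<exists>(\<phi> :: ('f, 'r, 'i + nat) form) e. S = {x. sat M (case_sum x e) \<phi>})"

definition definable_set ::
  "('a::linordered_field, 'f, 'r) expansion \<Rightarrow> ('a ^ 'n) set \<Rightarrow> bool" where
  "definable_set M X \<longleftrightarrow> definable M (vec_nth ` X)"

definition definable_map ::
  "('a::linordered_field, 'f, 'r) expansion \<Rightarrow> ('a ^ 'n) set \<Rightarrow> ('a ^ 'n \<Rightarrow> 'a ^ 'm) \<Rightarrow> bool" where
  "definable_map M U f \<longleftrightarrow>
     definable M ((\<lambda>x. case_sum (vec_nth x) (vec_nth (f x))) ` U)"

definition is_point_or_interval :: "'a::linorder set \<Rightarrow> bool" where
  "is_point_or_interval I \<longleftrightarrow>
     (\<exists>a. I = {a}) \<or> (\<exists>a b. I = {a<..<b}) \<or> (\<exists>a. I = {a<..}) \<or> (\<exists>b. I = {..<b}) \<or> I = UNIV"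

definition o_minimal :: "('a::linordered_field, 'f, 'r) expansion \<Rightarrow> bool" where
  "o_minimal M \<longleftrightarrow>
     (\<forall>S. definable M {x :: unit \<Rightarrow> 'a. x () \<in> S} \<longrightarrow>
        (\<exists>F. finite F \<and> (\<forall>I\<in>F. is_point_or_interval I) \<and> S = \<Union>F))"

text \<open>
  A pair \<open>(\<phi>, e)\<close> with \<open>range e \<subseteq> A\<close> represents the formula over \<open>A\<close> in the one free variable
  \<open>Inl ()\<close> that results from \<open>\<phi>\<close> by substituting \<open>e k\<close> for the free occurrences of \<open>Inr k\<close>.
  No such pair exists for \<open>A = {}\<close>, but formulas without parameters are covered by
  nonempty \<open>A\<close>.
\<close>

definition saturated :: "'k rel \<Rightarrow> ('a::linordered_field, 'f, 'r) expansion \<Rightarrow> bool" where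
  "saturated \<kappa> M \<longleftrightarrow>
     (\<forall>A (p :: (('f, 'r, unit + nat) form \<times> (nat \<Rightarrow> 'a)) set).
        (card_of A, \<kappa>) \<in> ordLess \<longrightarrow>
        (\<forall>(\<phi>, e)\<in>p. range e \<subseteq> A) \<longrightarrow>
        (\<forall>q\<subseteq>p. finite q \<longrightarrow> (\<exists>a. \<forall>(\<phi>, e)\<in>q. sat M (case_sum (\<lambda>_. a) e) \<phi>)) \<longrightarrow>
        (\<exists>a. \<forall>(\<phi>, e)\<in>p. sat M (case_sum (\<lambda>_. a) e) \<phi>))"


section \<open>Bounded sets, standard part and measure\<close>

definition \<O> :: "'a::linordered_field set" where
  "\<O> = {x. \<exists>p q. of_rat p \<le> x \<and> x \<le> of_rat q}"

definition \<mm> :: "'a::linordered_field set" where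
  "\<mm> = {x \<in> \<O>. \<forall>y\<in>\<O>. x * y \<noteq> 1}"

text \<open>
  The residue map \<open>\<O> \<rightarrow> \<O>/\<mm> \<subseteq> \<real>\<close>, where a residue class is identified with the real number
  realizing the same cut in the rationals. The lemmas below show that this is an
  order-preserving ring homomorphism with kernel \<open>\<mm>\<close>; values outside \<open>\<O>\<close> are irrelevant.
\<close>

definition standard_part :: "'a::linordered_field \<Rightarrow> real" where
  "standard_part x = Sup {of_rat q |q. of_rat q < x}"

definition st :: "'a::linordered_field ^ 'n \<Rightarrow> real ^ 'n" where
  "st x = (\<chi> i. standard_part (x $ i))"

definition bounded_definable ::
  "('a::linordered_field, 'f, 'r) expansion \<Rightarrow> ('a ^ 'n) set set" where
  "bounded_definable M =
     {X. definable_set M X \<and> (\<exists>r. \<forall>x\<in>X. \<forall>i. - r \<le> x $ i \<and> x $ i \<le> r)}"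

definition strongly_bounded_definable ::
  "('a::linordered_field, 'f, 'r) expansion \<Rightarrow> ('a ^ 'n) set set" where
  "strongly_bounded_definable M =
     {X \<in> bounded_definable M.
        \<exists>m::nat. \<forall>x\<in>X. \<forall>i. - of_nat m \<le> x $ i \<and> x $ i \<le> of_nat m}"

definition \<mu> :: "('a::linordered_field ^ 'n) set \<Rightarrow> real" where
  "\<mu> X = measure lebesgue (st ` X)"

definition eq_eps ::
  "real \<Rightarrow> ('a::linordered_field ^ 'n) set \<Rightarrow> ('a ^ 'n) set \<Rightarrow> bool" where
  "eq_eps \<epsilon> X Y \<longleftrightarrow> \<mu> (sym_diff X Y) < \<epsilon>"

definition almost_eq :: "('a::linordered_field ^ 'n) set \<Rightarrow> ('a ^ 'n) set \<Rightarrow> bool" where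
  "almost_eq X Y \<longleftrightarrow> (\<forall>\<epsilon>>0. eq_eps \<epsilon> X Y)"


section \<open>Isomorphisms\<close>

definition sup_norm :: "'a::linordered_field ^ 'n \<Rightarrow> 'a" where
  "sup_norm x = Max (range (\<lambda>i. \<bar>x $ i\<bar>))"

text \<open>
  The library's derivatives need a real normed vector space, so differentiability over an
  arbitrary ordered field is spelled out. At points of an open \<open>U\<close> the matrix is unique.
\<close>

definition has_jacobian_matrix ::
  "('a::linordered_field ^ 'n \<Rightarrow> 'a ^ 'm) \<Rightarrow> 'a ^ 'n ^ 'm \<Rightarrow> 'a ^ 'n \<Rightarrow> ('a ^ 'n) set \<Rightarrow> bool" where
  "has_jacobian_matrix f A x U \<longleftrightarrow>
     (\<forall>\<epsilon>>0. \<exists>\<delta>>0. \<forall>y\<in>U. sup_norm (y - x) < \<delta> \<longrightarrow>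
        sup_norm (f y - f x - A *v (y - x)) \<le> \<epsilon> * sup_norm (y - x))"

definition jacobian_matrix ::
  "('a::linordered_field ^ 'n) set \<Rightarrow> ('a ^ 'n \<Rightarrow> 'a ^ 'm) \<Rightarrow> 'a ^ 'n \<Rightarrow> 'a ^ 'n ^ 'm" where
  "jacobian_matrix U f x = (SOME A. has_jacobian_matrix f A x U)"

definition C1_map ::
  "('a::{linordered_field,linorder_topology} ^ 'n) set \<Rightarrow> ('a ^ 'n \<Rightarrow> 'a ^ 'm) \<Rightarrow> bool" where
  "C1_map U f \<longleftrightarrow>
     open U \<and> (\<forall>x\<in>U. \<exists>A. has_jacobian_matrix f A x U) \<and> continuous_on U (jacobian_matrix U f)"

definition n_isomorphism ::
  "('a::{linordered_field,linorder_topology}, 'f, 'r) expansion \<Rightarrow>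
    ('a ^ 'n) set \<Rightarrow> ('a ^ 'n \<Rightarrow> 'a ^ 'n) \<Rightarrow> bool" where
  "n_isomorphism M U f \<longleftrightarrow>
     definable_set M U \<and> open U \<and> open (f ` U) \<and>
     definable_map M U f \<and> inj_on f U \<and>
     C1_map U f \<and> C1_map (f ` U) (the_inv_into U f) \<and>
     (\<forall>x\<in>U. \<bar>det (jacobian_matrix U f x)\<bar> = 1)"


section \<open>The semigroup of bounded definable sets up to isomorphism\<close>

text \<open>
  The o-minimal dimension: the largest number of coordinates such that the projection of \<open>X\<close>
  to these coordinates has nonempty interior (contains an open box). The projection to no
  coordinates has interior iff \<open>X \<noteq> {}\<close>, so the empty set has dimension \<open>-\<infinity>\<close>.
\<close>

definition projection_has_interior :: "('a::linordered_field ^ 'n) set \<Rightarrow> 'n set \<Rightarrow> bool" where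
  "projection_has_interior X J \<longleftrightarrow>
     (\<exists>a b. (\<forall>j\<in>J. a $ j < b $ j) \<and>
        (\<forall>y. (\<forall>j\<in>J. a $ j < y $ j \<and> y $ j < b $ j) \<longrightarrow> (\<exists>x\<in>X. \<forall>j\<in>J. x $ j = y $ j)))"

definition dimension :: "('a::linordered_field ^ 'n) set \<Rightarrow> ereal" where
  "dimension X = (SUP J \<in> {J. projection_has_interior X J}. ereal (real (card J)))"

definition definable_open_partition ::
  "('a::{linordered_field,linorder_topology}, 'f, 'r) expansion \<Rightarrow>
    ('a ^ 'n) set \<Rightarrow> nat \<Rightarrow> (nat \<Rightarrow> ('a ^ 'n) set) \<Rightarrow> bool" where
  "definable_open_partition M X k P \<longleftrightarrow>
     (\<forall>i<k. definable_set M (P i) \<and> open (P i) \<and> P i \<subseteq> X) \<and>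
     disjoint_family_on P {..<k} \<and>
     dimension (X - (\<Union>i<k. P i)) < ereal (real CARD('n))"

definition iso_rel ::
  "('a::{linordered_field,linorder_topology}, 'f, 'r) expansion \<Rightarrow> ('a ^ 'n) set rel" where
  "iso_rel M =
     {(X, Y). X \<in> bounded_definable M \<and> Y \<in> bounded_definable M \<and>
        (\<exists>k P Q f. definable_open_partition M X k P \<and> definable_open_partition M Y k Q \<and>
           (\<forall>i<k. n_isomorphism M (P i) (f i) \<and> Q i = f i ` P i))}"

definition iso_classes ::
  "('a::{linordered_field,linorder_topology}, 'f, 'r) expansion \<Rightarrow> ('a ^ 'n) set set set" where
  "iso_classes M = bounded_definable M // iso_rel M"

definition class_add ::
  "('a::{linordered_field,linorder_topology}, 'f, 'r) expansion \<Rightarrow>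
    ('a ^ 'n) set set \<Rightarrow> ('a ^ 'n) set set \<Rightarrow> ('a ^ 'n) set set" where
  "class_add M \<alpha> \<beta> =
     (THE \<gamma>. \<exists>X\<in>\<alpha>. \<exists>Y\<in>\<beta>. X \<inter> Y = {} \<and> \<gamma> = iso_rel M `` {X \<union> Y})"

definition class_almost_eq ::
  "('a::{linordered_field,linorder_topology}, 'f, 'r) expansion \<Rightarrow>
    ('a ^ 'n) set set \<Rightarrow> ('a ^ 'n) set set \<Rightarrow> bool" where
  "class_almost_eq M \<alpha> \<beta> \<longleftrightarrow>
     (\<exists>X\<in>\<alpha>. \<exists>Y\<in>\<beta>. X \<in> strongly_bounded_definable M \<and> Y \<in> strongly_bounded_definable M \<and>
        almost_eq X Y)"


section \<open>Standard part as residue map\<close>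

lemma \<O>_iff_abs: "x \<in> \<O> \<longleftrightarrow> (\<exists>q>0. \<bar>x\<bar> \<le> of_rat q)"
proof
  assume "x \<in> \<O>"
  then obtain p q where pq: "of_rat p \<le> x" "x \<le> of_rat q" by (auto simp: \<O>_def)
  define r where "r = \<bar>p\<bar> + \<bar>q\<bar> + 1"
  have "- r \<le> p" "q \<le> r" "0 < r" by (auto simp: r_def)
  then have "of_rat (- r) \<le> x" "x \<le> of_rat r"
    using pq by (meson of_rat_less_eq order_trans)+
  then show "\<exists>q>0. \<bar>x\<bar> \<le> of_rat q"
    using \<open>0 < r\<close> by (intro exI[of _ r]) (auto simp: abs_le_iff of_rat_minus)
next
  assume "\<exists>q>0. \<bar>x\<bar> \<le> of_rat q"
  then obtain q where "\<bar>x\<bar> \<le> of_rat q" by blast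
  then have "of_rat (- q) \<le> x" "x \<le> of_rat q" by (auto simp: abs_le_iff of_rat_minus)
  then show "x \<in> \<O>" unfolding \<O>_def by blast
qed

lemma standard_part_cut:
  assumes "x \<in> \<O>"
  shows "of_rat q < x \<Longrightarrow> of_rat q \<le> standard_part x"
    and "x < of_rat q \<Longrightarrow> standard_part x \<le> of_rat q"
proof -
  obtain B where B: "\<bar>x\<bar> \<le> of_rat B" using assms \<O>_iff_abs by blast
  have *: "of_rat r \<le> (of_rat u :: real)" if "of_rat r < x" "x \<le> of_rat u" for r u
  proof -
    have "of_rat r < (of_rat u :: 'a)" using that by order
    then show ?thesis by (simp add: of_rat_less of_rat_less_eq)
  qed
  have bdd: "bdd_above {of_rat q :: real |q. of_rat q < x}"
    using * B by (intro bdd_aboveI[of _ "of_rat B"]) auto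
  show "of_rat q < x \<Longrightarrow> of_rat q \<le> standard_part x"
    unfolding standard_part_def using bdd by (intro cSup_upper) auto
  have "of_rat (- B - 1) < x" using B by (auto simp: abs_le_iff of_rat_diff of_rat_minus)
  then have "{of_rat q :: real |q. of_rat q < x} \<noteq> {}" by blast
  then show "x < of_rat q \<Longrightarrow> standard_part x \<le> of_rat q"
    unfolding standard_part_def using * by (intro cSup_least) auto
qed

lemma standard_part_approx:
  fixes x :: "'a::linordered_field"
  assumes "x \<in> \<O>" "0 < \<epsilon>"
  obtains q where "\<bar>x - of_rat q\<bar> < of_rat \<epsilon>" "\<bar>standard_part x - of_rat q\<bar> < of_rat \<epsilon>"
proof -
  have e: "(0::real) < of_rat (\<epsilon> / 2)" using assms by simp
  then obtain q where q: "standard_part x < of_rat q" "of_rat q < standard_part x + of_rat (\<epsilon> / 2)"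
    using of_rat_dense[of "standard_part x" "standard_part x + of_rat (\<epsilon> / 2)"] by auto
  have "\<not> of_rat (q + \<epsilon> / 2) < x"
    using standard_part_cut(1)[OF assms(1), of "q + \<epsilon> / 2"] q e by (auto simp: of_rat_add)
  moreover have "\<not> x < of_rat (q - \<epsilon> / 2)"
    using standard_part_cut(2)[OF assms(1), of "q - \<epsilon> / 2"] q e by (auto simp: of_rat_diff)
  moreover have "(of_rat (\<epsilon> / 2) :: 'a) < of_rat \<epsilon>" "(of_rat (\<epsilon> / 2) :: real) < of_rat \<epsilon>"
    using assms by (simp_all add: of_rat_less)
  ultimately have "\<bar>x - of_rat q\<bar> < of_rat \<epsilon>" "\<bar>standard_part x - of_rat q\<bar> < of_rat \<epsilon>"
    using q e by (auto simp: abs_less_iff of_rat_add of_rat_diff algebra_simps not_less)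
  then show ?thesis by (rule that)
qed

lemma standard_part_unique:
  fixes x :: "'a::linordered_field"
  assumes x: "x \<in> \<O>"
    and r: "\<And>\<epsilon>. 0 < \<epsilon> \<Longrightarrow> \<exists>q. \<bar>x - of_rat q\<bar> \<le> of_rat \<epsilon> \<and> \<bar>r - of_rat q\<bar> \<le> of_rat \<epsilon>"
  shows "standard_part x = r"
proof (rule ccontr)
  assume "standard_part x \<noteq> r"
  then have "0 < \<bar>standard_part x - r\<bar> / 4" by auto
  then obtain \<epsilon> where e: "0 < (of_rat \<epsilon> :: real)" "of_rat \<epsilon> < \<bar>standard_part x - r\<bar> / 4"
    using of_rat_dense by blast
  then have "0 < \<epsilon>" by simp
  obtain q where q: "\<bar>x - of_rat q\<bar> < of_rat \<epsilon>" "\<bar>standard_part x - of_rat q\<bar> < of_rat \<epsilon>"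
    using standard_part_approx[OF x \<open>0 < \<epsilon>\<close>] .
  obtain p where p: "\<bar>x - of_rat p\<bar> \<le> of_rat \<epsilon>" "\<bar>r - of_rat p\<bar> \<le> of_rat \<epsilon>"
    using r[OF \<open>0 < \<epsilon>\<close>] by blast
  have "(of_rat (p - q) :: 'a) \<le> of_rat (2 * \<epsilon>)" "(of_rat (q - p) :: 'a) \<le> of_rat (2 * \<epsilon>)"
    using p(1) q(1) unfolding of_rat_diff of_rat_mult by (auto simp: abs_le_iff abs_less_iff)
  then have "p - q \<le> 2 * \<epsilon>" "q - p \<le> 2 * \<epsilon>" by (simp_all only: of_rat_less_eq)
  then have "(of_rat (p - q) :: real) \<le> of_rat (2 * \<epsilon>)" "(of_rat (q - p) :: real) \<le> of_rat (2 * \<epsilon>)"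
    by (simp_all only: of_rat_less_eq)
  then have "\<bar>of_rat p - (of_rat q :: real)\<bar> \<le> 2 * of_rat \<epsilon>"
    unfolding of_rat_diff of_rat_mult by (auto simp: abs_le_iff)
  moreover have "\<bar>standard_part x - r\<bar> \<le>
      \<bar>standard_part x - of_rat q\<bar> + \<bar>of_rat p - of_rat q\<bar> + \<bar>r - of_rat p\<bar>"
    by arith
  ultimately show False using e q(2) p(2) by argo
qed

lemma standard_part_of_rat: "standard_part (of_rat q) = of_rat q"
  by (rule standard_part_unique)
    (auto simp: \<O>_def intro!: exI[of _ q])

lemma standard_part_mono:
  assumes "x \<in> \<O>" "y \<in> \<O>" "x \<le> y"
  shows "standard_part x \<le> standard_part y"
proof (rule ccontr)
  assume "\<not> ?thesis"
  then obtain q where q: "standard_part y < of_rat q" "of_rat q < standard_part x"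
    using of_rat_dense[of "standard_part y" "standard_part x"] by auto
  then obtain p where p: "of_rat q < (of_rat p :: real)" "of_rat p < standard_part x"
    using of_rat_dense[of "of_rat q" "standard_part x"] by auto
  have "y \<le> of_rat q" using standard_part_cut(1)[OF assms(2), of q] q by force
  moreover have "of_rat p \<le> x" using standard_part_cut(2)[OF assms(1), of p] p by force
  moreover have "of_rat q < (of_rat p :: 'a)" using p(1) by (simp add: of_rat_less)
  ultimately show False using assms(3) by order
qed

lemma \<O>_add: "x \<in> \<O> \<Longrightarrow> y \<in> \<O> \<Longrightarrow> x + y \<in> \<O>"
  unfolding \<O>_def by clarify (metis add_mono of_rat_add)

lemma \<O>_mult:
  assumes "x \<in> \<O>" "y \<in> \<O>"
  shows "x * y \<in> \<O>"
proof -
  obtain p q where "0 < p" "\<bar>x\<bar> \<le> of_rat p" "0 < q" "\<bar>y\<bar> \<le> of_rat q"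
    using assms by (auto simp: \<O>_iff_abs)
  then have "\<bar>x * y\<bar> \<le> of_rat (p * q)"
    by (simp add: abs_mult of_rat_mult mult_mono)
  then show ?thesis using \<open>0 < p\<close> \<open>0 < q\<close> unfolding \<O>_iff_abs
    by (intro exI[of _ "p * q"]) simp
qed

lemma standard_part_add:
  fixes x y :: "'a::linordered_field"
  assumes "x \<in> \<O>" "y \<in> \<O>"
  shows "standard_part (x + y) = standard_part x + standard_part y"
proof (rule standard_part_unique[OF \<O>_add[OF assms]])
  fix \<epsilon> :: rat
  assume "0 < \<epsilon>"
  then have e: "0 < \<epsilon> / 2" by simp
  obtain p where p: "\<bar>x - of_rat p\<bar> < of_rat (\<epsilon>/2)" "\<bar>standard_part x - of_rat p\<bar> < of_rat (\<epsilon>/2)"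
    using standard_part_approx[OF assms(1) e] .
  obtain q where q: "\<bar>y - of_rat q\<bar> < of_rat (\<epsilon>/2)" "\<bar>standard_part y - of_rat q\<bar> < of_rat (\<epsilon>/2)"
    using standard_part_approx[OF assms(2) e] .
  have "(of_rat \<epsilon> :: 'a) = of_rat (\<epsilon>/2) + of_rat (\<epsilon>/2)" "(of_rat \<epsilon> :: real) = of_rat (\<epsilon>/2) + of_rat (\<epsilon>/2)"
    by (simp_all flip: of_rat_add)
  then show "\<exists>r. \<bar>x + y - of_rat r\<bar> \<le> of_rat \<epsilon> \<and>
      \<bar>standard_part x + standard_part y - of_rat r\<bar> \<le> of_rat \<epsilon>"
    using p q by (intro exI[of _ "p + q"]) (auto simp: of_rat_add abs_le_iff abs_less_iff)
qed

lemma standard_part_mult: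
  fixes x y :: "'a::linordered_field"
  assumes "x \<in> \<O>" "y \<in> \<O>"
  shows "standard_part (x * y) = standard_part x * standard_part y"
proof (rule standard_part_unique[OF \<O>_mult[OF assms]])
  have prod: "\<bar>u * v - a * b\<bar> \<le> d * (2 * B + 1)"
    if "\<bar>u - a\<bar> \<le> d" "\<bar>v - b\<bar> \<le> d" "\<bar>u\<bar> \<le> B" "\<bar>v\<bar> \<le> B" "d \<le> 1"
    for u v a b d B :: "'b::linordered_field"
  proof -
    have "u * v - a * b = (u - a) * v + a * (v - b)" by (simp add: algebra_simps)
    then have "\<bar>u * v - a * b\<bar> \<le> \<bar>u - a\<bar> * \<bar>v\<bar> + \<bar>a\<bar> * \<bar>v - b\<bar>"
      by (metis abs_mult abs_triangle_ineq)
    also have "\<dots> \<le> d * B + (B + 1) * d"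
      using that by (intro add_mono mult_mono) (auto simp: abs_le_iff)
    finally show ?thesis by (simp add: algebra_simps)
  qed
  fix \<epsilon> :: rat
  assume "0 < \<epsilon>"
  obtain B\<^sub>1 B\<^sub>2 where B: "\<bar>x\<bar> \<le> of_rat B\<^sub>1" "0 < B\<^sub>1" "\<bar>y\<bar> \<le> of_rat B\<^sub>2" "0 < B\<^sub>2"
    using assms by (auto simp: \<O>_iff_abs)
  define B where "B = B\<^sub>1 + B\<^sub>2 + 1"
  have B0: "0 < B" and B12: "B\<^sub>1 < B" "B\<^sub>2 < B" using B by (auto simp: B_def)
  have 1: "\<bar>x\<bar> < of_rat B" "\<bar>y\<bar> < of_rat B"
    using B B12 by (meson of_rat_less le_less_trans)+
  have 2: "\<bar>standard_part z\<bar> \<le> of_rat B" if "z \<in> \<O>" "\<bar>z\<bar> < of_rat B" for z :: 'a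
    using standard_part_cut[OF that(1)] that(2) by (auto simp: abs_le_iff abs_less_iff)
      (metis minus_le_iff minus_less_iff of_rat_minus)
  define d where "d = min 1 (\<epsilon> / (2 * B + 1))"
  have d: "0 < d" "d \<le> 1" using \<open>0 < \<epsilon>\<close> B0 by (auto simp: d_def)
  have "d \<le> \<epsilon> / (2 * B + 1)" by (simp add: d_def)
  then have d3: "d * (2 * B + 1) \<le> \<epsilon>" using B0 by (simp add: pos_le_divide_eq)
  obtain p where p: "\<bar>x - of_rat p\<bar> < of_rat d" "\<bar>standard_part x - of_rat p\<bar> < of_rat d"
    using standard_part_approx[OF assms(1) d(1)] .
  obtain q where q: "\<bar>y - of_rat q\<bar> < of_rat d" "\<bar>standard_part y - of_rat q\<bar> < of_rat d"
    using standard_part_approx[OF assms(2) d(1)] .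
  have "\<bar>x * y - of_rat p * of_rat q\<bar> \<le> of_rat d * (2 * of_rat B + 1)"
    using p q 1 d by (intro prod) auto
  moreover have "\<bar>standard_part x * standard_part y - of_rat p * of_rat q\<bar> \<le>
      of_rat d * (2 * of_rat B + 1)"
    using p q 2 1 assms d by (intro prod) auto
  moreover have "(of_rat (d * (2 * B + 1)) :: 'a) \<le> of_rat \<epsilon>"
    "(of_rat (d * (2 * B + 1)) :: real) \<le> of_rat \<epsilon>"
    using d3 by (simp_all only: of_rat_less_eq)
  ultimately show "\<exists>r. \<bar>x * y - of_rat r\<bar> \<le> of_rat \<epsilon> \<and>
      \<bar>standard_part x * standard_part y - of_rat r\<bar> \<le> of_rat \<epsilon>"
    by (intro exI[of _ "p * q"]) (auto simp: of_rat_mult of_rat_add)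
qed

lemma standard_part_eq_0_iff:
  assumes "x \<in> \<O>"
  shows "standard_part x = 0 \<longleftrightarrow> x \<in> \<mm>"
proof
  assume "standard_part x = 0"
  then have "standard_part (x * y) \<noteq> standard_part (1::'a)" if "y \<in> \<O>" for y
    using standard_part_mult[OF assms that] standard_part_of_rat[of 1, where ?'a = 'a] by simp
  then show "x \<in> \<mm>" using assms unfolding \<mm>_def by force
next
  assume m: "x \<in> \<mm>"
  show "standard_part x = 0"
  proof (rule standard_part_unique[OF assms])
    fix \<epsilon> :: rat
    assume e: "0 < \<epsilon>"
    have "\<bar>x\<bar> \<le> of_rat \<epsilon>"
    proof (rule ccontr)
      assume "\<not> ?thesis"
      then have x: "of_rat \<epsilon> < \<bar>x\<bar>" by simp
      have e': "(0::'a) < of_rat \<epsilon>" using e by simp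
      then have "x \<noteq> 0" using x by auto
      have "\<bar>inverse x\<bar> \<le> of_rat (inverse \<epsilon>)"
        using x e' le_imp_inverse_le[of "of_rat \<epsilon>" "\<bar>x\<bar>"] by (simp add: of_rat_inverse)
      then have "inverse x \<in> \<O>" unfolding \<O>_iff_abs using e by (intro exI[of _ "inverse \<epsilon>"]) simp
      then show False using m \<open>x \<noteq> 0\<close> unfolding \<mm>_def by force
    qed
    then show "\<exists>q. \<bar>x - of_rat q\<bar> \<le> of_rat \<epsilon> \<and> \<bar>0 - of_rat q\<bar> \<le> (of_rat \<epsilon> :: real)"
      using e by (intro exI[of _ 0]) simp
  qed
qed

end

theory Submission
  imports Defs
begin

text \<open>
  Let \<open>S\<close> be the map that multiplies one fixed coordinate by \<open>1 / 2\<close>. Conjugation with \<open>S\<close> takes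
  \<open>n\<close>-isomorphisms to \<open>n\<close>-isomorphisms, so \<open>S\<close> acts on the classes of bounded definable sets, and
  this action inverts doubling: \<open>S(A) + S(A) = A\<close> in the semigroup. Hence a set in \<open>2\<alpha>\<close> is carried
  by \<open>S\<close> to a set in \<open>\<alpha>\<close> (lemma \<open>half_of_double\<close>). If \<open>X\<close> in \<open>2\<alpha>\<close> and \<open>Y\<close> in \<open>2\<beta>\<close> differ by a set
  whose standard part is null, then so do \<open>S(X)\<close> in \<open>\<alpha>\<close> and \<open>S(Y)\<close> in \<open>\<beta>\<close>, because the standard
  part map commutes with \<open>S\<close> and \<open>S\<close> halves Lebesgue measure.

  To see that \<open>A\<close> is the sum of two copies of \<open>S(A)\<close>, cut each component \<open>(l, u)\<close> of each fibre of \<open>A\<close>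
  in the chosen direction at its midpoint. Translating the lower half by \<open>- l / 2\<close> and the upper half by
  \<open>- u / 2\<close> maps both onto \<open>(l / 2, u / 2)\<close>, a component of a fibre of \<open>S(A)\<close>
  (lemma \<open>iso_rel_double\<close>). The ends \<open>l\<close> and \<open>u\<close> are definable functions that do not change along
  the fibre, so these translations form a shear, whose Jacobian determinant is \<open>1\<close> wherever the function
  is continuously differentiable. What is needed, therefore, is that a definable function is continuously
  differentiable on a dense open set (lemma \<open>generic_C1\<close>). Moreover the relation on sets has to be an
  equivalence relation compatible with disjoint unions, since otherwise the sum of two classes would
  have no meaning; this comes down to the fact that a definable set of smaller dimension is exactly one
  whose complement contains a dense open set.

  These facts of o-minimal geometry are derived here from saturation rather than from a monotonicity or
  cell decomposition theorem. The tool is uniformity on a smaller domain: if every point \<open>t\<close> of an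
  interval satisfies a definable condition \<open>Q t \<rho>\<close> for some \<open>\<rho> > 0\<close>, and \<open>Q\<close> persists when \<open>\<rho>\<close>
  shrinks, then a single \<open>\<rho>\<close> works for all points of some subinterval (lemma \<open>uniform_on_interval\<close>).
  It turns pointwise statements with \<open>\<epsilon>\<close> and \<open>\<delta>\<close> into uniform ones, so that failure of continuity
  or differentiability on a whole interval is contradicted by two nearby points. Both the uniformity
  principle and generic continuity pass to cubes of higher dimension by induction on the set of
  directions of the cube (lemma \<open>generic_calculus\<close>).
\<close>

section \<open>Definable predicates and functions\<close>

lemma trm_val_cong:
  "(\<And>v. v \<in> set2_trm t \<Longrightarrow> e v = e' v) \<Longrightarrow> trm_val M e t = trm_val M e' t"
proof (induction t)
  case (Fun f ts)
  then have "map (trm_val M e) ts = map (trm_val M e') ts"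
    by (intro map_cong refl Fun.IH) auto
  then show ?case by (simp only: trm_val.simps)
qed auto

lemma sat_cong:
  "(\<And>v. v \<in> set3_form \<phi> \<Longrightarrow> e v = e' v) \<Longrightarrow> sat M e \<phi> = sat M e' \<phi>"
proof (induction \<phi> arbitrary: e e')
  case (Eq s t)
  then have "trm_val M e s = trm_val M e' s" "trm_val M e t = trm_val M e' t"
    by (intro trm_val_cong; simp)+
  then show ?case by simp
next
  case (Less s t)
  then have "trm_val M e s = trm_val M e' s" "trm_val M e t = trm_val M e' t"
    by (intro trm_val_cong; simp)+
  then show ?case by simp
next
  case (Rel r ts)
  then have "map (trm_val M e) ts = map (trm_val M e') ts"
    by (intro map_cong refl trm_val_cong) auto
  then show ?case by (simp only: sat.simps)
next
  case (Conj \<phi> \<psi>)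
  have "sat M e \<phi> = sat M e' \<phi>" by (rule Conj.IH(1)) (simp add: Conj.prems)
  moreover have "sat M e \<psi> = sat M e' \<psi>" by (rule Conj.IH(2)) (simp add: Conj.prems)
  ultimately show ?case by simp
next
  case (Ex v \<phi>)
  have "sat M (e(v := a)) \<phi> = sat M (e'(v := a)) \<phi>" for a
    by (rule Ex.IH) (simp add: Ex.prems)
  then show ?case by simp
next
  case (Neg \<phi>)
  have "sat M e \<phi> = sat M e' \<phi>" by (rule Neg.IH) (simp add: Neg.prems)
  then show ?case by simp
qed

lemma finite_set2_trm: "finite (set2_trm t)"
  by (induction t) auto

lemma finite_set3_form: "finite (set3_form \<phi>)"
  by (induction \<phi>) (auto simp: finite_set2_trm)

lemma trm_val_rename: "trm_val M e (map_trm id r t) = trm_val M (e \<circ> r) t"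
  by (induction t) (auto simp: o_def intro!: arg_cong[where f = "fun_interp M _"])

text \<open>
  The renaming may identify variables, and literal substitution could then capture free ones. The
  induction therefore replaces each bound variable by one that is not the image of any other variable.
\<close>

lemma sat_rename:
  fixes r :: "'v \<Rightarrow> 'w" and \<phi> :: "('f, 'r, 'v) form"
  assumes inf: "infinite (UNIV :: 'w set)"
  shows "\<exists>\<psi> :: ('f, 'r, 'w) form. \<forall>e. sat M e \<psi> \<longleftrightarrow> sat M (e \<circ> r) \<phi>"
proof (induction \<phi> arbitrary: r)
  case (Eq s t)
  show ?case
    by (rule exI[of _ "Eq (map_trm id r s) (map_trm id r t)"]) (simp add: trm_val_rename comp_def)
next
  case (Less s t)
  show ?case
    by (rule exI[of _ "Less (map_trm id r s) (map_trm id r t)"]) (simp add: trm_val_rename comp_def)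
next
  case (Rel R ts)
  show ?case
    by (rule exI[of _ "Rel R (map (map_trm id r) ts)"]) (simp add: trm_val_rename comp_def)
next
  case (Neg \<phi>)
  then obtain \<psi> :: "('f, 'r, 'w) form" where "\<forall>e. sat M e \<psi> \<longleftrightarrow> sat M (e \<circ> r) \<phi>" by blast
  then show ?case by (intro exI[of _ "Neg \<psi>"]) (simp add: comp_def)
next
  case (Conj \<phi>1 \<phi>2)
  obtain \<psi>1 :: "('f, 'r, 'w) form" where 1: "\<forall>e. sat M e \<psi>1 \<longleftrightarrow> sat M (e \<circ> r) \<phi>1" using Conj by blast
  obtain \<psi>2 :: "('f, 'r, 'w) form" where 2: "\<forall>e. sat M e \<psi>2 \<longleftrightarrow> sat M (e \<circ> r) \<phi>2" using Conj by blast
  show ?case using 1 2 by (intro exI[of _ "Conj \<psi>1 \<psi>2"]) (simp add: comp_def)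
next
  case (Ex v \<phi>)
  have "finite (r ` set3_form \<phi>)" by (simp add: finite_set3_form)
  then obtain w where w: "w \<notin> r ` set3_form \<phi>" using inf ex_new_if_finite by blast
  obtain \<psi> :: "('f, 'r, 'w) form" where \<psi>: "\<forall>e. sat M e \<psi> \<longleftrightarrow> sat M (e \<circ> r(v := w)) \<phi>"
    using Ex by blast
  have "sat M (e(w := a) \<circ> r(v := w)) \<phi> = sat M ((e \<circ> r)(v := a)) \<phi>" for e a
    using w by (intro sat_cong) auto
  then show ?case using \<psi> by (intro exI[of _ "Ex w \<psi>"]) (simp add: comp_def)
qed

lemma sat_Ex_finite:
  assumes "finite K"
  shows "\<exists>\<psi>. \<forall>e. sat M e \<psi> \<longleftrightarrow> (\<exists>y. sat M (\<lambda>v. if v \<in> K then y v else e v) \<phi>)"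
  using assms
proof (induction K)
  case empty
  then show ?case by (intro exI[of _ \<phi>]) simp
next
  case (insert k K)
  then obtain \<psi> where \<psi>: "\<And>e. sat M e \<psi> \<longleftrightarrow> (\<exists>y. sat M (\<lambda>v. if v \<in> K then y v else e v) \<phi>)"
    by blast
  have "(\<exists>a. sat M (e(k := a)) \<psi>) \<longleftrightarrow> (\<exists>y. sat M (\<lambda>v. if v \<in> insert k K then y v else e v) \<phi>)" for e
  proof
    assume "\<exists>a. sat M (e(k := a)) \<psi>"
    then obtain a y where y: "sat M (\<lambda>v. if v \<in> K then y v else (e(k := a)) v) \<phi>" unfolding \<psi> by blast
    have "(\<lambda>v. if v \<in> K then y v else (e(k := a)) v) =
        (\<lambda>v. if v \<in> insert k K then (y(k := a)) v else e v)"
      using insert(2) by auto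
    then show "\<exists>y. sat M (\<lambda>v. if v \<in> insert k K then y v else e v) \<phi>" using y by metis
  next
    assume "\<exists>y. sat M (\<lambda>v. if v \<in> insert k K then y v else e v) \<phi>"
    then obtain y where y: "sat M (\<lambda>v. if v \<in> insert k K then y v else e v) \<phi>" by blast
    have "(\<lambda>v. if v \<in> K then y v else (e(k := y k)) v) =
        (\<lambda>v. if v \<in> insert k K then y v else e v)"
      by auto
    then show "\<exists>a. sat M (e(k := a)) \<psi>" unfolding \<psi> using y by metis
  qed
  then show ?case by (intro exI[of _ "Ex k \<psi>"]) simp
qed

text \<open>
  The coordinate functions of a pair. A quantifier over \<open>'b\<close> in a predicate on \<open>'e\<close> leads to a
  predicate on \<open>'e \<times> 'b\<close>.
\<close>

definition pr :: "('e \<Rightarrow> 'a) set \<Rightarrow> ('b \<Rightarrow> 'a) set \<Rightarrow> ('e \<times> 'b \<Rightarrow> 'a) set" where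
  "pr C E = (\<lambda>c z. c (fst z)) ` C \<union> (\<lambda>e z. e (snd z)) ` E"

text \<open>
  The functions in \<open>E\<close> identify \<open>'b\<close> with a finite power of the field.
\<close>

definition coord_system :: "('b \<Rightarrow> 'a) set \<Rightarrow> bool" where
  "coord_system E \<longleftrightarrow> finite E \<and> (\<forall>y. \<exists>v. \<forall>e\<in>E. e v = y e) \<and>
     (\<forall>v w. (\<forall>e\<in>E. e v = e w) \<longrightarrow> v = w)"

definition sc :: "('a \<Rightarrow> 'a) set" where
  "sc = {\<lambda>t. t}"

definition vc :: "('a ^ 'n \<Rightarrow> 'a) set" where
  "vc = range (\<lambda>i v. v $ i)"

lemma pr_fst: "c \<in> C \<Longrightarrow> (\<lambda>z. c (fst z)) \<in> pr C E" by (auto simp: pr_def)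
lemma pr_snd: "e \<in> E \<Longrightarrow> (\<lambda>z. e (snd z)) \<in> pr C E" by (auto simp: pr_def)
lemma sc_mem: "(\<lambda>t. t) \<in> sc" by (simp add: sc_def)
lemma vc_mem: "(\<lambda>v. v $ i) \<in> vc" by (auto simp: vc_def)

lemma coord_system_sc: "coord_system sc"
  by (auto simp: coord_system_def sc_def)

lemma coord_system_vc: "coord_system (vc :: ('a ^ 'n::finite \<Rightarrow> 'a) set)"
  unfolding coord_system_def
proof (intro conjI allI)
  fix y :: "('a ^ 'n \<Rightarrow> 'a) \<Rightarrow> 'a"
  show "\<exists>v. \<forall>e\<in>vc. e v = y e"
    by (rule exI[of _ "\<chi> i. y (\<lambda>v. v $ i)"]) (auto simp: vc_def)
qed (auto simp: vc_def vec_eq_iff)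

lemma coord_system_pr:
  fixes C :: "('e \<Rightarrow> 'a) set" and E :: "('b \<Rightarrow> 'a) set"
  assumes C: "coord_system C" and E: "coord_system E"
  shows "coord_system (pr C E)"
  unfolding coord_system_def
proof (intro conjI allI impI)
  show "finite (pr C E)" using assms by (auto simp: pr_def coord_system_def)
  fix y :: "('e \<times> 'b \<Rightarrow> 'a) \<Rightarrow> 'a"
  obtain v where "\<forall>c\<in>C. c v = y (\<lambda>z. c (fst z))"
    using C[unfolded coord_system_def, THEN conjunct2, THEN conjunct1, rule_format,
        of "\<lambda>c. y (\<lambda>z. c (fst z))"] by blast
  moreover obtain w where "\<forall>e\<in>E. e w = y (\<lambda>z. e (snd z))"
    using E[unfolded coord_system_def, THEN conjunct2, THEN conjunct1, rule_format,
        of "\<lambda>e. y (\<lambda>z. e (snd z))"] by blast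
  ultimately show "\<exists>v. \<forall>e\<in>pr C E. e v = y e"
    by (intro exI[of _ "(v, w)"]) (auto simp: pr_def)
next
  fix v w :: "'e \<times> 'b"
  assume *: "\<forall>e\<in>pr C E. e v = e w"
  then have "\<forall>c\<in>C. c (fst v) = c (fst w)" "\<forall>e\<in>E. e (snd v) = e (snd w)"
    by (simp_all add: pr_def ball_Un)
  then show "v = w" using assms unfolding coord_system_def by (metis prod_eqI)
qed

locale definability =
  fixes M :: "('a::linordered_field, 'f, 'r) expansion"
begin

text \<open>
  Definability with parameters of a predicate on a type \<open>'e\<close> that is accessed through the coordinate
  functions in \<open>C\<close>; the constant functions supply the parameters. Because \<open>'e\<close> is arbitrary,
  definability can be derived by rules that follow the syntax of the predicate, each quantifier adding
  one component to a nested pair, without any choice of variable names.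
\<close>

definition dfn :: "('e \<Rightarrow> 'a) set \<Rightarrow> ('e \<Rightarrow> bool) \<Rightarrow> bool" where
  "dfn C P \<longleftrightarrow> (\<exists>(\<phi> :: ('f, 'r, nat) form) c. range c \<subseteq> C \<union> range (\<lambda>a _. a) \<and>
     P = (\<lambda>x. sat M (\<lambda>k. c k x) \<phi>))"

text \<open>
  Definability of a function through its graph.
\<close>

definition dterm :: "('e \<Rightarrow> 'a) set \<Rightarrow> ('e \<Rightarrow> 'a) \<Rightarrow> bool" where
  "dterm C t \<longleftrightarrow> dfn (pr C sc) (\<lambda>z. t (fst z) = snd z)"

text \<open>
  Only finitely many variables occur in a formula, so their names may come from any type.
\<close>

lemma dfn_formula:
  fixes \<phi> :: "('f, 'r, 'v) form"
  assumes c: "\<And>v. c v \<in> C \<or> (\<exists>a. c v = (\<lambda>_. a))" and P: "\<And>x. P x \<longleftrightarrow> sat M (\<lambda>v. c v x) \<phi>"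
  shows "dfn C P"
proof -
  obtain r :: "'v \<Rightarrow> nat" where r: "inj_on r (set3_form \<phi>)"
    using finite_imp_inj_to_nat_seg[OF finite_set3_form] by metis
  obtain \<psi> :: "('f, 'r, nat) form" where \<psi>: "\<And>e. sat M e \<psi> \<longleftrightarrow> sat M (e \<circ> r) \<phi>"
    using sat_rename[of M r \<phi>] by auto
  let ?c = "\<lambda>k. c (inv_into (set3_form \<phi>) r k)"
  have "sat M ((\<lambda>k. ?c k x) \<circ> r) \<phi> \<longleftrightarrow> sat M (\<lambda>v. c v x) \<phi>" for x
    using r by (intro sat_cong) simp
  then show ?thesis unfolding dfn_def using c P \<psi>
    by (intro exI[of _ \<psi>] exI[of _ ?c]) fastforce
qed

lemma dfnE:
  assumes "dfn C P"
  obtains \<phi> :: "('f, 'r, nat) form" and c where "\<And>v. c v \<in> C \<or> (\<exists>a. c v = (\<lambda>_. a))"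
    "\<And>x. P x \<longleftrightarrow> sat M (\<lambda>v. c v x) \<phi>"
  using assms unfolding dfn_def by (force simp: image_iff subset_iff)

lemma dfn_reindex:
  assumes "dfn C P" "\<And>c. c \<in> C \<Longrightarrow> (\<lambda>x. c (F x)) \<in> C' \<or> (\<exists>a. \<forall>x. c (F x) = a)"
  shows "dfn C' (\<lambda>x. P (F x))"
proof -
  obtain \<phi> :: "('f, 'r, nat) form" and c where "\<And>v. c v \<in> C \<or> (\<exists>a. c v = (\<lambda>_. a))"
    "\<And>x. P x \<longleftrightarrow> sat M (\<lambda>v. c v x) \<phi>" using assms(1) by (rule dfnE) blast
  then show ?thesis using assms(2)
    by (intro dfn_formula[of "\<lambda>v x. c v (F x)" _ _ \<phi>]) (auto, metis)
qed

lemma dfn_not: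
  assumes "dfn C P"
  shows "dfn C (\<lambda>x. \<not> P x)"
proof -
  obtain \<phi> :: "('f, 'r, nat) form" and c where "\<And>v. c v \<in> C \<or> (\<exists>a. c v = (\<lambda>_. a))"
    "\<And>x. P x \<longleftrightarrow> sat M (\<lambda>v. c v x) \<phi>" using assms(1) by (rule dfnE) blast
  then show ?thesis by (intro dfn_formula[of c _ _ "Neg \<phi>"]) auto
qed

lemma dfn_conj:
  assumes "dfn C P" "dfn C Q"
  shows "dfn C (\<lambda>x. P x \<and> Q x)"
proof -
  obtain \<phi> :: "('f, 'r, nat) form" and c where c: "\<And>v. c v \<in> C \<or> (\<exists>a. c v = (\<lambda>_. a))"
    "\<And>x. P x \<longleftrightarrow> sat M (\<lambda>v. c v x) \<phi>" using assms(1) by (rule dfnE) blast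
  obtain \<phi>' :: "('f, 'r, nat) form" and c' where c': "\<And>v. c' v \<in> C \<or> (\<exists>a. c' v = (\<lambda>_. a))"
    "\<And>x. Q x \<longleftrightarrow> sat M (\<lambda>v. c' v x) \<phi>'" using assms(2) by (rule dfnE) blast
  have inf: "infinite (UNIV :: (nat + nat) set)" by simp
  obtain \<psi> :: "('f, 'r, nat + nat) form" where \<psi>: "\<And>e. sat M e \<psi> \<longleftrightarrow> sat M (e \<circ> Inl) \<phi>"
    using sat_rename[OF inf, of M Inl \<phi>] by auto
  obtain \<psi>' :: "('f, 'r, nat + nat) form" where \<psi>': "\<And>e. sat M e \<psi>' \<longleftrightarrow> sat M (e \<circ> Inr) \<phi>'"
    using sat_rename[OF inf, of M Inr \<phi>'] by auto
  show ?thesis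
  proof (rule dfn_formula[of "case_sum c c'" _ _ "Conj \<psi> \<psi>'"])
    show "case_sum c c' v \<in> C \<or> (\<exists>a. case_sum c c' v = (\<lambda>_. a))" for v
      using c(1) c'(1) by (cases v) auto
  qed (simp add: \<psi> \<psi>' c(2) c'(2) o_def)
qed

lemma dfn_disj:
  assumes "dfn C P" "dfn C Q"
  shows "dfn C (\<lambda>x. P x \<or> Q x)"
proof -
  have "dfn C (\<lambda>x. \<not> (\<not> P x \<and> \<not> Q x))" using assms by (intro dfn_not dfn_conj)
  then show ?thesis by simp
qed

lemma dfn_imp:
  assumes "dfn C P" "dfn C Q"
  shows "dfn C (\<lambda>x. P x \<longrightarrow> Q x)"
proof -
  have "dfn C (\<lambda>x. \<not> P x \<or> Q x)" using assms by (intro dfn_disj dfn_not)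
  then show ?thesis by simp
qed

lemma dfn_iff:
  assumes "dfn C P" "dfn C Q"
  shows "dfn C (\<lambda>x. P x \<longleftrightarrow> Q x)"
proof -
  have "dfn C (\<lambda>x. (P x \<longrightarrow> Q x) \<and> (Q x \<longrightarrow> P x))" using assms by (intro dfn_conj dfn_imp)
  then show ?thesis by (simp add: iff_conv_conj_imp)
qed

lemma dfn_const: "dfn C (\<lambda>_. b)"
  by (rule dfn_formula[of "\<lambda>(_::nat) _. 0" _ _ "if b then Eq Zero Zero else Neg (Eq Zero Zero)"]) auto

lemma dfn_ball:
  assumes "finite A" "\<And>i. i \<in> A \<Longrightarrow> dfn C (P i)"
  shows "dfn C (\<lambda>x. \<forall>i\<in>A. P i x)"
  using assms by (induction A) (auto intro: dfn_const dfn_conj)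

lemma dfn_bex:
  assumes "finite A" "\<And>i. i \<in> A \<Longrightarrow> dfn C (P i)"
  shows "dfn C (\<lambda>x. \<exists>i\<in>A. P i x)"
  using assms by (induction A) (auto intro: dfn_const dfn_disj)

text \<open>
  Several variables of the formula may stand for the same coordinate of the quantified element. They
  are given the same name before they are quantified; the other variables keep their values.
\<close>

lemma dfn_ex_general:
  assumes E: "coord_system E" and P: "dfn (pr C E) (\<lambda>z. P (fst z) (snd z))"
  shows "dfn C (\<lambda>x. \<exists>v. P x v)"
proof -
  obtain \<phi> :: "('f, 'r, nat) form" and c where c: "\<And>k. c k \<in> pr C E \<or> (\<exists>a. c k = (\<lambda>_. a))"
    and \<phi>: "\<And>z. P (fst z) (snd z) \<longleftrightarrow> sat M (\<lambda>k. c k z) \<phi>" using P by (rule dfnE) blast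
  have "\<exists>u. (\<exists>e\<in>E. u = Inr e \<and> c k = (\<lambda>z. e (snd z))) \<or>
      (\<exists>d. (d \<in> C \<or> (\<exists>a. d = (\<lambda>_. a))) \<and> u = Inl d \<and> c k = (\<lambda>z. d (fst z)))" for k
    using c[of k] unfolding pr_def by blast
  then obtain u where u: "\<And>k. (\<exists>e\<in>E. u k = Inr e \<and> c k = (\<lambda>z. e (snd z))) \<or>
      (\<exists>d. (d \<in> C \<or> (\<exists>a. d = (\<lambda>_. a))) \<and> u k = Inl d \<and> c k = (\<lambda>z. d (fst z)))"
    by metis
  define r where "r k = (case u k of Inl _ \<Rightarrow> Inl k | Inr e \<Rightarrow> Inr e)" for k
  define d where "d k = (case u k of Inl d \<Rightarrow> d | Inr e \<Rightarrow> (\<lambda>_. 0))" for k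
  have inf: "infinite (UNIV :: (nat + ('b \<Rightarrow> 'a)) set)" by simp
  obtain \<psi> :: "('f, 'r, nat + ('b \<Rightarrow> 'a)) form" where \<psi>: "\<And>e. sat M e \<psi> \<longleftrightarrow> sat M (e \<circ> r) \<phi>"
    using sat_rename[OF inf, of M r \<phi>] by auto
  have fin: "finite (Inr ` E :: (nat + ('b \<Rightarrow> 'a)) set)" using E by (simp add: coord_system_def)
  obtain \<theta> where \<theta>: "\<And>e. sat M e \<theta> \<longleftrightarrow> (\<exists>y. sat M (\<lambda>v. if v \<in> Inr ` E then y v else e v) \<psi>)"
    using sat_Ex_finite[OF fin, of M \<psi>] by auto
  define env where
    "env x y v = (if v \<in> Inr ` E then y v else case_sum d (\<lambda>_ _. 0) v x)" for x y v
  have 1: "c k (x, w) = env x y (r k)" if "\<forall>e\<in>E. y (Inr e) = e w" for x w y k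
  proof (cases "u k")
    case (Inl d')
    then have "c k = (\<lambda>z. d' (fst z))" "r k = Inl k" "d k = d'"
      using u[of k] by (auto simp: r_def d_def)
    then show ?thesis by (simp add: env_def image_iff)
  next
    case (Inr e)
    then have "c k = (\<lambda>z. e (snd z))" "r k = Inr e" "e \<in> E"
      using u[of k] by (auto simp: r_def)
    then show ?thesis using that by (simp add: env_def)
  qed
  have 2: "P x w \<longleftrightarrow> sat M (env x y) \<psi>" if "\<forall>e\<in>E. y (Inr e) = e w" for x w y
  proof -
    have "(\<lambda>k. c k (x, w)) = env x y \<circ> r" using 1[OF that] by (intro ext) simp
    then show ?thesis using \<phi>[of "(x, w)"] by (simp only: \<psi> fst_conv snd_conv)
  qed
  have 3: "(\<exists>w. P x w) \<longleftrightarrow> (\<exists>y. sat M (env x y) \<psi>)" for x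
  proof
    assume "\<exists>w. P x w"
    then obtain w where "P x w" by blast
    then have "sat M (env x (case_sum (\<lambda>_. 0) (\<lambda>e. e w))) \<psi>"
      using 2[of "case_sum (\<lambda>_. 0) (\<lambda>e. e w)" w x] by simp
    then show "\<exists>y. sat M (env x y) \<psi>" by blast
  next
    assume "\<exists>y. sat M (env x y) \<psi>"
    then obtain y where y: "sat M (env x y) \<psi>" by blast
    obtain w where "\<forall>e\<in>E. e w = (y \<circ> Inr) e"
      using E unfolding coord_system_def by blast
    then show "\<exists>w. P x w" using y 2[of y w x] by auto
  qed
  show ?thesis
  proof (rule dfn_formula[of "case_sum d (\<lambda>_ _. 0)" _ _ \<theta>])
    show "case_sum d (\<lambda>_ _. 0) v \<in> C \<or> (\<exists>a. case_sum d (\<lambda>_ _. 0) v = (\<lambda>_. a))" for v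
    proof (cases v)
      case (Inl k)
      then show ?thesis using u[of k] by (auto simp: d_def)
    qed auto
    have "env x y = (\<lambda>v. if v \<in> Inr ` E then y v else case_sum d (\<lambda>_ _. 0) v x)" for x y
      by (rule ext) (simp add: env_def)
    then show "(\<exists>w. P x w) \<longleftrightarrow> sat M (\<lambda>v. case_sum d (\<lambda>_ _. 0) v x) \<theta>" for x
      by (simp only: 3 \<theta>)
  qed
qed

lemma dfn_ex: "dfn (pr C sc) (\<lambda>z. P (fst z) (snd z)) \<Longrightarrow> dfn C (\<lambda>x. \<exists>a. P x a)"
  by (rule dfn_ex_general[OF coord_system_sc])

lemma dfn_all:
  assumes "dfn (pr C sc) (\<lambda>z. P (fst z) (snd z))"
  shows "dfn C (\<lambda>x. \<forall>a. P x a)"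
proof -
  have "dfn C (\<lambda>x. \<not> (\<exists>a. \<not> P x a))" by (rule dfn_not, rule dfn_ex, rule dfn_not) (rule assms)
  then show ?thesis by simp
qed

lemma dfn_exv:
  "dfn (pr C vc) (\<lambda>z. P (fst z) (snd z)) \<Longrightarrow> dfn C (\<lambda>x. \<exists>v :: 'a ^ 'n::finite. P x v)"
  by (rule dfn_ex_general[OF coord_system_vc])

lemma dfn_allv:
  assumes "dfn (pr C vc) (\<lambda>z. P (fst z) (snd z))"
  shows "dfn C (\<lambda>x. \<forall>v :: 'a ^ 'n::finite. P x v)"
proof -
  have "dfn C (\<lambda>x. \<not> (\<exists>v. \<not> P x v))" by (rule dfn_not, rule dfn_exv, rule dfn_not) (rule assms)
  then show ?thesis by simp
qed

lemma dfn_eq_coord: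
  assumes "c \<in> C \<or> (\<exists>a. c = (\<lambda>_. a))" "d \<in> C \<or> (\<exists>a. d = (\<lambda>_. a))"
  shows "dfn C (\<lambda>x. c x = d x)"
  by (rule dfn_formula[of "\<lambda>b. if b then c else d" _ _ "Eq (Var True) (Var False)"])
    (use assms in auto)

lemma dterm_coord:
  assumes "c \<in> C"
  shows "dterm C c"
  unfolding dterm_def using assms
  by (intro dfn_eq_coord) (auto intro: pr_fst pr_snd[OF sc_mem])

lemma dterm_const: "dterm C (\<lambda>_. a)"
  unfolding dterm_def by (intro dfn_eq_coord) (auto intro: pr_snd[OF sc_mem])

text \<open>
  \<open>P (F x)\<close> holds iff some \<open>v\<close> with the coordinates of \<open>F x\<close> satisfies \<open>P\<close>, and this \<open>v\<close> can be
  quantified.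
\<close>

lemma dfn_subst:
  assumes E: "coord_system E" and P: "dfn E P" and F: "\<And>e. e \<in> E \<Longrightarrow> dterm C (\<lambda>x. e (F x))"
  shows "dfn C (\<lambda>x. P (F x))"
proof -
  have "dfn (pr C E) (\<lambda>z. e (F (fst z)) = e (snd z))" if "e \<in> E" for e
  proof -
    have "dfn (pr C E) (\<lambda>x. (\<lambda>z. e (F (fst z)) = snd z) (fst x, e (snd x)))"
      using F[OF that, unfolded dterm_def]
      by (rule dfn_reindex) (use that in \<open>auto simp: pr_def sc_def\<close>)
    then show ?thesis by simp
  qed
  then have "dfn (pr C E) (\<lambda>z. (\<forall>e\<in>E. e (F (fst z)) = e (snd z)) \<and> P (snd z))"
    using E P by (intro dfn_conj dfn_ball dfn_reindex[OF P])
      (auto simp: coord_system_def intro: pr_snd)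
  then have "dfn C (\<lambda>x. \<exists>v. (\<forall>e\<in>E. e (F x) = e v) \<and> P v)"
    by (rule dfn_ex_general[OF E, of C "\<lambda>x v. (\<forall>e\<in>E. e (F x) = e v) \<and> P v"])
  moreover have "(\<exists>v. (\<forall>e\<in>E. e (F x) = e v) \<and> P v) \<longleftrightarrow> P (F x)" for x
    using E unfolding coord_system_def by metis
  ultimately show ?thesis by simp
qed

lemma dterm_weaken:
  assumes "dterm C t" "\<And>c. c \<in> C \<Longrightarrow> (\<lambda>x. c (F x)) \<in> C'"
  shows "dterm C' (\<lambda>x. t (F x))"
proof -
  have "dfn (pr C' sc) (\<lambda>z. (\<lambda>z. t (fst z) = snd z) (F (fst z), snd z))"
    using assms(1)[unfolded dterm_def]
    by (rule dfn_reindex) (use assms(2) in \<open>force simp: pr_def sc_def\<close>)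
  then show ?thesis by (simp add: dterm_def)
qed

lemma dterm_subst:
  assumes E: "coord_system E" and P: "dterm E f" and F: "\<And>e. e \<in> E \<Longrightarrow> dterm C (\<lambda>x. e (F x))"
  shows "dterm C (\<lambda>x. f (F x))"
proof -
  have "dfn (pr C sc) (\<lambda>z. (\<lambda>z. f (fst z) = snd z) (F (fst z), snd z))"
  proof (rule dfn_subst[OF coord_system_pr[OF E coord_system_sc] P[unfolded dterm_def]])
    fix e
    assume "e \<in> pr E sc"
    then consider e' where "e' \<in> E" "e = (\<lambda>z. e' (fst z))" | "e = snd"
      by (auto simp: pr_def sc_def)
    then show "dterm (pr C sc) (\<lambda>z. e (F (fst z), snd z))"
    proof cases
      case 1
      then show ?thesis using dterm_weaken[OF F[OF 1(1)], of fst "pr C sc"] by (auto intro: pr_fst)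
    next
      case 2
      then show ?thesis using dterm_coord[of snd "pr C sc"] by (auto simp: pr_def sc_def)
    qed
  qed
  then show ?thesis by (simp add: dterm_def)
qed

lemma dfn_binary:
  assumes "dfn (pr sc sc) (\<lambda>z. P (fst z) (snd z))" "dterm C s" "dterm C t"
  shows "dfn C (\<lambda>x. P (s x) (t x))"
  by (rule dfn_subst[OF coord_system_pr[OF coord_system_sc coord_system_sc] assms(1),
        of _ "\<lambda>x. (s x, t x)", simplified])
    (use assms(2,3) in \<open>auto simp: pr_def sc_def\<close>)

lemma dterm_binary:
  assumes "dterm (pr sc sc) (\<lambda>z. f (fst z) (snd z))" "dterm C s" "dterm C t"
  shows "dterm C (\<lambda>x. f (s x) (t x))"
  by (rule dterm_subst[OF coord_system_pr[OF coord_system_sc coord_system_sc] assms(1),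
        of _ "\<lambda>x. (s x, t x)", simplified])
    (use assms(2,3) in \<open>auto simp: pr_def sc_def\<close>)

lemma dfn_eq: "dterm C s \<Longrightarrow> dterm C t \<Longrightarrow> dfn C (\<lambda>x. s x = t x)"
  by (rule dfn_binary[where P = "(=)"]) (auto intro!: dfn_eq_coord simp: pr_def sc_def)

lemma dfn_less: "dterm C s \<Longrightarrow> dterm C t \<Longrightarrow> dfn C (\<lambda>x. s x < t x)"
  by (rule dfn_binary[where P = "(<)"],
      rule dfn_formula[of "\<lambda>b. if b then fst else snd" _ _ "Less (Var True) (Var False)"])
    (auto simp: pr_def sc_def fun_eq_iff)

lemma dfn_le: "dterm C s \<Longrightarrow> dterm C t \<Longrightarrow> dfn C (\<lambda>x. s x \<le> t x)"
  using dfn_not[OF dfn_less, of C t s] by (simp add: not_less)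

lemma dtermI:
  assumes "\<And>x a. t x = a \<longleftrightarrow> G x a" "dfn (pr C sc) (\<lambda>z. G (fst z) (snd z))"
  shows "dterm C t"
  unfolding dterm_def using assms by simp

lemma dterm_add: "dterm C s \<Longrightarrow> dterm C t \<Longrightarrow> dterm C (\<lambda>x. s x + t x)"
  by (rule dterm_binary[where f = "(+)"], unfold dterm_def,
      rule dfn_formula[of "case_option snd (\<lambda>b. if b then fst \<circ> fst else snd \<circ> fst)" _ _
        "Eq (Plus (Var (Some True)) (Var (Some False))) (Var None)"])
    (auto simp: pr_def sc_def image_Un fun_eq_iff split: option.splits)

lemma dterm_mult: "dterm C s \<Longrightarrow> dterm C t \<Longrightarrow> dterm C (\<lambda>x. s x * t x)"
  by (rule dterm_binary[where f = "(*)"], unfold dterm_def,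
      rule dfn_formula[of "case_option snd (\<lambda>b. if b then fst \<circ> fst else snd \<circ> fst)" _ _
        "Eq (Times (Var (Some True)) (Var (Some False))) (Var None)"])
    (auto simp: pr_def sc_def image_Un fun_eq_iff split: option.splits)

lemma dterm_snd_sc: "dterm (pr C sc) (\<lambda>z. snd z)"
  by (rule dterm_coord) (rule pr_snd[OF sc_mem])

lemma dterm_fst: "dterm C t \<Longrightarrow> dterm (pr C E) (\<lambda>z. t (fst z))"
  by (rule dterm_weaken[of C t fst]) (auto intro: pr_fst)

lemma dterm_snd: "dterm E t \<Longrightarrow> dterm (pr C E) (\<lambda>z. t (snd z))"
  by (rule dterm_weaken[of E t snd]) (auto intro: pr_snd)

lemma dterm_sc: "dterm sc (\<lambda>t. t)"
  by (rule dterm_coord) (rule sc_mem)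

lemma dterm_vc: "dterm vc (\<lambda>v. v $ i)"
  by (rule dterm_coord) (rule vc_mem)

lemma dterm_uminus: "dterm C t \<Longrightarrow> dterm C (\<lambda>x. - t x)"
  using dterm_mult[OF dterm_const[of C "- 1"], of t] by simp

lemma dterm_diff: "dterm C s \<Longrightarrow> dterm C t \<Longrightarrow> dterm C (\<lambda>x. s x - t x)"
  using dterm_add[OF _ dterm_uminus, of C s t] by simp

lemma dterm_if:
  assumes "dfn C P" "dterm C s" "dterm C t"
  shows "dterm C (\<lambda>x. if P x then s x else t x)"
proof (rule dtermI[of _ "\<lambda>x a. (P x \<longrightarrow> s x = a) \<and> (\<not> P x \<longrightarrow> t x = a)"])
  show "dfn (pr C sc) (\<lambda>z. (P (fst z) \<longrightarrow> s (fst z) = snd z) \<and> (\<not> P (fst z) \<longrightarrow> t (fst z) = snd z))"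
    using dfn_reindex[OF assms(1), of fst "pr C sc"] assms(2,3)
    by (intro dfn_conj dfn_imp dfn_not dfn_eq dterm_fst dterm_snd_sc) (auto intro: pr_fst)
qed auto

lemma dterm_abs: "dterm C t \<Longrightarrow> dterm C (\<lambda>x. \<bar>t x\<bar>)"
  unfolding abs_if by (intro dterm_if dfn_less dterm_const dterm_uminus)

lemma dterm_sum:
  "finite A \<Longrightarrow> (\<And>i. i \<in> A \<Longrightarrow> dterm C (t i)) \<Longrightarrow> dterm C (\<lambda>x. \<Sum>i\<in>A. t i x)"
  by (induction A rule: finite_induct) (auto intro: dterm_const dterm_add)

lemma dfn_vec_subst:
  fixes F :: "'e \<Rightarrow> 'a ^ 'n::finite"
  assumes "dfn vc P" "\<And>i. dterm C (\<lambda>x. F x $ i)"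
  shows "dfn C (\<lambda>x. P (F x))"
  by (rule dfn_subst[OF coord_system_vc assms(1)]) (use assms(2) in \<open>auto simp: vc_def\<close>)

lemma dterm_vec_subst:
  fixes F :: "'e \<Rightarrow> 'a ^ 'n::finite"
  assumes "dterm vc f" "\<And>i. dterm C (\<lambda>x. F x $ i)"
  shows "dterm C (\<lambda>x. f (F x))"
  by (rule dterm_subst[OF coord_system_vc assms(1)]) (use assms(2) in \<open>auto simp: vc_def\<close>)

lemma definable_iff_dfn:
  fixes S :: "('i \<Rightarrow> 'a) set"
  shows "definable M S \<longleftrightarrow> dfn (range (\<lambda>i x. x i)) (\<lambda>x. x \<in> S)"
proof
  assume "definable M S"
  then obtain \<phi> :: "('f, 'r, 'i + nat) form" and e where S: "S = {x. sat M (case_sum x e) \<phi>}"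
    unfolding definable_def by blast
  show "dfn (range (\<lambda>i x. x i)) (\<lambda>x. x \<in> S)"
  proof (rule dfn_formula[of "case_sum (\<lambda>i x. x i) (\<lambda>k _. e k)" _ _ \<phi>])
    show "case_sum (\<lambda>i x. x i) (\<lambda>k _. e k) v \<in> range (\<lambda>i x. x i) \<or>
        (\<exists>a. case_sum (\<lambda>i x. x i) (\<lambda>k _. e k) v = (\<lambda>_. a))" for v
      by (cases v) auto
    have "sat M (\<lambda>v. case_sum (\<lambda>i x. x i) (\<lambda>k _. e k) v x) \<phi> = sat M (case_sum x e) \<phi>" for x
      by (rule arg_cong[where f = "\<lambda>e. sat M e \<phi>"]) (auto split: sum.splits)
    then show "(x \<in> S) = sat M (\<lambda>v. case_sum (\<lambda>i x. x i) (\<lambda>k _. e k) v x) \<phi>" for x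
      by (simp only: S mem_Collect_eq)
  qed
next
  assume "dfn (range (\<lambda>i x. x i)) (\<lambda>x. x \<in> S)"
  then obtain \<phi> :: "('f, 'r, nat) form" and c
    where c: "\<And>k. c k \<in> range (\<lambda>i x. x i) \<or> (\<exists>a. c k = (\<lambda>_. a))"
      and \<phi>: "\<And>x. x \<in> S \<longleftrightarrow> sat M (\<lambda>k. c k x) \<phi>" by (rule dfnE) blast
  have "\<exists>v. (\<exists>i. v = Inl i \<and> c k = (\<lambda>x. x i)) \<or> (\<exists>a. v = Inr a \<and> c k = (\<lambda>_. a))" for k
    using c[of k] by blast
  then obtain v where v: "\<And>k. (\<exists>i. v k = Inl i \<and> c k = (\<lambda>x. x i)) \<or> (\<exists>a. v k = Inr a \<and> c k = (\<lambda>_. a))"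
    by metis
  define r where "r k = (case v k of Inl i \<Rightarrow> Inl i | Inr _ \<Rightarrow> Inr k)" for k
  define e where "e k = (case v k of Inl i \<Rightarrow> 0 | Inr a \<Rightarrow> a)" for k
  have inf: "infinite (UNIV :: ('i + nat) set)" by simp
  obtain \<psi> :: "('f, 'r, 'i + nat) form" where \<psi>: "\<And>e. sat M e \<psi> \<longleftrightarrow> sat M (e \<circ> r) \<phi>"
    using sat_rename[OF inf, of M r \<phi>] by auto
  have "(\<lambda>k. c k x) = case_sum x e \<circ> r" for x
  proof
    show "c k x = (case_sum x e \<circ> r) k" for k using v[of k] by (auto simp: r_def e_def)
  qed
  then show "definable M S" unfolding definable_def using \<phi> \<psi>
    by (intro exI[of _ \<psi>] exI[of _ e]) auto
qed

lemma definable_set_iff_dfn: "definable_set M X \<longleftrightarrow> dfn vc (\<lambda>x. x \<in> (X :: ('a ^ 'n) set))"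
proof -
  have 1: "f \<in> vec_nth ` X \<longleftrightarrow> (\<chi> i. f i) \<in> X" for f
    by (metis (lifting) ext image_iff vec_lambda_beta vec_lambda_eta)
  show ?thesis unfolding definable_set_def definable_iff_dfn
  proof
    assume "dfn (range (\<lambda>i x. x i)) (\<lambda>x. x \<in> vec_nth ` X)"
    then have "dfn vc (\<lambda>x :: 'a ^ 'n. vec_nth x \<in> vec_nth ` X)"
      by (rule dfn_reindex) (auto simp: vc_def)
    then show "dfn vc (\<lambda>x. x \<in> X)" by (simp add: 1)
  next
    assume "dfn vc (\<lambda>x. x \<in> X)"
    then have "dfn (range (\<lambda>i x. x i)) (\<lambda>f. (\<chi> i. f i) \<in> X)"
      by (rule dfn_reindex) (auto simp: vc_def)
    then show "dfn (range (\<lambda>i x. x i)) (\<lambda>x. x \<in> vec_nth ` X)" by (simp add: 1)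
  qed
qed

lemma definable_map_iff_dfn:
  "definable_map M U (f :: 'a ^ 'n \<Rightarrow> 'a ^ 'm) \<longleftrightarrow>
     dfn (pr vc vc) (\<lambda>z. fst z \<in> U \<and> f (fst z) = snd z)"
proof -
  let ?S = "(\<lambda>x. case_sum (vec_nth x) (vec_nth (f x))) ` U"
  have 1: "g \<in> ?S \<longleftrightarrow> (\<chi> i. g (Inl i)) \<in> U \<and> f (\<chi> i. g (Inl i)) = (\<chi> i. g (Inr i))" (is "_ \<longleftrightarrow> ?R") for g
  proof
    assume ?R
    then have "g = (\<lambda>x. case_sum (vec_nth x) (vec_nth (f x))) (\<chi> i. g (Inl i))"
      by (auto split: sum.splits)
    then show "g \<in> ?S" using \<open>?R\<close> by blast
  qed auto
  have 2: "case_sum (vec_nth (fst z)) (vec_nth (snd z)) \<in> ?S \<longleftrightarrow> fst z \<in> U \<and> f (fst z) = snd z" for z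
    unfolding 1 by simp
  show ?thesis unfolding definable_map_def definable_iff_dfn
  proof
    assume "dfn (range (\<lambda>i x. x i)) (\<lambda>g. g \<in> ?S)"
    then have "dfn (pr vc vc) (\<lambda>z. case_sum (vec_nth (fst z)) (vec_nth (snd z)) \<in> ?S)"
    proof (rule dfn_reindex)
      fix c :: "('n + 'm \<Rightarrow> 'a) \<Rightarrow> 'a"
      assume "c \<in> range (\<lambda>i x. x i)"
      then obtain i where i: "c = (\<lambda>x. x i)" by blast
      show "(\<lambda>z. c (case_sum (vec_nth (fst z)) (vec_nth (snd z)))) \<in> pr vc vc \<or>
          (\<exists>a. \<forall>z. c (case_sum (vec_nth (fst z)) (vec_nth (snd z))) = a)"
        unfolding i by (cases i) (auto simp: pr_def vc_def)
    qed
    then show "dfn (pr vc vc) (\<lambda>z. fst z \<in> U \<and> f (fst z) = snd z)" unfolding 2 .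
  next
    assume "dfn (pr vc vc) (\<lambda>z. fst z \<in> U \<and> f (fst z) = snd z)"
    then have "dfn (range (\<lambda>i x. x i)) ((\<lambda>z. fst z \<in> U \<and> f (fst z) = snd z) \<circ>
        (\<lambda>g. (\<chi> i. g (Inl i), \<chi> i. g (Inr i))))"
      unfolding o_def by (rule dfn_reindex) (auto simp: pr_def vc_def)
    then show "dfn (range (\<lambda>i x. x i)) (\<lambda>g. g \<in> ?S)" by (simp add: 1 o_def)
  qed
qed

end

section \<open>The o-minimal line\<close>

context definability begin

lemma dterm_inverse:
  assumes "dterm C t"
  shows "dterm C (\<lambda>x. inverse (t x))"
proof (rule dtermI[of _ "\<lambda>x a. t x * a = 1 \<or> t x = 0 \<and> a = 0"])
  show "inverse (t x) = a \<longleftrightarrow> t x * a = 1 \<or> t x = 0 \<and> a = 0" for x a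
    by (cases "t x = 0") (auto simp: inverse_unique)
  show "dfn (pr C sc) (\<lambda>z. t (fst z) * snd z = 1 \<or> t (fst z) = 0 \<and> snd z = 0)"
    by (intro dfn_disj dfn_conj dfn_eq dterm_mult dterm_const dterm_fst dterm_snd_sc assms)
qed

lemma dterm_divide: "dterm C s \<Longrightarrow> dterm C t \<Longrightarrow> dterm C (\<lambda>x. s x / t x)"
  unfolding divide_inverse by (intro dterm_mult dterm_inverse)

lemma dterm_sc_subst:
  assumes "dterm sc f" "dterm C t"
  shows "dterm C (\<lambda>x. f (t x))"
  by (rule dterm_subst[OF coord_system_sc assms(1)]) (use assms(2) in \<open>auto simp: sc_def\<close>)

lemma dterm_fst_sc: "dterm (pr sc E) (\<lambda>z. fst z)"
  by (rule dterm_fst[OF dterm_sc])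

lemmas dterm_intros =
  dterm_const dterm_add dterm_mult dterm_diff dterm_uminus dterm_abs dterm_divide
  dterm_fst_sc dterm_snd_sc dterm_sc dterm_vc

lemmas dfn_intros =
  dfn_conj dfn_disj dfn_imp dfn_not dfn_iff dfn_less dfn_le dfn_eq dfn_all dfn_ex dfn_allv dfn_exv

text \<open>
  A definable function given by unique existence, with default value \<open>0\<close>.
\<close>

lemma dterm_the:
  assumes "\<And>x. (\<exists>a. G x a) \<Longrightarrow> (\<exists>!a. G x a)" "dfn (pr C sc) (\<lambda>z. G (fst z) (snd z))"
  shows "dterm C (\<lambda>x. if \<exists>a. G x a then THE a. G x a else 0)"
proof (rule dtermI[of _ "\<lambda>x a. G x a \<or> \<not> (\<exists>b. G x b) \<and> a = 0"])
  show "(if \<exists>a. G x a then THE a. G x a else 0) = a \<longleftrightarrow> G x a \<or> \<not> (\<exists>b. G x b) \<and> a = 0" for x a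
    using assms(1)[of x] theI'[of "G x"] by auto
  have "dfn C (\<lambda>x. \<exists>b. G x b)" using assms(2) by (rule dfn_ex)
  then have "dfn (pr C sc) (\<lambda>z. \<exists>b. G (fst z) b)"
    by (rule dfn_reindex) (auto intro: pr_fst)
  then show "dfn (pr C sc) (\<lambda>z. G (fst z) (snd z) \<or> \<not> (\<exists>b. G (fst z) b) \<and> snd z = 0)"
    by (intro dfn_disj assms dfn_conj dfn_not dfn_eq dterm_snd_sc dterm_const)
qed

end

locale o_minimal_structure = definability M
  for M :: "('a::{linordered_field,linorder_topology}, 'f, 'r) expansion" +
  assumes o_minimal: "o_minimal M"
    and saturated: "saturated (cardSuc (card_of (UNIV :: nat set set))) M"
begin

lemma definable_unit: "dfn sc P \<Longrightarrow> definable M {x :: unit \<Rightarrow> 'a. P (x ())}"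
  unfolding definable_iff_dfn mem_Collect_eq by (rule dfn_reindex) (auto simp: sc_def)

text \<open>
  A sequence of formulas has only countably many parameters altogether, fewer than the successor of
  the continuum.
\<close>

lemma countable_saturation:
  assumes P: "\<And>k :: nat. dfn sc (P k)" and ne: "\<And>k. \<exists>t. P k t"
    and dec: "\<And>k t. P (Suc k) t \<Longrightarrow> P k t"
  shows "\<exists>t. \<forall>k. P k t"
proof -
  have "\<exists>(\<phi> :: ('f, 'r, unit + nat) form) e. {x. P k (x ())} = {x. sat M (case_sum x e) \<phi>}" for k
    using definable_unit[OF P[of k]] unfolding definable_def .
  then obtain \<phi> :: "nat \<Rightarrow> ('f, 'r, unit + nat) form" and e
    where \<phi>: "\<And>k. {x. P k (x ())} = {x. sat M (case_sum x (e k)) (\<phi> k)}" by metis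
  have \<phi>': "sat M (case_sum (\<lambda>_. t) (e k)) (\<phi> k) \<longleftrightarrow> P k t" for k t
    using \<phi>[of k] by (auto simp: set_eq_iff dest!: spec[of _ "\<lambda>_. t"])
  define A where "A = (\<Union>k. range (e k))"
  have "countable A" unfolding A_def by auto
  then have "(card_of A, card_of (UNIV :: nat set)) \<in> ordLeq"
    by (metis card_of_ordLeq countableE subset_UNIV)
  moreover have "(card_of (UNIV :: nat set), card_of (UNIV :: nat set set)) \<in> ordLeq"
    by (metis card_of_ordLeq inj_singleton subset_UNIV)
  ultimately have "(card_of A, card_of (UNIV :: nat set set)) \<in> ordLeq"
    by (rule ordLeq_transitive)
  then have A: "(card_of A, cardSuc (card_of (UNIV :: nat set set))) \<in> ordLess"
    by (rule ordLeq_ordLess_trans) (rule cardSuc_greater[OF card_of_Card_order])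
  define p where "p = range (\<lambda>k. (\<phi> k, e k))"
  have mono: "P k t" if "P m t" "k \<le> m" for k m t
    using that(2,1) dec by (induction rule: inc_induct) auto
  have "\<exists>a. \<forall>(\<phi>, e)\<in>q. sat M (case_sum (\<lambda>_. a) e) \<phi>" if q: "q \<subseteq> p" "finite q" for q
  proof -
    obtain K where K: "finite K" "q = (\<lambda>k. (\<phi> k, e k)) ` K"
      using finite_subset_image[OF q(2) q(1)[unfolded p_def]] by blast
    obtain m where m: "\<forall>k\<in>K. k \<le> m" using K(1) by (metis finite_nat_set_iff_bounded_le)
    obtain t where "P m t" using ne by blast
    then have "\<forall>k\<in>K. P k t" using mono m by blast
    then show ?thesis unfolding K(2) by (auto simp: \<phi>')
  qed
  moreover have "\<forall>(\<phi>, e)\<in>p. range e \<subseteq> A" by (auto simp: p_def A_def)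
  ultimately obtain a where "\<forall>(\<phi>, e)\<in>p. sat M (case_sum (\<lambda>_. a) e) \<phi>"
    using saturated[unfolded saturated_def, rule_format, OF A, of p] by blast
  then show ?thesis by (auto simp: p_def \<phi>')
qed

lemma o_minimal_dfn:
  assumes "dfn sc P"
  obtains F where "finite F" "\<And>I. I \<in> F \<Longrightarrow> is_point_or_interval I" "{t. P t} = \<Union>F"
  using o_minimal[unfolded o_minimal_def, rule_format, of "{t. P t}"] definable_unit[OF assms]
  by auto

lemma is_point_or_interval_germ:
  fixes x :: 'a
  assumes "is_point_or_interval I"
  shows "\<exists>d>x. {x<..<d} \<subseteq> I \<or> {x<..<d} \<inter> I = {}"
proof -
  have gt: "\<exists>d>x. True" by (metis gt_ex)
  from assms consider a where "I = {a}" | a b where "I = {a<..<b}" | a where "I = {a<..}"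
    | b where "I = {..<b}" | "I = UNIV" unfolding is_point_or_interval_def by blast
  then show ?thesis
  proof cases
    case (1 a)
    obtain y where "y > x" using gt by blast
    then show ?thesis unfolding 1 by (intro exI[of _ "if x < a then a else y"]) auto
  next
    case (2 a b)
    obtain y where "y > x" using gt by blast
    then show ?thesis unfolding 2
      by (intro exI[of _ "if x < a then a else if x < b then b else y"]) auto
  next
    case (3 a)
    obtain y where "y > x" using gt by blast
    then show ?thesis unfolding 3 by (intro exI[of _ "if x < a then a else y"]) auto
  next
    case (4 b)
    obtain y where "y > x" using gt by blast
    then show ?thesis unfolding 4 by (intro exI[of _ "if x < b then b else y"]) auto
  next
    case 5
    then show ?thesis using gt by blast
  qed
qed

text \<open>
  A finite union of points and intervals contains or misses all points immediately to the right of \<open>x\<close>.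
  This is the form in which o-minimality is used most.
\<close>

lemma germ_decided:
  assumes "dfn sc P"
  obtains d where "x < d" "(\<forall>t. x < t \<and> t < d \<longrightarrow> P t) \<or> (\<forall>t. x < t \<and> t < d \<longrightarrow> \<not> P t)"
proof -
  obtain F where F: "finite F" "\<And>I. I \<in> F \<Longrightarrow> is_point_or_interval I" "{t. P t} = \<Union>F"
    using o_minimal_dfn[OF assms] by blast
  from F(1,2) have "\<exists>d>x. {x<..<d} \<subseteq> \<Union>F \<or> {x<..<d} \<inter> \<Union>F = {}"
  proof (induction F)
    case empty
    then show ?case using gt_ex[of x] by auto
  next
    case (insert I F)
    then obtain d where d: "x < d" "{x<..<d} \<subseteq> \<Union>F \<or> {x<..<d} \<inter> \<Union>F = {}" by auto
    obtain d' where d': "x < d'" "{x<..<d'} \<subseteq> I \<or> {x<..<d'} \<inter> I = {}"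
      using is_point_or_interval_germ[OF insert.prems[of I]] by blast
    have "x < min d d'" using d d' by simp
    moreover have "{x<..<min d d'} \<subseteq> \<Union>(insert I F) \<or> {x<..<min d d'} \<inter> \<Union>(insert I F) = {}"
    proof (cases "{x<..<d} \<subseteq> \<Union>F \<or> {x<..<d'} \<subseteq> I")
      case True
      then have "{x<..<min d d'} \<subseteq> \<Union>(insert I F)" by auto
      then show ?thesis ..
    next
      case False
      then have "{x<..<d} \<inter> \<Union>F = {}" "{x<..<d'} \<inter> I = {}" using d(2) d'(2) by blast+
      moreover have "{x<..<min d d'} \<subseteq> {x<..<d} \<inter> {x<..<d'}" by auto
      ultimately have "{x<..<min d d'} \<inter> \<Union>(insert I F) = {}" by blast
      then show ?thesis ..
    qed
    ultimately show ?case by blast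
  qed
  then obtain d where d: "x < d" "{x<..<d} \<subseteq> {t. P t} \<or> {x<..<d} \<inter> {t. P t} = {}"
    unfolding F(3) by blast
  then have "(\<forall>t. x < t \<and> t < d \<longrightarrow> P t) \<or> (\<forall>t. x < t \<and> t < d \<longrightarrow> \<not> P t)"
    by (auto simp: subset_eq disjoint_iff)
  then show ?thesis using that[OF d(1)] by blast
qed

lemma dense_interval:
  assumes "dfn sc P" "a < b" "\<And>c d. a \<le> c \<Longrightarrow> c < d \<Longrightarrow> d \<le> b \<Longrightarrow> \<exists>t. c < t \<and> t < d \<and> P t"
  obtains d where "a < d" "d \<le> b" "\<And>t. a < t \<Longrightarrow> t < d \<Longrightarrow> P t"
proof -
  obtain d where d: "a < d" "(\<forall>t. a < t \<and> t < d \<longrightarrow> P t) \<or> (\<forall>t. a < t \<and> t < d \<longrightarrow> \<not> P t)"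
    using germ_decided[OF assms(1)] .
  then have "a < min d b" using assms(2) by simp
  then obtain t where "a < t" "t < min d b" "P t" using assms(3)[of a "min d b"] by auto
  then show ?thesis using that[of "min d b"] d assms(2) by auto
qed

lemma infinite_dfn_interval:
  assumes "dfn sc P" "infinite {t. P t}"
  obtains c d where "c < d" "\<And>t. c < t \<Longrightarrow> t < d \<Longrightarrow> P t"
proof -
  obtain F where F: "finite F" "\<And>I. I \<in> F \<Longrightarrow> is_point_or_interval I" "{t. P t} = \<Union>F"
    using o_minimal_dfn[OF assms(1)] by blast
  then obtain I where I: "I \<in> F" "infinite I" using assms(2) by (metis finite_Union)
  have "\<exists>c d. c < d \<and> {c<..<d} \<subseteq> I"
    using F(2)[OF I(1)] I(2) unfolding is_point_or_interval_def
  proof (elim disjE exE)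
    fix a b assume "I = {a<..<b}"
    then show ?thesis using I(2) by (intro exI[of _ a] exI[of _ b])
        (metis finite.emptyI greaterThanLessThan_empty_iff linorder_not_le subset_refl)
  next
    fix a assume "I = {a<..}"
    then show ?thesis by (intro exI[of _ a] exI[of _ "a + 1"]) auto
  next
    fix b assume "I = {..<b}"
    then show ?thesis by (intro exI[of _ "b - 1"] exI[of _ b]) auto
  next
    assume "I = UNIV"
    then show ?thesis by (intro exI[of _ 0] exI[of _ 1]) auto
  qed auto
  then obtain c d where "c < d" "{c<..<d} \<subseteq> I" by blast
  moreover have "P t" if "t \<in> I" for t
  proof -
    have "t \<in> {t. P t}" unfolding F(3) using I(1) that by blast
    then show ?thesis by simp
  qed
  ultimately show ?thesis using that by (meson greaterThanLessThan_iff subsetD)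
qed

lemma dfn_lub:
  assumes "dfn sc P" "P t0" "\<And>t. P t \<Longrightarrow> t \<le> B"
  obtains s where "\<And>y. s \<le> y \<longleftrightarrow> (\<forall>t. P t \<longrightarrow> t \<le> y)"
proof -
  obtain F where F: "finite F" "\<And>I. I \<in> F \<Longrightarrow> is_point_or_interval I" "{t. P t} = \<Union>F"
    using o_minimal_dfn[OF assms(1)] by blast
  have lubI: "\<exists>s. \<forall>y. s \<le> y \<longleftrightarrow> (\<forall>t\<in>I. t \<le> y)"
    if "\<And>t. t \<in> I \<Longrightarrow> t \<le> s" "\<And>y. \<forall>t\<in>I. t \<le> y \<Longrightarrow> s \<le> y" for I :: "'a set" and s
    using that by (intro exI[of _ s] allI iffI) (auto intro: order_trans)
  have lub: "\<exists>s. \<forall>y. s \<le> y \<longleftrightarrow> (\<forall>t\<in>I. t \<le> y)"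
    if "is_point_or_interval I" "I \<noteq> {}" "\<forall>t\<in>I. t \<le> B" for I
    using that(1) unfolding is_point_or_interval_def
  proof (elim disjE exE)
    fix a assume "I = {a}"
    then show ?thesis by (intro lubI[of I a]) auto
  next
    fix a b assume I: "I = {a<..<b}"
    then have "a < b" using that(2) by auto
    have "b \<le> y" if y: "\<forall>t\<in>I. t \<le> y" for y
    proof (rule ccontr)
      assume "\<not> b \<le> y"
      then have "max a y < b" using \<open>a < b\<close> by auto
      then obtain t where "max a y < t" "t < b" using dense by blast
      then have "t \<in> I" "y < t" using I by auto
      then show False using y by auto
    qed
    moreover have "t \<le> b" if "t \<in> I" for t using that I by auto
    ultimately show ?thesis using lubI[of I b] by blast
  next
    fix a assume I: "I = {a<..}"
    have "max a B + 1 \<in> I" unfolding I by (simp add: max_def)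
    then have "max a B + 1 \<le> B" using that(3) by blast
    then show ?thesis by (auto simp: max_def split: if_splits)
  next
    fix b assume I: "I = {..<b}"
    have "b \<le> y" if y: "\<forall>t\<in>I. t \<le> y" for y
    proof (rule ccontr)
      assume "\<not> b \<le> y"
      then obtain t where "y < t" "t < b" using dense[of y b] by auto
      then show False using y I by (auto simp: not_le[symmetric])
    qed
    moreover have "t \<le> b" if "t \<in> I" for t using that I by auto
    ultimately show ?thesis using lubI[of I b] by blast
  next
    assume "I = UNIV"
    then show ?thesis using that(3) gt_ex[of B] by (auto simp: not_le[symmetric])
  qed
  have "\<exists>s. \<forall>y. s \<le> y \<longleftrightarrow> (\<forall>t\<in>\<Union>F. t \<le> y)" if "\<Union>F \<noteq> {}" "\<forall>t\<in>\<Union>F. t \<le> B"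
    using F(1,2) that
  proof (induction F)
    case (insert I F)
    show ?case
    proof (cases "I = {}")
      case True
      then show ?thesis using insert by auto
    next
      case I: False
      then obtain s where s: "\<forall>y. s \<le> y \<longleftrightarrow> (\<forall>t\<in>I. t \<le> y)" using lub[of I] insert by auto
      show ?thesis
      proof (cases "\<Union>F = {}")
        case True
        then have "\<Union>(insert I F) = I" by auto
        then show ?thesis using s by auto
      next
        case False
        then obtain s' where s': "\<forall>y. s' \<le> y \<longleftrightarrow> (\<forall>t\<in>\<Union>F. t \<le> y)" using insert by auto
        then have "\<forall>y. max s s' \<le> y \<longleftrightarrow> (\<forall>t\<in>\<Union>(insert I F). t \<le> y)"
          by (simp add: s[rule_format] s'[rule_format] ball_Un)
        then show ?thesis by (rule exI)
      qed
    qed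
  qed auto
  moreover have "P t \<longleftrightarrow> t \<in> \<Union>F" for t unfolding F(3)[symmetric] by simp
  ultimately have "\<exists>s. \<forall>y. s \<le> y \<longleftrightarrow> (\<forall>t. P t \<longrightarrow> t \<le> y)"
    using assms(2,3) by (metis (no_types, lifting) empty_iff)
  then show ?thesis using that by blast
qed

text \<open>
  For each \<open>k\<close> some \<open>\<rho>\<close> is good for \<open>k\<close> points at once, namely the least of \<open>k\<close> radii. By
  saturation some \<open>\<rho>\<close> is good for at least \<open>k\<close> points for every \<open>k\<close>. The set of points for which it is
  good is definable and infinite, so it contains an interval.
\<close>

lemma uniform_on_interval:
  assumes Q: "dfn (pr sc sc) (\<lambda>z. Q (fst z) (snd z))"
    and down: "\<And>t \<rho> \<rho>'. Q t \<rho> \<Longrightarrow> 0 < \<rho>' \<Longrightarrow> \<rho>' \<le> \<rho> \<Longrightarrow> Q t \<rho>'"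
    and ab: "a < b" and ex: "\<And>t. a < t \<Longrightarrow> t < b \<Longrightarrow> \<exists>\<rho>>0. Q t \<rho>"
  obtains \<rho> c d where "0 < \<rho>" "c < d" "\<And>t. c < t \<Longrightarrow> t < d \<Longrightarrow> a < t \<and> t < b \<and> Q t \<rho>"
proof -
  \<comment> \<open>\<open>N k \<rho> s\<close>: there are \<open>k\<close> points \<open>t\<close> in \<open>(s, b)\<close> with \<open>Q t \<rho>\<close>\<close>
  define N where "N = rec_nat (\<lambda>_ _. True) (\<lambda>_ N \<rho> s. \<exists>t. s < t \<and> t < b \<and> Q t \<rho> \<and> N \<rho> t)"
  have N0: "N 0 \<rho> s" for \<rho> s by (simp add: N_def)
  have NS: "N (Suc k) \<rho> s \<longleftrightarrow> (\<exists>t. s < t \<and> t < b \<and> Q t \<rho> \<and> N k \<rho> t)" for k \<rho> s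
    by (simp add: N_def)
  have dfnN: "dfn (pr sc sc) (\<lambda>z. N k (fst z) (snd z))" for k
  proof (induction k)
    case 0
    then show ?case by (simp add: N0 dfn_const)
  next
    case (Suc k)
    show ?case unfolding NS
      by (intro dfn_ex dfn_conj dfn_less dterm_intros dfn_binary[OF Q] dfn_binary[OF Suc]
          dterm_fst[OF dterm_fst_sc] dterm_fst)
  qed
  have Ndown: "N k \<rho>' s" if "N k \<rho> s" "0 < \<rho>'" "\<rho>' \<le> \<rho>" for k \<rho> \<rho>' s
    using that by (induction k arbitrary: s) (auto simp: N0 NS intro: down)
  have Ndec: "N k \<rho> s" if "N (Suc k) \<rho> s" for k \<rho> s
    using that by (induction k arbitrary: s) (auto simp: N0 NS)
  have Nex: "\<exists>\<rho>>0. N k \<rho> s" if "a \<le> s" "s < b" for k s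
    using that
  proof (induction k arbitrary: s)
    case 0
    then show ?case using zero_less_one N0 by blast
  next
    case (Suc k)
    obtain t where t: "s < t" "t < b" using dense Suc by blast
    obtain \<rho> where \<rho>: "0 < \<rho>" "Q t \<rho>" using ex t Suc by (meson order_le_less_trans)
    obtain \<rho>' where \<rho>': "0 < \<rho>'" "N k \<rho>' t" using Suc t by (meson less_imp_le order_trans)
    have "N (Suc k) (min \<rho> \<rho>') s" unfolding NS using t \<rho> \<rho>'
      by (intro exI[of _ t]) (auto intro: down[OF \<rho>(2)] Ndown[OF \<rho>'(2)])
    then show ?case using \<rho> \<rho>' by (intro exI[of _ "min \<rho> \<rho>'"]) auto
  qed
  have "\<exists>\<rho>. \<forall>k. 0 < \<rho> \<and> N k \<rho> a"
  proof (rule countable_saturation)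
    show "dfn sc (\<lambda>\<rho>. 0 < \<rho> \<and> N k \<rho> a)" for k
      by (intro dfn_conj dfn_less dterm_intros dfn_binary[OF dfnN])
  qed (use Nex ab Ndec in auto)
  then obtain \<rho> where \<rho>: "0 < \<rho>" "\<And>k. N k \<rho> a" by blast
  let ?T = "{t. a < t \<and> t < b \<and> Q t \<rho>}"
  have "infinite ?T"
  proof
    assume fin: "finite ?T"
    have "k \<le> card {t \<in> ?T. s < t}" if "N k \<rho> s" "a \<le> s" for k s
      using that
    proof (induction k arbitrary: s)
      case (Suc k)
      then obtain t where t: "s < t" "t < b" "Q t \<rho>" "N k \<rho> t" unfolding NS by blast
      then have "k \<le> card {u \<in> ?T. t < u}" using Suc by auto
      moreover have "insert t {u \<in> ?T. t < u} \<subseteq> {u \<in> ?T. s < u}" using t Suc.prems by auto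
      then have "card (insert t {u \<in> ?T. t < u}) \<le> card {u \<in> ?T. s < u}"
        by (intro card_mono finite_subset[OF _ fin]) auto
      moreover have "card (insert t {u \<in> ?T. t < u}) = Suc (card {u \<in> ?T. t < u})"
        by (intro card_insert_disjoint finite_subset[OF _ fin]) auto
      ultimately show ?case by linarith
    qed simp
    from this[OF \<rho>(2)[of "Suc (card {t \<in> ?T. a < t})"]] show False by auto
  qed
  moreover have "dfn sc (\<lambda>t. a < t \<and> t < b \<and> Q t \<rho>)"
    by (intro dfn_conj dfn_less dterm_intros dfn_binary[OF Q])
  ultimately obtain c d where "c < d" "\<And>t. c < t \<Longrightarrow> t < d \<Longrightarrow> a < t \<and> t < b \<and> Q t \<rho>"
    using infinite_dfn_interval by blast
  then show ?thesis using that \<rho>(1) by blast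
qed

text \<open>
  The eventual lower bounds of \<open>f\<close> to the right of \<open>x\<close> form an initial segment. By o-minimality, it is
  empty, everything, or has a supremum; in the last case the supremum is the limit.
\<close>

lemma right_limit_cases:
  assumes f: "dterm sc f"
  shows "(\<forall>y. \<exists>d>x. \<forall>t. x < t \<and> t < d \<longrightarrow> y \<le> f t) \<or>
    (\<forall>y. \<exists>d>x. \<forall>t. x < t \<and> t < d \<longrightarrow> f t \<le> y) \<or>
    (\<exists>L. \<forall>\<epsilon>>0. \<exists>d>x. \<forall>t. x < t \<and> t < d \<longrightarrow> \<bar>f t - L\<bar> \<le> \<epsilon>)"
proof -
  define P where "P y \<longleftrightarrow> (\<exists>d>x. \<forall>t. x < t \<and> t < d \<longrightarrow> y \<le> f t)" for y
  have P: "dfn sc P" unfolding P_def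
    by (intro dfn_intros dterm_sc_subst[OF f] dterm_intros dterm_fst)
  have nP: "\<exists>d>x. \<forall>t. x < t \<and> t < d \<longrightarrow> f t < y" if "\<not> P y" for y
  proof -
    have "dfn sc (\<lambda>t. y \<le> f t)" by (intro dfn_intros f dterm_intros)
    from germ_decided[OF this, of x] that show ?thesis unfolding P_def by (metis not_le)
  qed
  show ?thesis
  proof (cases "(\<forall>y. P y) \<or> (\<forall>y. \<not> P y)")
    case True
    then show ?thesis
    proof
      assume "\<forall>y. P y"
      then show ?thesis unfolding P_def by simp
    next
      assume "\<forall>y. \<not> P y"
      then have "\<exists>d>x. \<forall>t. x < t \<and> t < d \<longrightarrow> f t \<le> y" for y
        using nP[of y] less_imp_le by blast
      then show ?thesis by blast
    qed
  next
    case False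
    then obtain y0 y1 where y: "P y0" "\<not> P y1" by blast
    have down: "P y'" if "P y" "y' \<le> y" for y y' using that unfolding P_def by (meson order_trans)
    then have "t \<le> y1" if "P t" for t using that y(2) by (meson linear)
    then obtain L where L: "\<And>y. L \<le> y \<longleftrightarrow> (\<forall>t. P t \<longrightarrow> t \<le> y)" using dfn_lub[OF P y(1)] by blast
    have "\<exists>d>x. \<forall>t. x < t \<and> t < d \<longrightarrow> \<bar>f t - L\<bar> \<le> \<epsilon>" if "0 < \<epsilon>" for \<epsilon>
    proof -
      have "\<not> L \<le> L - \<epsilon>" using that by simp
      then obtain u where "P u" "L - \<epsilon> < u" unfolding L by auto
      then have "P (L - \<epsilon>)" using down by auto
      then obtain d where d: "x < d" "\<forall>t. x < t \<and> t < d \<longrightarrow> L - \<epsilon> \<le> f t" unfolding P_def by blast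
      have "\<not> P (L + \<epsilon>)" using L[of L] that by auto
      then obtain d' where d': "x < d'" "\<forall>t. x < t \<and> t < d' \<longrightarrow> f t < L + \<epsilon>" using nP by blast
      show ?thesis using d d' by (intro exI[of _ "min d d'"]) (auto simp: abs_le_iff algebra_simps)
    qed
    then show ?thesis by blast
  qed
qed

definition cont1 :: "('a \<Rightarrow> 'a) \<Rightarrow> 'a \<Rightarrow> bool" where
  "cont1 f t \<longleftrightarrow> (\<forall>\<epsilon>>0. \<exists>\<delta>>0. \<forall>u. \<bar>u - t\<bar> < \<delta> \<longrightarrow> \<bar>f u - f t\<bar> < \<epsilon>)"

lemma dfn_cont1:
  assumes f: "dterm sc f"
  shows "dfn sc (cont1 f)"
  unfolding cont1_def
  by (intro dfn_intros dterm_sc_subst[OF f] dterm_intros dterm_fst)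

text \<open>
  On a subinterval \<open>f\<close> is bounded, by uniformity. If \<open>f\<close> were nowhere continuous there, uniformity
  would give one lower bound for its oscillation at all points of a smaller interval. But \<open>f\<close> has a
  finite limit at the left end of that interval, hence small oscillation near it.
\<close>

lemma exists_continuity_point:
  assumes f: "dterm sc f" and "a < b"
  obtains t where "a < t" "t < b" "cont1 f t"
proof (rule ccontr)
  note wit = that
  assume n: "\<not> thesis"
  have nc: "\<not> cont1 f t" if "a < t" "t < b" for t using n wit[OF that] by blast
  have "dfn (pr sc sc) (\<lambda>z. snd z * \<bar>f (fst z)\<bar> \<le> 1)"
    by (intro dfn_intros dterm_sc_subst[OF f] dterm_intros)
  moreover have "\<rho>' * \<bar>f t\<bar> \<le> 1" if "\<rho> * \<bar>f t\<bar> \<le> 1" "0 < \<rho>'" "\<rho>' \<le> \<rho>" for \<rho> \<rho>' t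
    using that by (meson abs_ge_zero mult_right_mono order_trans)
  moreover have "\<exists>\<rho>>0. \<rho> * \<bar>f t\<bar> \<le> 1" for t
    by (rule exI[of _ "1 / (1 + \<bar>f t\<bar>)"]) (auto simp: divide_simps add_pos_nonneg)
  ultimately obtain B c d where B: "0 < B" "c < d"
    "\<And>t. c < t \<Longrightarrow> t < d \<Longrightarrow> a < t \<and> t < b \<and> B * \<bar>f t\<bar> \<le> 1"
    using uniform_on_interval[of "\<lambda>t \<rho>. \<rho> * \<bar>f t\<bar> \<le> 1", OF _ _ assms(2)] by blast
  let ?Q = "\<lambda>t \<eta>. \<forall>\<delta>>0. \<exists>u. \<bar>u - t\<bar> < \<delta> \<and> \<eta> \<le> \<bar>f u - f t\<bar>"
  have "dfn (pr sc sc) (\<lambda>z. ?Q (fst z) (snd z))"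
    by (intro dfn_intros dterm_sc_subst[OF f] dterm_intros dterm_fst dterm_snd)
  moreover have "?Q t \<eta>'" if "?Q t \<eta>" "0 < \<eta>'" "\<eta>' \<le> \<eta>" for t \<eta> \<eta>'
    using that by (meson order_trans)
  moreover have "\<exists>\<eta>>0. ?Q t \<eta>" if "c < t" "t < d" for t
    using nc[of t] B(3)[OF that] unfolding cont1_def by (meson not_less)
  ultimately obtain \<eta> c' d' where \<eta>: "0 < \<eta>" "c' < d'"
    "\<And>t. c' < t \<Longrightarrow> t < d' \<Longrightarrow> c < t \<and> t < d \<and> ?Q t \<eta>"
    using uniform_on_interval[of ?Q, OF _ _ B(2)] by blast
  have bd: "\<bar>f t\<bar> \<le> 1 / B" if "c' < t" "t < d'" for t
    using B(1) B(3)[of t] \<eta>(3)[OF that] by (auto simp: field_simps)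
  have "\<not> (\<forall>y. \<exists>d>c'. \<forall>t. c' < t \<and> t < d \<longrightarrow> y \<le> f t)"
  proof
    assume "\<forall>y. \<exists>d>c'. \<forall>t. c' < t \<and> t < d \<longrightarrow> y \<le> f t"
    then obtain e where e: "c' < e" "\<And>t. c' < t \<Longrightarrow> t < e \<Longrightarrow> 1 / B + 1 \<le> f t" by metis
    obtain t where "c' < t" "t < min e d'" using dense[of c' "min e d'"] e \<eta>(2) by auto
    then show False using bd[of t] e(2)[of t] by auto
  qed
  moreover have "\<not> (\<forall>y. \<exists>d>c'. \<forall>t. c' < t \<and> t < d \<longrightarrow> f t \<le> y)"
  proof
    assume "\<forall>y. \<exists>d>c'. \<forall>t. c' < t \<and> t < d \<longrightarrow> f t \<le> y"
    then obtain e where e: "c' < e" "\<And>t. c' < t \<Longrightarrow> t < e \<Longrightarrow> f t \<le> - (1 / B) - 1" by metis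
    obtain t where "c' < t" "t < min e d'" using dense[of c' "min e d'"] e \<eta>(2) by auto
    then show False using bd[of t] e(2)[of t] by auto
  qed
  ultimately obtain L where L: "\<And>\<epsilon>. 0 < \<epsilon> \<Longrightarrow> \<exists>d>c'. \<forall>t. c' < t \<and> t < d \<longrightarrow> \<bar>f t - L\<bar> \<le> \<epsilon>"
    using right_limit_cases[OF f, of c'] by blast
  obtain e where e: "c' < e" "\<And>t. c' < t \<Longrightarrow> t < e \<Longrightarrow> \<bar>f t - L\<bar> \<le> \<eta> / 3"
    using L[of "\<eta> / 3"] \<eta>(1) by auto
  obtain t where t: "c' < t" "t < min e d'" using dense[of c' "min e d'"] e \<eta>(2) by auto
  then obtain u where u: "\<bar>u - t\<bar> < min (t - c') (e - t)" "\<eta> \<le> \<bar>f u - f t\<bar>"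
    using \<eta>(3)[of t] by (metis diff_gt_0_iff_gt min_less_iff_conj)
  have "\<bar>f u - L\<bar> \<le> \<eta> / 3" using u(1) by (intro e(2)) (auto simp: abs_less_iff)
  moreover have "\<bar>f t - L\<bar> \<le> \<eta> / 3" using t by (intro e(2)) auto
  ultimately have "\<bar>f u - f t\<bar> \<le> \<eta> / 3 + \<eta> / 3" by linarith
  moreover have "\<eta> / 3 + \<eta> / 3 < \<eta>" using \<eta>(1) by simp
  ultimately show False using u(2) by linarith
qed

end

section \<open>Differentiability in one variable\<close>

context o_minimal_structure begin

lemma dense_interval_ex:
  assumes "dfn sc P" "a < b" "\<forall>c d. c < d \<longrightarrow> a \<le> c \<and> d \<le> b \<longrightarrow> (\<exists>t. c < t \<and> t < d \<and> P t)"
  shows "\<exists>d. a < d \<and> d \<le> b \<and> (\<forall>t. a < t \<and> t < d \<longrightarrow> P t)"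
  by (rule dense_interval[OF assms(1,2)]) (use assms(3) in blast)+

text \<open>
  Compare \<open>f\<close> with the line through its value at \<open>p\<close> whose slope \<open>m\<close> is larger than the slope of the
  chord from \<open>p\<close> to \<open>q\<close>. The points up to which \<open>f\<close> stays above the line have a supremum; by continuity
  and the hypothesis on slopes it can only be \<open>q\<close>, where \<open>f\<close> is below the line.
\<close>

lemma no_infinite_slope:
  assumes f: "dterm sc f" and "a < b" and cont: "\<And>t. a < t \<Longrightarrow> t < b \<Longrightarrow> cont1 f t"
    and inf: "\<And>t m. a < t \<Longrightarrow> t < b \<Longrightarrow> \<exists>\<delta>>0. \<forall>h. 0 < h \<and> h < \<delta> \<longrightarrow> m * h \<le> f (t + h) - f t"
  shows False
proof -
  obtain p where p: "a < p" "p < b" using dense[OF assms(2)] by blast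
  obtain q where q: "p < q" "q < b" using dense[OF p(2)] by blast
  \<comment> \<open>one more than the slope of the chord from \<open>p\<close> to \<open>q\<close>\<close>
  define m where "m = (f q - f p) / (q - p) + 1"
  define g where "g t = f t - f p - m * (t - p)" for t
  have "m * (q - p) = f q - f p + (q - p)" using q(1) by (simp add: m_def distrib_right)
  then have gq: "g q < 0" using q(1) by (simp add: g_def)
  have gp: "g p = 0" by (simp add: g_def)
  define S where "S t \<longleftrightarrow> p \<le> t \<and> t \<le> q \<and> (\<forall>s. p \<le> s \<and> s \<le> t \<longrightarrow> 0 \<le> g s)" for t
  have "dfn sc S" unfolding S_def g_def
    by (intro dfn_intros dterm_sc_subst[OF f] dterm_intros dterm_fst)
  moreover have "S p" using q(1) by (auto simp: S_def gp)
  moreover have "t \<le> q" if "S t" for t using that by (simp add: S_def)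
  ultimately obtain T where T: "\<And>y. T \<le> y \<longleftrightarrow> (\<forall>t. S t \<longrightarrow> t \<le> y)" using dfn_lub by blast
  have pT: "p \<le> T" using T[of T] \<open>S p\<close> by auto
  have Tq: "T \<le> q" unfolding T by (auto simp: S_def)
  have below: "0 \<le> g s" if "p \<le> s" "s < T" for s
    using T[of s] that by (auto simp: S_def not_le intro: less_imp_le)
  have "0 \<le> g T"
  proof (rule ccontr)
    assume neg: "\<not> 0 \<le> g T"
    define e where "e = - g T / 2"
    have e: "0 < e" using neg by (simp add: e_def)
    have "cont1 f T" using cont p(1) pT Tq q(2) by auto
    then obtain \<delta> where \<delta>: "0 < \<delta>" "\<And>u. \<bar>u - T\<bar> < \<delta> \<Longrightarrow> \<bar>f u - f T\<bar> < e"
      unfolding cont1_def using e by blast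
    have "p < T" using pT neg gp by (cases "p = T") auto
    define k where "k = min (\<delta> / 2) (min (T - p) (e / (\<bar>m\<bar> + 1)))"
    have k: "0 < k" "k < \<delta>" "k \<le> T - p" "k \<le> e / (\<bar>m\<bar> + 1)"
      using \<delta>(1) \<open>p < T\<close> e by (auto simp: k_def min_less_iff_disj add_nonneg_pos)
    have "k * (\<bar>m\<bar> + 1) \<le> e" using k(4) by (subst (asm) pos_le_divide_eq) auto
    then have mk: "m * k \<le> e"
    proof -
      have "m \<le> \<bar>m\<bar> + 1" by simp
      then have "m * k \<le> (\<bar>m\<bar> + 1) * k" using k(1) by (intro mult_right_mono) auto
      then show ?thesis using \<open>k * (\<bar>m\<bar> + 1) \<le> e\<close> by (simp add: mult.commute)
    qed
    have "\<bar>f (T - k) - f T\<bar> < e" using k by (intro \<delta>(2)) auto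
    then have "g (T - k) < g T + e + m * k" by (simp add: g_def algebra_simps)
    then have "g (T - k) < 0" using mk unfolding e_def by (simp add: field_simps)
    moreover have "0 \<le> g (T - k)" using k by (intro below) auto
    ultimately show False by simp
  qed
  then have "T < q" using gq Tq by (cases "T = q") auto
  obtain \<delta> where \<delta>: "0 < \<delta>" "\<And>h. 0 < h \<and> h < \<delta> \<Longrightarrow> m * h \<le> f (T + h) - f T"
    using inf[of T m] p(1) pT Tq q(2) by auto
  have above: "0 \<le> g (T + h)" if "0 < h" "h < \<delta>" for h
    using \<delta>(2)[of h] that \<open>0 \<le> g T\<close> by (simp add: g_def algebra_simps)
  define h where "h = min (\<delta> / 2) (q - T)"
  have h: "0 < h" "h < \<delta>" "h \<le> q - T" using \<delta>(1) \<open>T < q\<close> by (auto simp: h_def min_less_iff_disj)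
  have "0 \<le> g s" if "p \<le> s" "s \<le> T + h" for s
  proof -
    consider "s < T" | "s = T" | "T < s" by fastforce
    then show ?thesis using below above[of "s - T"] \<open>0 \<le> g T\<close> that h by cases auto
  qed
  then have "S (T + h)" using pT h by (auto simp: S_def)
  then have "T + h \<le> T" using T[of T] by auto
  then show False using h(1) by simp
qed

definition right_deriv :: "('a \<Rightarrow> 'a) \<Rightarrow> 'a \<Rightarrow> 'a \<Rightarrow> bool" where
  "right_deriv f t L \<longleftrightarrow>
     (\<forall>\<epsilon>>0. \<exists>\<delta>>0. \<forall>h. 0 < h \<and> h < \<delta> \<longrightarrow> \<bar>f (t + h) - f t - L * h\<bar> \<le> \<epsilon> * h)"

lemma dfn_right_deriv:
  assumes f: "dterm sc f"
  shows "dfn (pr sc sc) (\<lambda>z. right_deriv f (fst z) (snd z))"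
  unfolding right_deriv_def
  by (intro dfn_intros dterm_sc_subst[OF f] dterm_intros dterm_fst dterm_snd)

lemma right_deriv_unique:
  assumes "right_deriv f t L" "right_deriv f t L'"
  shows "L = L'"
proof (rule ccontr)
  assume "L \<noteq> L'"
  then have e: "0 < \<bar>L - L'\<bar> / 3" by simp
  obtain \<delta> where \<delta>: "0 < \<delta>"
    "\<And>h. 0 < h \<and> h < \<delta> \<Longrightarrow> \<bar>f (t + h) - f t - L * h\<bar> \<le> \<bar>L - L'\<bar> / 3 * h"
    using assms(1) e unfolding right_deriv_def by blast
  obtain \<delta>' where \<delta>': "0 < \<delta>'"
    "\<And>h. 0 < h \<and> h < \<delta>' \<Longrightarrow> \<bar>f (t + h) - f t - L' * h\<bar> \<le> \<bar>L - L'\<bar> / 3 * h"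
    using assms(2) e unfolding right_deriv_def by blast
  define h where "h = min \<delta> \<delta>' / 2"
  have h: "0 < h" "h < \<delta>" "h < \<delta>'" using \<delta>(1) \<delta>'(1) by (auto simp: h_def min_def)
  have "\<bar>L - L'\<bar> * h = \<bar>L * h - L' * h\<bar>" using h(1) by (simp add: abs_mult flip: left_diff_distrib)
  also have "\<dots> \<le> \<bar>f (t + h) - f t - L * h\<bar> + \<bar>f (t + h) - f t - L' * h\<bar>" by linarith
  also have "\<dots> \<le> \<bar>L - L'\<bar> / 3 * h + \<bar>L - L'\<bar> / 3 * h"
    using \<delta>(2)[of h] \<delta>'(2)[of h] h by (intro add_mono) auto
  finally have "\<bar>L - L'\<bar> * h \<le> 2 / 3 * (\<bar>L - L'\<bar> * h)" by simp
  then show False using e h(1) by (auto simp: field_simps)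
qed

lemma continuous_subinterval:
  assumes f: "dterm sc f" and ab: "a < b"
  obtains d where "a < d" "d \<le> b" "\<And>t. a < t \<Longrightarrow> t < d \<Longrightarrow> cont1 f t"
  using dense_interval_ex[OF dfn_cont1[OF f] ab] exists_continuity_point[OF f] by metis

text \<open>
  The difference quotients have a limit from the right, possibly infinite. As plus infinity is excluded
  on every interval for both \<open>f\<close> and \<open>- f\<close>, the limit is finite somewhere.
\<close>

lemma exists_right_deriv:
  assumes f: "dterm sc f" and "a < b"
  obtains t L where "a < t" "t < b" "right_deriv f t L"
proof (rule ccontr)
  note wit = that
  assume n: "\<not> thesis"
  have nd: "\<not> right_deriv f t L" if "a < t" "t < b" for t L using n wit[OF that] by blast
  obtain d where d: "a < d" "d \<le> b" "\<And>t. a < t \<Longrightarrow> t < d \<Longrightarrow> cont1 f t"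
    using continuous_subinterval[OF f assms(2)] by blast
  define R where "R f t \<longleftrightarrow> (\<forall>m. \<exists>\<delta>>0. \<forall>h. 0 < h \<and> h < \<delta> \<longrightarrow> m * h \<le> f (t + h) - f t)"
    for f :: "'a \<Rightarrow> 'a" and t
  have shift: "(\<exists>d>t. \<forall>u. t < u \<and> u < d \<longrightarrow> P u) \<Longrightarrow> (\<exists>\<delta>>0. \<forall>h. 0 < h \<and> h < \<delta> \<longrightarrow> P (t + h))"
    for t and P :: "'a \<Rightarrow> bool"
  proof -
    assume "\<exists>d>t. \<forall>u. t < u \<and> u < d \<longrightarrow> P u"
    then obtain d where "t < d" "\<forall>u. t < u \<and> u < d \<longrightarrow> P u" by blast
    then show ?thesis by (intro exI[of _ "d - t"]) (auto simp: algebra_simps)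
  qed
  have RR: "R f t \<or> R (\<lambda>u. - f u) t" if t: "a < t" "t < d" for t
  proof -
    define \<phi> where "\<phi> u = (f u - f t) / (u - t)" for u
    have \<phi>: "f (t + h) - f t = \<phi> (t + h) * h" if "0 < h" for h using that by (simp add: \<phi>_def)
    have "dterm sc \<phi>" unfolding \<phi>_def by (intro dterm_intros f)
    from right_limit_cases[OF this, of t] show ?thesis
    proof (elim disjE exE)
      assume *: "\<forall>y. \<exists>d>t. \<forall>u. t < u \<and> u < d \<longrightarrow> y \<le> \<phi> u"
      have "R f t" unfolding R_def
      proof
        fix m
        show "\<exists>\<delta>>0. \<forall>h. 0 < h \<and> h < \<delta> \<longrightarrow> m * h \<le> f (t + h) - f t"
          using shift[of t "\<lambda>u. m \<le> \<phi> u"] * \<phi> by (metis less_imp_le mult_right_mono)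
      qed
      then show ?thesis ..
    next
      assume *: "\<forall>y. \<exists>d>t. \<forall>u. t < u \<and> u < d \<longrightarrow> \<phi> u \<le> y"
      have "R (\<lambda>u. - f u) t" unfolding R_def
      proof
        fix m
        obtain \<delta> where \<delta>: "0 < \<delta>" "\<And>h. 0 < h \<and> h < \<delta> \<Longrightarrow> \<phi> (t + h) \<le> - m"
          using shift[of t "\<lambda>u. \<phi> u \<le> - m"] * by blast
        have "m * h \<le> - f (t + h) - (- f t)" if "0 < h \<and> h < \<delta>" for h
          using mult_right_mono[OF \<delta>(2)[OF that], of h] \<phi>[of h] that by (simp add: algebra_simps)
        then show "\<exists>\<delta>>0. \<forall>h. 0 < h \<and> h < \<delta> \<longrightarrow> m * h \<le> - f (t + h) - (- f t)"
          using \<delta>(1) by blast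
      qed
      then show ?thesis ..
    next
      fix L
      assume *: "\<forall>\<epsilon>>0. \<exists>d>t. \<forall>u. t < u \<and> u < d \<longrightarrow> \<bar>\<phi> u - L\<bar> \<le> \<epsilon>"
      have "right_deriv f t L" unfolding right_deriv_def
      proof (intro allI impI)
        fix \<epsilon> :: 'a
        assume "0 < \<epsilon>"
        then obtain \<delta> where \<delta>: "0 < \<delta>" "\<And>h. 0 < h \<and> h < \<delta> \<Longrightarrow> \<bar>\<phi> (t + h) - L\<bar> \<le> \<epsilon>"
          using shift[of t "\<lambda>u. \<bar>\<phi> u - L\<bar> \<le> \<epsilon>"] * by blast
        have "\<bar>f (t + h) - f t - L * h\<bar> \<le> \<epsilon> * h" if "0 < h \<and> h < \<delta>" for h
        proof -
          have "f (t + h) - f t - L * h = (\<phi> (t + h) - L) * h"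
            using \<phi>[of h] that by (simp add: algebra_simps)
          then show ?thesis using mult_right_mono[OF \<delta>(2)[OF that], of h] that
            by (simp add: abs_mult)
        qed
        then show "\<exists>\<delta>>0. \<forall>h. 0 < h \<and> h < \<delta> \<longrightarrow> \<bar>f (t + h) - f t - L * h\<bar> \<le> \<epsilon> * h"
          using \<delta>(1) by blast
      qed
      then show ?thesis using nd t d(2) by auto
    qed
  qed
  have noR: "\<exists>t. c < t \<and> t < e \<and> \<not> R g t"
    if "dterm sc g" "c < e" "\<And>t. c < t \<Longrightarrow> t < e \<Longrightarrow> cont1 g t" for g c e
    using no_infinite_slope[OF that] unfolding R_def by blast
  have dR: "dfn sc (\<lambda>t. \<not> R f t)" unfolding R_def
    by (intro dfn_intros dterm_sc_subst[OF f] dterm_intros dterm_fst)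
  have "\<exists>t. u < t \<and> t < v \<and> \<not> R f t" if "u < v" "a \<le> u \<and> v \<le> d" for u v
    using noR[OF f that(1)] d(3) that by auto
  then obtain e where e: "a < e" "e \<le> d" "\<And>t. a < t \<Longrightarrow> t < e \<Longrightarrow> \<not> R f t"
    using dense_interval_ex[OF dR d(1)] by blast
  have "dterm sc (\<lambda>u. - f u)" by (intro dterm_intros f)
  moreover have "cont1 (\<lambda>u. - f u) t" if "a < t" "t < e" for t
    using d(3)[of t] e(2) that unfolding cont1_def
    by (simp add: abs_minus_commute)
  ultimately obtain t where "a < t" "t < e" "\<not> R (\<lambda>u. - f u) t" using noR e(1) by blast
  then show False using RR[of t] e(2) e(3)[of t] by auto
qed

text \<open>
  Subtracting \<open>m t\<close> makes every point a strict local minimum, with a uniform radius on some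
  subinterval. Two points of the subinterval closer than this radius contradict each other.
\<close>

lemma no_corner:
  assumes f: "dterm sc f" and "a < b"
    and corner: "\<And>t. a < t \<Longrightarrow> t < b \<Longrightarrow> \<exists>\<rho>>0. \<forall>h. 0 < h \<and> h < \<rho> \<longrightarrow>
      m * h < f (t + h) - f t \<and> - m * h < f (t - h) - f t"
  shows False
proof -
  let ?Q = "\<lambda>t \<rho>. \<forall>h. 0 < h \<and> h < \<rho> \<longrightarrow> m * h < f (t + h) - f t \<and> - m * h < f (t - h) - f t"
  have "dfn (pr sc sc) (\<lambda>z. ?Q (fst z) (snd z))"
    by (intro dfn_intros dterm_sc_subst[OF f] dterm_intros dterm_fst dterm_snd)
  moreover have "?Q t \<rho>'" if "?Q t \<rho>" "0 < \<rho>'" "\<rho>' \<le> \<rho>" for t \<rho> \<rho>'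
    using that by (meson order_less_le_trans)
  ultimately obtain \<rho> c d where \<rho>: "0 < \<rho>" "c < d"
    "\<And>t. c < t \<Longrightarrow> t < d \<Longrightarrow> a < t \<and> t < b \<and> ?Q t \<rho>"
    using uniform_on_interval[of ?Q, OF _ _ assms(2) corner] by blast
  obtain s where s: "c < s" "s < d" using dense[OF \<rho>(2)] by blast
  obtain t where t: "s < t" "t < min d (s + \<rho>)" using dense[of s "min d (s + \<rho>)"] s \<rho>(1) by auto
  have h: "0 < t - s \<and> t - s < \<rho>" "t < d" "c < t" using s t by (auto simp: algebra_simps)
  have "m * (t - s) < f (s + (t - s)) - f s" using \<rho>(3)[OF s] h(1) by blast
  moreover have "- m * (t - s) < f (t - (t - s)) - f t" using \<rho>(3)[OF h(3,2)] h(1) by blast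
  ultimately show False by simp
qed

definition deriv1 :: "('a \<Rightarrow> 'a) \<Rightarrow> 'a \<Rightarrow> 'a \<Rightarrow> bool" where
  "deriv1 f t L \<longleftrightarrow>
     (\<forall>\<epsilon>>0. \<exists>\<delta>>0. \<forall>h. \<bar>h\<bar> < \<delta> \<longrightarrow> \<bar>f (t + h) - f t - L * h\<bar> \<le> \<epsilon> * \<bar>h\<bar>)"

text \<open>
  The one-sided derivatives \<open>q\<close> and \<open>q'\<close> exist and are continuous on a common subinterval. If they
  differed at a point, a constant \<open>m\<close> would separate them on an interval, which makes every point there a
  corner of \<open>f\<close> or of \<open>- f\<close>.
\<close>

lemma exists_deriv1:
  assumes f: "dterm sc f" and ab: "a < b"
  obtains t L where "a < t" "t < b" "deriv1 f t L"
proof -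
  define f' where "f' u = f (- u)" for u
  have f'_eq: "f' = (\<lambda>u. f (- u))" by (rule ext) (simp add: f'_def)
  have f': "dterm sc f'" unfolding f'_def by (intro dterm_sc_subst[OF f] dterm_intros)
  define q where "q t = (if \<exists>L. right_deriv f t L then THE L. right_deriv f t L else 0)" for t
  define q' where "q' t = - (if \<exists>L. right_deriv f' (- t) L then THE L. right_deriv f' (- t) L else 0)" for t
  have q: "dterm sc q" unfolding q_def
    by (rule dterm_the) (auto intro: right_deriv_unique dfn_right_deriv[OF f])
  have "dterm sc (\<lambda>t. if \<exists>L. right_deriv f' (- t) L then THE L. right_deriv f' (- t) L else 0)"
    by (rule dterm_the) (auto intro: right_deriv_unique intro!: dfn_binary[OF dfn_right_deriv[OF f']] dterm_intros)
  then have q': "dterm sc q'" unfolding q'_def by (rule dterm_uminus)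
  have Rq: "right_deriv f t (q t)" if "\<exists>L. right_deriv f t L" for t
    using that unfolding q_def by (auto intro: theI2 right_deriv_unique)
  have Rq': "right_deriv f' (- t) (- q' t)" if "\<exists>L. right_deriv f' (- t) L" for t
    using that unfolding q'_def by (auto intro: theI2 right_deriv_unique)
  have "dfn sc (\<lambda>t. \<exists>L. right_deriv f t L)"
    by (intro dfn_intros dfn_right_deriv[OF f])
  moreover have "\<forall>u v. u < v \<longrightarrow> a \<le> u \<and> v \<le> b \<longrightarrow> (\<exists>t. u < t \<and> t < v \<and> (\<exists>L. right_deriv f t L))"
    using exists_right_deriv[OF f] by metis
  ultimately have "\<exists>d. a < d \<and> d \<le> b \<and> (\<forall>t. a < t \<and> t < d \<longrightarrow> (\<exists>L. right_deriv f t L))"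
    by (rule dense_interval_ex[OF _ ab])
  then obtain d where d: "a < d" "d \<le> b" "\<And>t. a < t \<Longrightarrow> t < d \<Longrightarrow> \<exists>L. right_deriv f t L" by metis
  have "\<exists>t. c < t \<and> t < e \<and> (\<exists>L. right_deriv f' (- t) L)" if "c < e" for c e
  proof -
    obtain t L where t: "- e < t" "t < - c" "right_deriv f' t L"
      using exists_right_deriv[OF f', of "- e" "- c"] \<open>c < e\<close> by auto
    then show ?thesis by (intro exI[of _ "- t"]) auto
  qed
  then have "\<forall>u v. u < v \<longrightarrow> a \<le> u \<and> v \<le> d \<longrightarrow> (\<exists>t. u < t \<and> t < v \<and> (\<exists>L. right_deriv f' (- t) L))"
    by blast
  moreover have "dfn sc (\<lambda>t. \<exists>L. right_deriv f' (- t) L)"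
    by (intro dfn_intros dfn_binary[OF dfn_right_deriv[OF f']] dterm_intros dterm_fst)
  ultimately have "\<exists>d1. a < d1 \<and> d1 \<le> d \<and> (\<forall>t. a < t \<and> t < d1 \<longrightarrow> (\<exists>L. right_deriv f' (- t) L))"
    using dense_interval_ex[OF _ d(1)] by fast
  then obtain d1 where d1: "a < d1" "d1 \<le> d" "\<And>t. a < t \<Longrightarrow> t < d1 \<Longrightarrow> \<exists>L. right_deriv f' (- t) L" by metis
  obtain d2 where d2: "a < d2" "d2 \<le> d1" "\<And>t. a < t \<Longrightarrow> t < d2 \<Longrightarrow> cont1 q t"
    using continuous_subinterval[OF q d1(1)] by blast
  obtain d3 where d3: "a < d3" "d3 \<le> d2" "\<And>t. a < t \<Longrightarrow> t < d3 \<Longrightarrow> cont1 q' t"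
    using continuous_subinterval[OF q' d2(1)] by blast
  have R: "right_deriv f t (q t)" "right_deriv f' (- t) (- q' t)" if "a < t" "t < d3" for t
    using that d(3) d1 d2 d3 by (auto intro!: Rq Rq')
  have corner: "\<exists>\<rho>>0. \<forall>h. 0 < h \<and> h < \<rho> \<longrightarrow>
      m * h < g (t + h) - g t \<and> - m * h < g (t - h) - g t"
    if H: "right_deriv g t u" "right_deriv (\<lambda>u. g (- u)) (- t) (- v)" "v < m" "m < u" for g t u v m
  proof -
    obtain \<delta> where \<delta>: "0 < \<delta>"
      "\<And>h. 0 < h \<and> h < \<delta> \<Longrightarrow> \<bar>g (t + h) - g t - u * h\<bar> \<le> (u - m) / 2 * h"
      using H(1,4) unfolding right_deriv_def by (metis diff_gt_0_iff_gt half_gt_zero)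
    obtain \<delta>' where \<delta>': "0 < \<delta>'"
      "\<And>h. 0 < h \<and> h < \<delta>' \<Longrightarrow> \<bar>g (- (- t + h)) - g (- (- t)) - (- v) * h\<bar> \<le> (m - v) / 2 * h"
      using H(2,3) unfolding right_deriv_def by (metis diff_gt_0_iff_gt half_gt_zero)
    have "m * h < g (t + h) - g t \<and> - m * h < g (t - h) - g t" if "0 < h \<and> h < min \<delta> \<delta>'" for h
    proof -
      have aux: "k < x" if "\<bar>x - r\<bar> \<le> A" "A < r - k" for x r A k :: 'a
        using that by (auto simp: abs_le_iff algebra_simps)
      have "(u - m) / 2 * h < (u - m) * h" "(m - v) / 2 * h < (m - v) * h"
        using that \<open>v < m\<close> \<open>m < u\<close> by (auto intro!: mult_strict_right_mono)
      then have "(u - m) / 2 * h < u * h - m * h" "(m - v) / 2 * h < - v * h - (- m * h)"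
        by (simp_all add: left_diff_distrib)
      moreover have "\<bar>g (t + h) - g t - u * h\<bar> \<le> (u - m) / 2 * h" using that by (intro \<delta>(2)) auto
      moreover have "\<bar>g (t - h) - g t - (- v * h)\<bar> \<le> (m - v) / 2 * h" using \<delta>'(2)[of h] that by simp
      ultimately show ?thesis by (blast intro: aux)
    qed
    then show ?thesis using \<delta>(1) \<delta>'(1) by (intro exI[of _ "min \<delta> \<delta>'"]) auto
  qed
  have sep: "\<exists>m u v. a < u \<and> u < v \<and> v < d3 \<and> (\<forall>t. u < t \<and> t < v \<longrightarrow> r' t < m \<and> m < r t)"
    if H: "a < t0" "t0 < d3" "cont1 r t0" "cont1 r' t0" "r' t0 < r t0" for r r' :: "'a \<Rightarrow> 'a" and t0
  proof -
    define e where "e = (r t0 - r' t0) / 2"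
    have e: "0 < e" using H(5) by (simp add: e_def)
    obtain \<delta> where \<delta>: "0 < \<delta>" "\<And>t. \<bar>t - t0\<bar> < \<delta> \<Longrightarrow> \<bar>r t - r t0\<bar> < e"
      using H(3) e unfolding cont1_def by blast
    obtain \<delta>' where \<delta>': "0 < \<delta>'" "\<And>t. \<bar>t - t0\<bar> < \<delta>' \<Longrightarrow> \<bar>r' t - r' t0\<bar> < e"
      using H(4) e unfolding cont1_def by blast
    obtain v where v: "t0 < v" "v < min d3 (t0 + min \<delta> \<delta>')"
      using dense[of t0 "min d3 (t0 + min \<delta> \<delta>')"] H(2) \<delta>(1) \<delta>'(1) by auto
    have "r' t < r' t0 + e \<and> r' t0 + e < r t" if t: "t0 < t \<and> t < v" for t
    proof -
      have "\<bar>r t - r t0\<bar> < e" "\<bar>r' t - r' t0\<bar> < e" using t v by (auto intro!: \<delta> \<delta>')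
      moreover have "r t0 = r' t0 + e + e" by (simp add: e_def)
      ultimately show ?thesis by linarith
    qed
    then show ?thesis using v H(1) by (intro exI[of _ "r' t0 + e"] exI[of _ t0] exI[of _ v]) auto
  qed
  have neg: "right_deriv (\<lambda>u. - g u) t (- L)" if "right_deriv g t L" for g t L
  proof -
    have "\<bar>- g (t + h) - (- g t) - (- L) * h\<bar> = \<bar>g (t + h) - g t - L * h\<bar>" for h by linarith
    then show ?thesis using that unfolding right_deriv_def by simp
  qed
  obtain t0 where t0: "a < t0" "t0 < d3" using dense[OF d3(1)] by blast
  have cont: "cont1 q t" "cont1 q' t" if "a < t" "t < d3" for t using that d2(3) d3 by auto
  have "q t0 = q' t0"
  proof (rule linorder_cases)
    assume "q' t0 < q t0"
    then obtain m u v where m: "a < u" "u < v" "v < d3" "\<And>t. u < t \<Longrightarrow> t < v \<Longrightarrow> q' t < m \<and> m < q t"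
      using sep[OF t0 cont[OF t0]] by blast
    have "False"
    proof (rule no_corner[OF f m(2)])
      fix t assume t: "u < t" "t < v"
      then show "\<exists>\<rho>>0. \<forall>h. 0 < h \<and> h < \<rho> \<longrightarrow> m * h < f (t + h) - f t \<and> - m * h < f (t - h) - f t"
        using R[of t, unfolded f'_eq] m by (intro corner[of f t "q t" "q' t"]) auto
    qed
    then show ?thesis ..
  next
    assume "q t0 < q' t0"
    then obtain m u v where m: "a < u" "u < v" "v < d3" "\<And>t. u < t \<Longrightarrow> t < v \<Longrightarrow> q t < m \<and> m < q' t"
      using sep[OF t0 cont(2)[OF t0] cont(1)[OF t0]] by blast
    have "False"
    proof (rule no_corner[of "\<lambda>u. - f u", OF _ m(2)])
      show "dterm sc (\<lambda>u. - f u)" by (intro dterm_intros f)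
      fix t assume t: "u < t" "t < v"
      then show "\<exists>\<rho>>0. \<forall>h. 0 < h \<and> h < \<rho> \<longrightarrow>
          - m * h < - f (t + h) - (- f t) \<and> - (- m) * h < - f (t - h) - (- f t)"
        using neg[OF R(1)[of t]] neg[OF R(2)[of t, unfolded f'_eq]] m
        by (intro corner[of "\<lambda>u. - f u" t "- q t" "- q' t" "- m"]) auto
    qed
    then show ?thesis ..
  qed (rule sym)
  then have "right_deriv f t0 (q t0)" "right_deriv f' (- t0) (- q t0)" using R[OF t0] by simp_all
  have "deriv1 f t0 (q t0)" unfolding deriv1_def
  proof (intro allI impI)
    fix \<epsilon> :: 'a assume \<epsilon>: "0 < \<epsilon>"
    obtain \<delta> where \<delta>: "0 < \<delta>" "\<And>h. 0 < h \<and> h < \<delta> \<Longrightarrow> \<bar>f (t0 + h) - f t0 - q t0 * h\<bar> \<le> \<epsilon> * h"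
      using \<open>right_deriv f t0 (q t0)\<close> \<epsilon> unfolding right_deriv_def by blast
    obtain \<delta>' where \<delta>': "0 < \<delta>'"
      "\<And>h. 0 < h \<and> h < \<delta>' \<Longrightarrow> \<bar>f' (- t0 + h) - f' (- t0) - (- q t0) * h\<bar> \<le> \<epsilon> * h"
      using \<open>right_deriv f' (- t0) (- q t0)\<close> \<epsilon> unfolding right_deriv_def by blast
    have "\<bar>f (t0 + h) - f t0 - q t0 * h\<bar> \<le> \<epsilon> * \<bar>h\<bar>" if "\<bar>h\<bar> < min \<delta> \<delta>'" for h
    proof -
      consider "0 < h" | "h = 0" | "h < 0" by fastforce
      then show ?thesis
      proof cases
        case 1
        then show ?thesis using \<delta>(2)[of h] that by auto
      next
        case 3
        then show ?thesis using \<delta>'(2)[of "- h"] that by (auto simp: f'_def add.commute)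
      qed auto
    qed
    then show "\<exists>\<delta>>0. \<forall>h. \<bar>h\<bar> < \<delta> \<longrightarrow> \<bar>f (t0 + h) - f t0 - q t0 * h\<bar> \<le> \<epsilon> * \<bar>h\<bar>"
      using \<delta>(1) \<delta>'(1) by (intro exI[of _ "min \<delta> \<delta>'"]) auto
  qed
  then show ?thesis using that t0 d d1 d2 d3 by (meson order_less_le_trans)
qed

end

section \<open>Generic properties on cubes\<close>

text \<open>
  The coordinates outside \<open>J\<close> are fixed. Keeping lower-dimensional cubes in the ambient space makes it
  possible to do induction on the dimension although the dimension is a type.
\<close>

definition cube :: "'n set \<Rightarrow> 'a::linordered_field ^ 'n \<Rightarrow> 'a \<Rightarrow> ('a ^ 'n) set" where
  "cube J p r = {x. (\<forall>j\<in>J. \<bar>x $ j - p $ j\<bar> < r) \<and> (\<forall>i\<in>- J. x $ i = p $ i)}"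

definition upd :: "'a ^ 'n \<Rightarrow> 'n \<Rightarrow> 'a \<Rightarrow> 'a ^ 'n" where
  "upd x j t = (\<chi> i. if i = j then t else x $ i)"

text \<open>
  On each translate of the coordinate subspace of \<open>J\<close>, the predicate holds on a dense open set.
\<close>

definition generic :: "'n set \<Rightarrow> ('a::linordered_field ^ 'n \<Rightarrow> bool) \<Rightarrow> bool" where
  "generic J P \<longleftrightarrow>
     (\<forall>p r. 0 < r \<longrightarrow> (\<exists>q s. 0 < s \<and> cube J q s \<subseteq> cube J p r \<and> (\<forall>x\<in>cube J q s. P x)))"

lemma upd_nth [simp]: "upd x j t $ i = (if i = j then t else x $ i)"
  by (simp add: upd_def)

lemma upd_same [simp]: "upd x j (x $ j) = x" "upd (upd x j s) j t = upd x j t"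
  by (simp_all add: vec_eq_iff)

lemma cube_center: "0 < r \<Longrightarrow> p \<in> cube J p r"
  by (simp add: cube_def)

lemma cube_mono: "r \<le> r' \<Longrightarrow> cube J p r \<subseteq> cube J p r'"
  by (auto simp: cube_def)

lemma finite_positive_lower_bound:
  fixes g :: "'b \<Rightarrow> 'a::linordered_field"
  assumes "finite A" "\<And>j. j \<in> A \<Longrightarrow> 0 < g j"
  shows "\<exists>s>0. \<forall>j\<in>A. s \<le> g j"
  using assms
proof (induction A)
  case empty
  then show ?case using zero_less_one by blast
next
  case (insert k A)
  then obtain s where "0 < s" "\<forall>j\<in>A. s \<le> g j" by auto
  then show ?case using insert.prems by (intro exI[of _ "min s (g k)"]) (auto intro: min.coboundedI1)
qed

lemma cube_subcube:
  fixes p :: "'a::linordered_field ^ 'n::finite"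
  assumes "x \<in> cube J p r"
  obtains s where "0 < s" "cube J x s \<subseteq> cube J p r"
proof -
  obtain s where s: "0 < s" "\<forall>j\<in>J. s \<le> r - \<bar>x $ j - p $ j\<bar>"
    using finite_positive_lower_bound[of J "\<lambda>j. r - \<bar>x $ j - p $ j\<bar>"] assms
    by (auto simp: cube_def)
  have "\<bar>y $ j - p $ j\<bar> < r" if "j \<in> J" "\<bar>y $ j - x $ j\<bar> < s" for y j
  proof -
    have "s \<le> r - \<bar>x $ j - p $ j\<bar>" using s(2) that(1) by blast
    then show ?thesis using that(2) by linarith
  qed
  then have "cube J x s \<subseteq> cube J p r" using assms unfolding cube_def by auto
  then show ?thesis using that s(1) by blast
qed

lemma cube_insert:
  assumes "j \<notin> J"
  shows "x \<in> cube (insert j J) p r \<longleftrightarrow> upd x j (p $ j) \<in> cube J p r \<and> \<bar>x $ j - p $ j\<bar> < r"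
  using assms by (auto simp: cube_def)

lemma generic_mono: "generic J P \<Longrightarrow> (\<And>x. P x \<Longrightarrow> Q x) \<Longrightarrow> generic J Q"
  unfolding generic_def by blast

lemma generic_conj:
  fixes P Q :: "'a::linordered_field ^ 'n \<Rightarrow> bool"
  assumes "generic J P" "generic J Q"
  shows "generic J (\<lambda>x. P x \<and> Q x)"
  unfolding generic_def
proof (intro allI impI)
  fix p :: "'a ^ 'n" and r :: 'a assume "0 < r"
  then obtain q s where 1: "0 < s" "cube J q s \<subseteq> cube J p r" "\<forall>x\<in>cube J q s. P x"
    using assms(1) unfolding generic_def by blast
  obtain q' s' where 2: "0 < s'" "cube J q' s' \<subseteq> cube J q s" "\<forall>x\<in>cube J q' s'. Q x"
    using assms(2) 1(1) unfolding generic_def by blast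
  show "\<exists>q s. 0 < s \<and> cube J q s \<subseteq> cube J p r \<and> (\<forall>x\<in>cube J q s. P x \<and> Q x)"
    using 1 2 by (intro exI[of _ q'] exI[of _ s']) blast
qed

lemma generic_True: "(\<And>x. P x) \<Longrightarrow> generic J P"
  unfolding generic_def by blast

lemma generic_ball:
  assumes "finite A" "\<And>i. i \<in> A \<Longrightarrow> generic J (P i)"
  shows "generic J (\<lambda>x. \<forall>i\<in>A. P i x)"
  using assms by (induction A) (auto intro: generic_True generic_conj)

lemma genericE:
  assumes "generic J P" "0 < r"
  obtains q s where "0 < s" "cube J q s \<subseteq> cube J p r" "\<And>x. x \<in> cube J q s \<Longrightarrow> P x"
  using assms unfolding generic_def by meson

definition cont_on_cubes ::
  "'n set \<Rightarrow> ('a::linordered_field ^ 'n \<Rightarrow> 'a) \<Rightarrow> 'a ^ 'n \<Rightarrow> bool" where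
  "cont_on_cubes J f x \<longleftrightarrow> (\<forall>\<epsilon>>0. \<exists>\<delta>>0. \<forall>y\<in>cube J x \<delta>. \<bar>f y - f x\<bar> < \<epsilon>)"

lemma cont_on_cubesE:
  assumes "cont_on_cubes J f x" "0 < \<epsilon>"
  obtains \<delta> where "0 < \<delta>" "\<And>y. y \<in> cube J x \<delta> \<Longrightarrow> \<bar>f y - f x\<bar> < \<epsilon>"
proof -
  have "\<exists>\<delta>>0. \<forall>y\<in>cube J x \<delta>. \<bar>f y - f x\<bar> < \<epsilon>"
    using assms by (simp add: cont_on_cubes_def)
  then show ?thesis using that by blast
qed

context definability begin

lemma dterm_upd:
  "dterm C t \<Longrightarrow> dterm C (\<lambda>z. v z $ i) \<Longrightarrow> dterm C (\<lambda>z. upd (v z) j (t z) $ i)"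
  by (cases "i = j") simp_all

lemma dfn_ball_fin: "(\<And>i. dfn C (P i)) \<Longrightarrow> dfn C (\<lambda>x. \<forall>i\<in>A. P (i :: 'n::finite) x)"
  by (rule dfn_ball) auto

lemma dfn_bex_fin: "(\<And>i. dfn C (P i)) \<Longrightarrow> dfn C (\<lambda>x. \<exists>i\<in>A. P (i :: 'n::finite) x)"
  by (rule dfn_bex) auto

lemma dfn_cube:
  fixes y :: "'e \<Rightarrow> 'a ^ 'n::finite"
  assumes "\<And>i. dterm C (\<lambda>z. y z $ i)" "\<And>i. dterm C (\<lambda>z. x z $ i)" "dterm C r"
  shows "dfn C (\<lambda>z. y z \<in> cube J (x z) (r z))"
  unfolding cube_def mem_Collect_eq
  by (intro dfn_conj dfn_ball_fin dfn_less dfn_eq dterm_abs dterm_diff assms)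

lemma dfn_cont_on_cubes:
  fixes f :: "'a ^ 'n::finite \<Rightarrow> 'a"
  assumes f: "dterm vc f"
  shows "dfn vc (cont_on_cubes J f)"
  unfolding cont_on_cubes_def Ball_def
  by (intro dfn_intros dfn_cube dterm_vec_subst[OF f] dterm_intros dterm_fst dterm_snd)

end

context o_minimal_structure begin

lemma dfn_lub_ex:
  assumes "dfn sc P" "P t0" "\<forall>t. P t \<longrightarrow> t \<le> B"
  shows "\<exists>s. \<forall>y. s \<le> y \<longleftrightarrow> (\<forall>t. P t \<longrightarrow> t \<le> y)"
  by (rule dfn_lub[of P t0 B]) (use assms in blast)+

lemma uniform_on_interval_ex:
  assumes "dfn (pr sc sc) (\<lambda>z. Q (fst z) (snd z))"
    "\<forall>t \<rho> \<rho>'. Q t \<rho> \<longrightarrow> 0 < \<rho>' \<longrightarrow> \<rho>' \<le> \<rho> \<longrightarrow> Q t \<rho>'"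
    "a < b" "\<forall>t. a < t \<longrightarrow> t < b \<longrightarrow> (\<exists>\<rho>>0. Q t \<rho>)"
  shows "\<exists>\<rho> c d. 0 < \<rho> \<and> c < d \<and> (\<forall>t. c < t \<longrightarrow> t < d \<longrightarrow> a < t \<and> t < b \<and> Q t \<rho>)"
  by (rule uniform_on_interval[of Q a b]) (use assms in blast)+

definition decided_on_subcube :: "'n::finite set \<Rightarrow> bool" where
  "decided_on_subcube J \<longleftrightarrow> (\<forall>P p r. dfn (vc :: ('a ^ 'n \<Rightarrow> 'a) set) P \<longrightarrow> 0 < r \<longrightarrow>
     (\<exists>q s. 0 < s \<and> cube J q s \<subseteq> cube J p r \<and>
       ((\<forall>x\<in>cube J q s. P x) \<or> (\<forall>x\<in>cube J q s. \<not> P x))))"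

text \<open>
  The principle of \<open>uniform_on_interval\<close> in the directions \<open>J\<close>.
\<close>

definition uniform_on_subcube :: "'n::finite set \<Rightarrow> bool" where
  "uniform_on_subcube J \<longleftrightarrow> (\<forall>Q p r. dfn (pr (vc :: ('a ^ 'n \<Rightarrow> 'a) set) sc) (\<lambda>z. Q (fst z) (snd z)) \<longrightarrow>
     (\<forall>x \<rho> \<rho>'. Q x \<rho> \<longrightarrow> 0 < \<rho>' \<longrightarrow> \<rho>' \<le> \<rho> \<longrightarrow> Q x \<rho>') \<longrightarrow> 0 < r \<longrightarrow>
     (\<forall>x\<in>cube J p r. \<exists>\<rho>>0. Q x \<rho>) \<longrightarrow>
     (\<exists>q s \<rho>. 0 < s \<and> 0 < \<rho> \<and> cube J q s \<subseteq> cube J p r \<and> (\<forall>x\<in>cube J q s. Q x \<rho>)))"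

definition generically_continuous :: "'n::finite set \<Rightarrow> bool" where
  "generically_continuous J \<longleftrightarrow> (\<forall>f. dterm (vc :: ('a ^ 'n \<Rightarrow> 'a) set) f \<longrightarrow> generic J (cont_on_cubes J f))"

lemma uniform_on_subcube_ex:
  fixes p :: "'a ^ 'n::finite"
  assumes "uniform_on_subcube J" "dfn (pr vc sc) (\<lambda>z. Q (fst z) (snd z))"
    "\<forall>x \<rho> \<rho>'. Q x \<rho> \<longrightarrow> 0 < \<rho>' \<longrightarrow> \<rho>' \<le> \<rho> \<longrightarrow> Q x \<rho>'" "0 < r"
    "\<forall>x\<in>cube J p r. \<exists>\<rho>>0. Q x \<rho>"
  shows "\<exists>q s \<rho>. 0 < s \<and> 0 < \<rho> \<and> cube J q s \<subseteq> cube J p r \<and> (\<forall>x\<in>cube J q s. Q x \<rho>)"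
  using assms unfolding uniform_on_subcube_def by blast

lemma decided_on_subcube_generic:
  fixes P :: "'a ^ 'n::finite \<Rightarrow> bool"
  assumes "decided_on_subcube J" "dfn vc P" "\<And>q s. 0 < s \<Longrightarrow> \<exists>x\<in>cube J q s. P x"
  shows "generic J P"
  unfolding generic_def
proof (intro allI impI)
  fix p :: "'a ^ 'n" and r :: 'a assume "0 < r"
  then obtain q s where "0 < s" "cube J q s \<subseteq> cube J p r"
    "(\<forall>x\<in>cube J q s. P x) \<or> (\<forall>x\<in>cube J q s. \<not> P x)"
    using assms(1,2) unfolding decided_on_subcube_def by blast
  then show "\<exists>q s. 0 < s \<and> cube J q s \<subseteq> cube J p r \<and> (\<forall>x\<in>cube J q s. P x)"
    using assms(3)[of s q] by blast
qed

lemma generically_continuous_decided_on_subcube: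
  assumes "generically_continuous (J :: 'n::finite set)"
  shows "decided_on_subcube J"
  unfolding decided_on_subcube_def
proof (intro allI impI)
  fix P :: "'a ^ 'n \<Rightarrow> bool" and p :: "'a ^ 'n" and r :: 'a
  assume P: "dfn vc P" and r: "0 < r"
  define f where "f x = (if P x then 1 else 0 :: 'a)" for x
  have "dterm vc f" unfolding f_def by (intro dterm_if P dterm_const)
  then have "generic J (cont_on_cubes J f)" using assms unfolding generically_continuous_def by blast
  then obtain q s where q: "0 < s" "cube J q s \<subseteq> cube J p r" "\<And>x. x \<in> cube J q s \<Longrightarrow> cont_on_cubes J f x"
    using genericE[OF _ r] by metis
  have "cont_on_cubes J f q" using q(1,3) cube_center by blast
  then obtain \<delta> where \<delta>: "0 < \<delta>" "\<And>y. y \<in> cube J q \<delta> \<Longrightarrow> \<bar>f y - f q\<bar> < 1"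
    unfolding cont_on_cubes_def using zero_less_one by blast
  have "P y \<longleftrightarrow> P q" if "y \<in> cube J q \<delta>" for y
    using \<delta>(2)[OF that] by (auto simp: f_def split: if_splits)
  then have "(\<forall>x\<in>cube J q (min s \<delta>). P x) \<or> (\<forall>x\<in>cube J q (min s \<delta>). \<not> P x)"
    using cube_mono[of "min s \<delta>" \<delta> J q] by (meson min.cobounded2 subsetD)
  moreover have "cube J q (min s \<delta>) \<subseteq> cube J p r"
    using q(2) cube_mono[of "min s \<delta>" s J q] by auto
  ultimately show "\<exists>q s. 0 < s \<and> cube J q s \<subseteq> cube J p r \<and>
      ((\<forall>x\<in>cube J q s. P x) \<or> (\<forall>x\<in>cube J q s. \<not> P x))"
    using q(1) \<delta>(1) by (intro exI[of _ q] exI[of _ "min s \<delta>"]) auto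
qed

text \<open>
  If all fibres in direction \<open>j\<close> over a \<open>J\<close>-cube contain intervals, then on a subcube these intervals
  can be taken to have a common length \<open>\<rho>\<close>. The least left end point of such an interval is a definable
  function of the base point, so it is continuous on a subcube. Near a point of continuity the intervals
  overlap in a fixed interval.
\<close>

lemma fat_fibres:
  fixes p :: "'a ^ 'n::finite"
  assumes C: "generically_continuous J" and U: "uniform_on_subcube J" and j: "j \<notin> J"
    and P: "dfn vc P" and bd: "\<forall>x. P x \<longrightarrow> b \<le> x $ j" and r: "0 < r"
    and fib: "\<forall>x\<in>cube J p r. \<exists>c d. c < d \<and> (\<forall>t. c < t \<and> t < d \<longrightarrow> P (upd x j t))"
  shows "\<exists>q s. 0 < s \<and> (\<forall>x\<in>cube (insert j J) q s. upd x j (p $ j) \<in> cube J p r \<and> P x)"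
proof -
  define G where "G \<rho> x a \<longleftrightarrow> (\<forall>t. a < t \<and> t < a + \<rho> \<longrightarrow> P (upd x j t))" for \<rho> x a
  have dG: "dfn (pr vc sc) (\<lambda>z. \<exists>a. G (snd z) (fst z) a)" unfolding G_def
    by (intro dfn_intros dfn_vec_subst[OF P] dterm_upd dterm_intros dterm_fst dterm_snd)
  have "\<exists>a. G \<rho>' x a" if "\<exists>a. G \<rho> x a" "0 < \<rho>'" "\<rho>' \<le> \<rho>" for \<rho> \<rho>' x
    using that unfolding G_def by (meson add_left_mono order_less_le_trans)
  moreover have "\<exists>\<rho>>0. \<exists>a. G \<rho> x a" if "x \<in> cube J p r" for x
  proof -
    obtain c d where "c < d" "\<forall>t. c < t \<and> t < d \<longrightarrow> P (upd x j t)" using fib \<open>x \<in> cube J p r\<close> by blast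
    then show ?thesis unfolding G_def by (intro exI[of _ "d - c"] conjI exI[of _ c]) auto
  qed
  ultimately have "\<exists>q s \<rho>. 0 < s \<and> 0 < \<rho> \<and> cube J q s \<subseteq> cube J p r \<and> (\<forall>x\<in>cube J q s. \<exists>a. G \<rho> x a)"
    by (intro uniform_on_subcube_ex[OF U, of "\<lambda>x \<rho>. \<exists>a. G \<rho> x a"] dG r allI ballI impI)
  then obtain q s \<rho> where q: "0 < s" "0 < \<rho>" "cube J q s \<subseteq> cube J p r"
    "\<And>x. x \<in> cube J q s \<Longrightarrow> \<exists>a. G \<rho> x a" by blast
  define H where "H x a \<longleftrightarrow> G \<rho> x a \<and> (\<forall>a'. G \<rho> x a' \<longrightarrow> a \<le> a')" for x a
  have lower: "b - \<rho> \<le> a" if "G \<rho> x a" for x a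
  proof -
    have "b \<le> upd x j (a + \<rho> / 2) $ j" using that q(2) unfolding G_def by (intro bd[rule_format]) auto
    then have "b \<le> a + \<rho> / 2" by simp
    then show ?thesis using q(2) by (simp add: field_simps)
  qed
  have Hex: "\<exists>a. H x a" if Gx: "\<exists>a. G \<rho> x a" for x
  proof -
    obtain a0 where a0: "G \<rho> x a0" using Gx by blast
    have dGx: "dfn sc (\<lambda>a. G \<rho> x (- a))" unfolding G_def
      by (intro dfn_intros dfn_vec_subst[OF P] dterm_upd dterm_intros dterm_fst dterm_snd)
    have "\<forall>a. G \<rho> x (- a) \<longrightarrow> a \<le> \<rho> - b" using lower by fastforce
    moreover have "G \<rho> x (- (- a0))" using a0 by simp
    ultimately obtain s where s: "\<And>y. s \<le> y \<longleftrightarrow> (\<forall>t. G \<rho> x (- t) \<longrightarrow> t \<le> y)"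
      using dfn_lub_ex[OF dGx] by blast
    have low: "- s \<le> a'" if "G \<rho> x a'" for a' using s[of s] that by (auto dest: spec[of _ "- a'"])
    have "G \<rho> x (- s)" unfolding G_def
    proof (intro allI impI)
      fix t assume t: "- s < t \<and> t < - s + \<rho>"
      then have "\<not> s \<le> - t" by auto
      then obtain u where u: "G \<rho> x (- u)" "- t < u" unfolding s by auto
      then have "- u < t \<and> t < - u + \<rho>" using t low[OF u(1)] by auto
      then show "P (upd x j t)" using u(1) unfolding G_def by blast
    qed
    then show ?thesis unfolding H_def using low by blast
  qed
  define h where "h x = (if \<exists>a. H x a then THE a. H x a else 0)" for x
  have "dterm vc h" unfolding h_def
  proof (rule dterm_the)
    show "\<exists>!a. H x a" if "\<exists>a. H x a" for x using that unfolding H_def by (metis order_antisym)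
    show "dfn (pr vc sc) (\<lambda>z. H (fst z) (snd z))" unfolding H_def G_def
      by (intro dfn_intros dfn_vec_subst[OF P] dterm_upd dterm_intros dterm_fst dterm_snd)
  qed
  then have "generic J (cont_on_cubes J h)" using C unfolding generically_continuous_def by blast
  then obtain q' s' where q': "0 < s'" "cube J q' s' \<subseteq> cube J q s"
    "\<And>x. x \<in> cube J q' s' \<Longrightarrow> cont_on_cubes J h x"
    using genericE[OF _ q(1)] by metis
  have h: "G \<rho> x (h x)" if "x \<in> cube J q' s'" for x
  proof -
    have "\<exists>a. H x a" using Hex q(4) q'(2) that by blast
    then obtain a where a: "H x a" by blast
    moreover have "a' = a" if "H x a'" for a' using a that unfolding H_def by (metis order_antisym)
    ultimately have "(THE a. H x a) = a" by (intro the_equality)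
    then have "h x = a" using a unfolding h_def by metis
    then show ?thesis using a unfolding H_def by simp
  qed
  have "cont_on_cubes J h q'" using q'(1,3) cube_center by blast
  then obtain \<delta> where \<delta>: "0 < \<delta>" "\<And>y. y \<in> cube J q' \<delta> \<Longrightarrow> \<bar>h y - h q'\<bar> < \<rho> / 4" using q(2) by (elim cont_on_cubesE[of _ _ _ "\<rho> / 4"]) simp_all
  \<comment> \<open>the middle of the interval over \<open>q'\<close>; the others are displaced by less than a quarter of their length\<close>
  define c where "c = h q' + \<rho> / 2"
  define e where "e = min (\<rho> / 4) (min \<delta> s')"
  have e: "0 < e" "e \<le> \<rho> / 4" "e \<le> \<delta>" "e \<le> s'" using q(2) \<delta>(1) q'(1) by (auto simp: e_def)
  have qj: "q' $ j = p $ j"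
  proof -
    have "q' \<in> cube J p r" using q'(1,2) q(3) cube_center by blast
    then show ?thesis using j by (auto simp: cube_def)
  qed
  show ?thesis
  proof (intro exI[of _ "upd q' j c"] exI[of _ e] conjI ballI)
    show "0 < e" by (rule e(1))
  next
    fix x assume x: "x \<in> cube (insert j J) (upd q' j c) e"
    define y where "y = upd x j (p $ j)"
    have y: "y \<in> cube J q' e" using x j qj unfolding y_def cube_def by (auto split: if_splits)
    then have ys: "y \<in> cube J q' s'" "y \<in> cube J q' \<delta>" using e cube_mono by blast+
    have "\<bar>x $ j - c\<bar> < \<rho> / 4" using x e(2) j by (auto simp: cube_def)
    moreover have "\<bar>h y - h q'\<bar> < \<rho> / 4" using \<delta>(2)[OF ys(2)] .
    moreover have "\<rho> / 2 = \<rho> / 4 + \<rho> / 4" "\<rho> = \<rho> / 4 + \<rho> / 4 + \<rho> / 4 + \<rho> / 4" by simp_all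
    ultimately have "h y < x $ j" "x $ j < h y + \<rho>" unfolding c_def by linarith+
    then have "P (upd y j (x $ j))" using h[OF ys(1)] unfolding G_def by blast
    moreover have "upd y j (x $ j) = x" by (simp add: y_def)
    moreover have "y \<in> cube J p r" using ys(1) q'(2) q(3) by blast
    ultimately show "upd x j (p $ j) \<in> cube J p r" "P x" unfolding y_def by simp_all
  qed
qed

lemma fat_fibres_cube:
  fixes p :: "'a ^ 'n::finite"
  assumes C: "generically_continuous J" and U: "uniform_on_subcube J" and j: "j \<notin> J"
    and P: "dfn vc P" and r: "0 < r" "0 < r'" "r' \<le> r" and p': "cube J p' r' \<subseteq> cube J p r"
    and fib: "\<forall>x\<in>cube J p' r'.
      \<exists>c d. c < d \<and> (\<forall>t. c < t \<and> t < d \<longrightarrow> \<bar>t - p $ j\<bar> < r \<and> P (upd x j t))"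
  shows "\<exists>q s. 0 < s \<and> cube (insert j J) q s \<subseteq> cube (insert j J) p r \<and>
    (\<forall>x\<in>cube (insert j J) q s. P x)"
proof -
  let ?P = "\<lambda>x. \<bar>x $ j - p $ j\<bar> < r \<and> P x"
  have "dfn vc ?P" by (intro dfn_intros dterm_intros P)
  moreover have "\<forall>x. ?P x \<longrightarrow> p $ j - r \<le> x $ j" by (auto simp: abs_less_iff)
  moreover have "\<forall>x\<in>cube J p' r'. \<exists>c d. c < d \<and> (\<forall>t. c < t \<and> t < d \<longrightarrow> ?P (upd x j t))"
    using fib by simp
  ultimately obtain q s where q: "0 < s"
    "\<And>x. x \<in> cube (insert j J) q s \<Longrightarrow> upd x j (p' $ j) \<in> cube J p' r' \<and> ?P x"
    using fat_fibres[OF C U j, of ?P "p $ j - r", OF _ _ r(2)] by blast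
  have "p' \<in> cube J p r" using p' cube_center[OF r(2)] by blast
  then have "p' $ j = p $ j" using j by (auto simp: cube_def)
  then have "x \<in> cube (insert j J) p r" if "x \<in> cube (insert j J) q s" for x
    using q(2)[OF that] p' unfolding cube_insert[OF j] by auto
  then have "cube (insert j J) q s \<subseteq> cube (insert j J) p r" by blast
  then show ?thesis using q by blast
qed

text \<open>
  Each fibre contains an interval inside or outside \<open>P\<close>. Which of the two is decided on a subcube of
  the base, and \<open>fat_fibres\<close> applies.
\<close>

lemma decided_on_subcube_insert:
  assumes C: "generically_continuous (J :: 'n::finite set)" and U: "uniform_on_subcube J" and j: "j \<notin> J"
  shows "decided_on_subcube (insert j J)"
  unfolding decided_on_subcube_def
proof (intro allI impI)
  fix P :: "'a ^ 'n \<Rightarrow> bool" and p :: "'a ^ 'n" and r :: 'a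
  assume P: "dfn vc P" and r: "0 < r"
  define E where "E x \<longleftrightarrow> (\<exists>c d. c < d \<and> (\<forall>t. c < t \<and> t < d \<longrightarrow> \<bar>t - p $ j\<bar> < r \<and> P (upd x j t)))" for x
  have E: "dfn vc E" unfolding E_def
    by (intro dfn_intros dfn_vec_subst[OF P] dterm_upd dterm_intros dterm_fst dterm_snd)
  have nE: "\<exists>c d. c < d \<and> (\<forall>t. c < t \<and> t < d \<longrightarrow> \<bar>t - p $ j\<bar> < r \<and> \<not> P (upd x j t))" if n: "\<not> E x" for x
  proof -
    have "dfn sc (\<lambda>t. P (upd x j t))" by (intro dfn_vec_subst[OF P] dterm_upd dterm_intros)
    from germ_decided[OF this, of "p $ j"] obtain d where d: "p $ j < d"
      "(\<forall>t. p $ j < t \<and> t < d \<longrightarrow> P (upd x j t)) \<or> (\<forall>t. p $ j < t \<and> t < d \<longrightarrow> \<not> P (upd x j t))" by blast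
    define d' where "d' = min d (p $ j + r)"
    have d': "p $ j < d'" using d(1) r by (simp add: d'_def)
    have rng: "\<bar>t - p $ j\<bar> < r" "t < d" if "p $ j < t" "t < d'" for t
      using that by (auto simp: d'_def)
    then have "\<not> (\<forall>t. p $ j < t \<and> t < d \<longrightarrow> P (upd x j t))" using n d' unfolding E_def by blast
    then show ?thesis using d(2) d' rng by blast
  qed
  obtain q s where q: "0 < s" "cube J q s \<subseteq> cube J p r"
    "(\<forall>x\<in>cube J q s. E x) \<or> (\<forall>x\<in>cube J q s. \<not> E x)"
    using generically_continuous_decided_on_subcube[OF C] E r unfolding decided_on_subcube_def by blast
  define s' where "s' = min s r"
  have s': "0 < s'" "s' \<le> r" "cube J q s' \<subseteq> cube J q s" using q(1) r by (auto simp: s'_def intro!: cube_mono[of s' s J q, unfolded s'_def, THEN subsetD])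
  have sub: "cube J q s' \<subseteq> cube J p r" using s' q(2) by blast
  from q(3) show "\<exists>q s. 0 < s \<and> cube (insert j J) q s \<subseteq> cube (insert j J) p r \<and>
      ((\<forall>x\<in>cube (insert j J) q s. P x) \<or> (\<forall>x\<in>cube (insert j J) q s. \<not> P x))"
  proof
    assume "\<forall>x\<in>cube J q s. E x"
    then have "\<forall>x\<in>cube J q s'. \<exists>c d. c < d \<and> (\<forall>t. c < t \<and> t < d \<longrightarrow> \<bar>t - p $ j\<bar> < r \<and> P (upd x j t))"
      using s'(3) unfolding E_def by blast
    then show ?thesis using fat_fibres_cube[OF C U j P r s'(1,2) sub] by blast
  next
    assume "\<forall>x\<in>cube J q s. \<not> E x"
    then have "\<forall>x\<in>cube J q s'. \<exists>c d. c < d \<and> (\<forall>t. c < t \<and> t < d \<longrightarrow> \<bar>t - p $ j\<bar> < r \<and> \<not> P (upd x j t))"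
      using s'(3) nE by blast
    then show ?thesis using fat_fibres_cube[OF C U j dfn_not[OF P] r s'(1,2) sub] by blast
  qed
qed

lemma uniform_on_subcube_insert:
  assumes C: "generically_continuous (J :: 'n::finite set)" and U: "uniform_on_subcube J" and j: "j \<notin> J"
  shows "uniform_on_subcube (insert j J)"
  unfolding uniform_on_subcube_def
proof (intro allI impI)
  fix Q :: "'a ^ 'n \<Rightarrow> 'a \<Rightarrow> bool" and p :: "'a ^ 'n" and r :: 'a
  assume Q: "dfn (pr vc sc) (\<lambda>z. Q (fst z) (snd z))"
    and down: "\<forall>x \<rho> \<rho>'. Q x \<rho> \<longrightarrow> 0 < \<rho>' \<longrightarrow> \<rho>' \<le> \<rho> \<longrightarrow> Q x \<rho>'" and r: "0 < r"
    and ex: "\<forall>x\<in>cube (insert j J) p r. \<exists>\<rho>>0. Q x \<rho>"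
  have Qs: "dfn C (\<lambda>z. Q (F z) (t z))" if "\<And>i. dterm C (\<lambda>z. F z $ i)" "dterm C t"
    for C :: "('e \<Rightarrow> 'a) set" and F :: "'e \<Rightarrow> 'a ^ 'n" and t
    using that by (intro dfn_subst[OF coord_system_pr[OF coord_system_vc coord_system_sc] Q,
          of C "\<lambda>z. (F z, t z)", simplified]) (auto simp: pr_def sc_def vc_def)
  define Q' where "Q' x \<rho> \<longleftrightarrow>
    (\<exists>c d. c < d \<and> (\<forall>t. c < t \<and> t < d \<longrightarrow> \<bar>t - p $ j\<bar> < r \<and> Q (upd x j t) \<rho>))" for x \<rho>
  have Q': "dfn (pr vc sc) (\<lambda>z. Q' (fst z) (snd z))" unfolding Q'_def
    by (intro dfn_intros Qs dterm_upd dterm_intros dterm_fst dterm_snd)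
  have "Q' x \<rho>'" if "Q' x \<rho>" "0 < \<rho>'" "\<rho>' \<le> \<rho>" for x \<rho> \<rho>'
    using that down unfolding Q'_def by meson
  moreover have "\<exists>\<rho>>0. Q' x \<rho>" if x: "x \<in> cube J p r" for x
  proof -
    let ?Q = "\<lambda>t \<rho>. Q (upd x j t) \<rho>"
    have dQ: "dfn (pr sc sc) (\<lambda>z. ?Q (fst z) (snd z))"
      by (intro Qs dterm_upd dterm_intros dterm_fst dterm_snd)
    have ex1: "\<forall>t. p $ j - r < t \<longrightarrow> t < p $ j + r \<longrightarrow> (\<exists>\<rho>>0. ?Q t \<rho>)"
    proof (intro allI impI)
      fix t assume that: "p $ j - r < t" "t < p $ j + r"
      have "upd x j t \<in> cube (insert j J) p r"
        using x that j unfolding cube_insert[OF j] by (auto simp: cube_def abs_less_iff)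
      then show "\<exists>\<rho>>0. ?Q t \<rho>" using ex by blast
    qed
    have lt: "p $ j - r < p $ j + r" using r by simp
    have dn: "\<forall>t \<rho> \<rho>'. ?Q t \<rho> \<longrightarrow> 0 < \<rho>' \<longrightarrow> \<rho>' \<le> \<rho> \<longrightarrow> ?Q t \<rho>'" using down by blast
    obtain \<rho> c d where "0 < \<rho>" "c < d"
      "\<forall>t. c < t \<longrightarrow> t < d \<longrightarrow> p $ j - r < t \<and> t < p $ j + r \<and> ?Q t \<rho>"
      using uniform_on_interval_ex[of ?Q, OF dQ dn lt ex1] by blast
    then show ?thesis unfolding Q'_def
      by (intro exI[of _ \<rho>] conjI exI[of _ c] exI[of _ d]) (auto simp: abs_less_iff algebra_simps)
  qed
  ultimately have "\<exists>q s \<rho>. 0 < s \<and> 0 < \<rho> \<and> cube J q s \<subseteq> cube J p r \<and> (\<forall>x\<in>cube J q s. Q' x \<rho>)"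
    by (intro uniform_on_subcube_ex[OF U] Q' r allI ballI impI)
  then obtain q s \<rho> where q: "0 < s" "0 < \<rho>" "cube J q s \<subseteq> cube J p r"
    "\<And>x. x \<in> cube J q s \<Longrightarrow> Q' x \<rho>" by blast
  define s' where "s' = min s r"
  have s': "0 < s'" "s' \<le> r" "cube J q s' \<subseteq> cube J q s" using q(1) r by (auto simp: s'_def intro!: cube_mono[of s' s J q, unfolded s'_def, THEN subsetD])
  have sub: "cube J q s' \<subseteq> cube J p r" using s' q(3) by blast
  have "dfn vc (\<lambda>x. Q x \<rho>)" by (intro Qs dterm_intros)
  moreover have "\<forall>x\<in>cube J q s'. \<exists>c d. c < d \<and> (\<forall>t. c < t \<and> t < d \<longrightarrow> \<bar>t - p $ j\<bar> < r \<and> Q (upd x j t) \<rho>)"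
    using q(4) s'(3) unfolding Q'_def by blast
  ultimately show "\<exists>q s \<rho>. 0 < s \<and> 0 < \<rho> \<and> cube (insert j J) q s \<subseteq> cube (insert j J) p r \<and>
      (\<forall>x\<in>cube (insert j J) q s. Q x \<rho>)"
    using fat_fibres_cube[OF C U j _ r s'(1,2) sub, of "\<lambda>x. Q x \<rho>"] q(2) by blast
qed

text \<open>
  Continuity in the directions \<open>J\<close> and continuity in direction \<open>j\<close> both hold generically. Uniformity
  turns them into bounds with one radius on a subcube, and moving first in direction \<open>j\<close>, then in the
  directions \<open>J\<close>, shows that the oscillation is smaller than any uniform lower bound for it.
\<close>

lemma generically_continuous_insert:
  assumes C: "generically_continuous (J :: 'n::finite set)" and U: "uniform_on_subcube J" and j: "j \<notin> J"
  shows "generically_continuous (insert j J)"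
  unfolding generically_continuous_def
proof (intro allI impI)
  let ?K = "insert j J"
  fix f :: "'a ^ 'n \<Rightarrow> 'a"
  assume f: "dterm vc f"
  have D: "decided_on_subcube ?K" by (rule decided_on_subcube_insert[OF C U j])
  have UK: "uniform_on_subcube ?K" by (rule uniform_on_subcube_insert[OF C U j])
  have gJ: "generic ?K (cont_on_cubes J f)"
  proof (rule decided_on_subcube_generic[OF D dfn_cont_on_cubes[OF f]])
    fix q :: "'a ^ 'n" and s :: 'a assume s: "0 < s"
    have "generic J (cont_on_cubes J f)" using C f unfolding generically_continuous_def by blast
    then obtain q' s' where "0 < s'" "cube J q' s' \<subseteq> cube J q s"
      "\<And>x. x \<in> cube J q' s' \<Longrightarrow> cont_on_cubes J f x" using genericE[OF _ s] by metis
    then have "q' \<in> cube J q s" "cont_on_cubes J f q'" using cube_center by blast+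
    moreover have "cube J q s \<subseteq> cube ?K q s" using s by (auto simp: cube_def)
    ultimately show "\<exists>x\<in>cube ?K q s. cont_on_cubes J f x" by blast
  qed
  have gj: "generic ?K (cont_on_cubes {j} f)"
  proof (rule decided_on_subcube_generic[OF D dfn_cont_on_cubes[OF f]])
    fix q :: "'a ^ 'n" and s :: 'a assume s: "0 < s"
    have "dterm sc (\<lambda>t. f (upd q j t))"
      by (intro dterm_vec_subst[OF f] dterm_upd dterm_intros)
    moreover have "q $ j - s < q $ j + s" using s by simp
    ultimately obtain t where t: "q $ j - s < t" "t < q $ j + s" "cont1 (\<lambda>t. f (upd q j t)) t"
      using exists_continuity_point by metis
    have "upd q j t \<in> cube ?K q s" using t s by (auto simp: cube_def abs_less_iff)
    moreover have "cont_on_cubes {j} f (upd q j t)" unfolding cont_on_cubes_def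
    proof (intro allI impI)
      fix \<epsilon> :: 'a assume "0 < \<epsilon>"
      then obtain \<delta> where \<delta>: "0 < \<delta>" "\<And>u. \<bar>u - t\<bar> < \<delta> \<Longrightarrow> \<bar>f (upd q j u) - f (upd q j t)\<bar> < \<epsilon>"
        using t(3) unfolding cont1_def by blast
      have "\<bar>f y - f (upd q j t)\<bar> < \<epsilon>" if y: "y \<in> cube {j} (upd q j t) \<delta>" for y
      proof -
        have "y = upd q j (y $ j)" using y by (auto simp: cube_def vec_eq_iff)
        moreover have "\<bar>y $ j - t\<bar> < \<delta>" using y by (simp add: cube_def)
        ultimately show ?thesis using \<delta>(2)[of "y $ j"] by simp
      qed
      then show "\<exists>\<delta>>0. \<forall>y\<in>cube {j} (upd q j t) \<delta>. \<bar>f y - f (upd q j t)\<bar> < \<epsilon>" using \<delta>(1) by blast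
    qed
    ultimately show "\<exists>x\<in>cube ?K q s. cont_on_cubes {j} f x" by blast
  qed
  show "generic ?K (cont_on_cubes ?K f)"
  proof (rule decided_on_subcube_generic[OF D dfn_cont_on_cubes[OF f]], rule ccontr)
    fix q :: "'a ^ 'n" and s :: 'a
    assume s: "0 < s" and no: "\<not> (\<exists>x\<in>cube ?K q s. cont_on_cubes ?K f x)"
    define Q where "Q x \<eta> \<longleftrightarrow> (\<forall>\<delta>>0. \<exists>y. y \<in> cube ?K x \<delta> \<and> \<eta> \<le> \<bar>f y - f x\<bar>)" for x \<eta>
    have "dfn (pr vc sc) (\<lambda>z. Q (fst z) (snd z))" unfolding Q_def
      by (intro dfn_intros dfn_cube dterm_vec_subst[OF f] dterm_intros dterm_fst dterm_snd)
    moreover have "Q x \<eta>'" if "Q x \<eta>" "0 < \<eta>'" "\<eta>' \<le> \<eta>" for x \<eta> \<eta>'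
      using that unfolding Q_def by (meson order_trans)
    moreover have "\<exists>\<eta>>0. Q x \<eta>" if "x \<in> cube ?K q s" for x
      using no that unfolding Q_def cont_on_cubes_def by (meson not_less)
    ultimately have "\<exists>q0 s0 \<eta>. 0 < s0 \<and> 0 < \<eta> \<and> cube ?K q0 s0 \<subseteq> cube ?K q s \<and> (\<forall>x\<in>cube ?K q0 s0. Q x \<eta>)"
      by (intro uniform_on_subcube_ex[OF UK] s allI ballI impI)
    then obtain q0 s0 \<eta> where q0: "0 < s0" "0 < \<eta>" "cube ?K q0 s0 \<subseteq> cube ?K q s"
      "\<And>x. x \<in> cube ?K q0 s0 \<Longrightarrow> Q x \<eta>" by blast
    define \<epsilon> where "\<epsilon> = \<eta> / 2"
    have \<epsilon>: "0 < \<epsilon>" "\<eta> = \<epsilon> + \<epsilon>" using q0(2) by (simp_all add: \<epsilon>_def)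
    obtain q1 s1 where q1: "0 < s1" "cube ?K q1 s1 \<subseteq> cube ?K q0 s0"
      "\<And>x. x \<in> cube ?K q1 s1 \<Longrightarrow> cont_on_cubes J f x \<and> cont_on_cubes {j} f x"
      using generic_conj[OF gJ gj] q0(1) unfolding generic_def by blast
    define R where "R x \<rho> \<longleftrightarrow> (\<forall>y. y \<in> cube J x \<rho> \<longrightarrow> \<bar>f y - f x\<bar> < \<epsilon>) \<and>
      (\<forall>y. y \<in> cube {j} x \<rho> \<longrightarrow> \<bar>f y - f x\<bar> < \<epsilon>)" for x \<rho>
    have "dfn (pr vc sc) (\<lambda>z. R (fst z) (snd z))" unfolding R_def
      by (intro dfn_intros dfn_cube dterm_vec_subst[OF f] dterm_intros dterm_fst dterm_snd)
    moreover have "R x \<rho>'" if "R x \<rho>" "0 < \<rho>'" "\<rho>' \<le> \<rho>" for x \<rho> \<rho>'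
      using that cube_mono[OF that(3)] unfolding R_def by blast
    moreover have "\<exists>\<rho>>0. R x \<rho>" if x: "x \<in> cube ?K q1 s1" for x
    proof -
      obtain \<rho> where \<rho>: "0 < \<rho>" "\<And>y. y \<in> cube J x \<rho> \<Longrightarrow> \<bar>f y - f x\<bar> < \<epsilon>"
        using cont_on_cubesE[OF conjunct1[OF q1(3)[OF x]] \<epsilon>(1)] by blast
      obtain \<rho>' where \<rho>': "0 < \<rho>'" "\<And>y. y \<in> cube {j} x \<rho>' \<Longrightarrow> \<bar>f y - f x\<bar> < \<epsilon>"
        using cont_on_cubesE[OF conjunct2[OF q1(3)[OF x]] \<epsilon>(1)] by blast
      have "cube J x (min \<rho> \<rho>') \<subseteq> cube J x \<rho>" "cube {j} x (min \<rho> \<rho>') \<subseteq> cube {j} x \<rho>'"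
        by (simp_all add: cube_mono)
      then show ?thesis using \<rho> \<rho>' unfolding R_def by (intro exI[of _ "min \<rho> \<rho>'"]) auto
    qed
    ultimately have "\<exists>q2 s2 \<rho>. 0 < s2 \<and> 0 < \<rho> \<and> cube ?K q2 s2 \<subseteq> cube ?K q1 s1 \<and> (\<forall>x\<in>cube ?K q2 s2. R x \<rho>)"
      by (intro uniform_on_subcube_ex[OF UK] q1(1) allI ballI impI)
    then obtain q2 s2 \<rho> where q2: "0 < s2" "0 < \<rho>" "cube ?K q2 s2 \<subseteq> cube ?K q1 s1"
      "\<And>x. x \<in> cube ?K q2 s2 \<Longrightarrow> R x \<rho>" by blast
    have q2m: "q2 \<in> cube ?K q2 s2" using q2(1) by (rule cube_center)
    then have "q2 \<in> cube ?K q0 s0" using q2(3) q1(2) by blast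
    moreover have "0 < min s2 \<rho>" using q2(1,2) by simp
    ultimately obtain y where y: "y \<in> cube ?K q2 (min s2 \<rho>)" "\<eta> \<le> \<bar>f y - f q2\<bar>"
      using q0(4) unfolding Q_def by blast
    define z where "z = upd q2 j (y $ j)"
    have "z \<in> cube {j} q2 \<rho>" using y(1) unfolding z_def by (auto simp: cube_def)
    then have 1: "\<bar>f z - f q2\<bar> < \<epsilon>" using q2(4)[OF q2m] unfolding R_def by blast
    have "z \<in> cube ?K q2 s2" using y(1) q2(1) unfolding z_def by (auto simp: cube_def)
    moreover have "y \<in> cube J z \<rho>" using y(1) j unfolding z_def by (auto simp: cube_def)
    ultimately have 2: "\<bar>f y - f z\<bar> < \<epsilon>" using q2(4) unfolding R_def by blast
    show False using 1 2 y(2) \<epsilon>(2) by linarith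
  qed
qed

lemma generic_calculus:
  "generically_continuous (J :: 'n::finite set) \<and> uniform_on_subcube J"
proof (induction J rule: finite_induct[OF finite])
  case 1
  have cube: "cube {} p r = {p}" for p :: "'a ^ 'n" and r :: 'a by (auto simp: cube_def vec_eq_iff)
  show ?case
  proof
    show "generically_continuous ({} :: 'n set)"
      unfolding generically_continuous_def generic_def cont_on_cubes_def cube by auto
    show "uniform_on_subcube ({} :: 'n set)"
      unfolding uniform_on_subcube_def cube by auto
  qed
next
  case (2 j J)
  then show ?case using generically_continuous_insert uniform_on_subcube_insert by blast
qed

end

section \<open>Differentiation over an ordered field\<close>

lemma sup_norm_le_iff: "sup_norm (x :: 'a::linordered_field ^ 'n::finite) \<le> r \<longleftrightarrow> (\<forall>i. \<bar>x $ i\<bar> \<le> r)"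
  by (auto simp: sup_norm_def)

lemma sup_norm_less_iff: "sup_norm (x :: 'a::linordered_field ^ 'n::finite) < r \<longleftrightarrow> (\<forall>i. \<bar>x $ i\<bar> < r)"
  by (auto simp: sup_norm_def)

lemma component_le_sup_norm: "\<bar>x $ i\<bar> \<le> sup_norm (x :: 'a::linordered_field ^ 'n::finite)"
  using sup_norm_le_iff[of x "sup_norm x"] by blast

lemma sup_norm_ge_0: "0 \<le> sup_norm (x :: 'a::linordered_field ^ 'n::finite)"
  using component_le_sup_norm[of x undefined] abs_ge_zero order_trans by blast

lemma sup_norm_attained: "\<exists>i. \<bar>x $ i\<bar> = sup_norm (x :: 'a::linordered_field ^ 'n::finite)"
proof -
  have "Max (range (\<lambda>i. \<bar>x $ i\<bar>)) \<in> range (\<lambda>i. \<bar>x $ i\<bar>)" by (rule Max_in) auto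
  then show ?thesis unfolding sup_norm_def by (metis (no_types, lifting) imageE)
qed

lemma mem_cube_UNIV:
  "y \<in> cube UNIV x r \<longleftrightarrow> sup_norm (y - x :: 'a::linordered_field ^ 'n::finite) < r"
  by (simp add: cube_def sup_norm_less_iff)

lemma uniform_radius:
  fixes P :: "'n::finite \<Rightarrow> 'a::linordered_field \<Rightarrow> bool"
  assumes "\<And>i. \<exists>\<delta>>0. P i \<delta>" and down: "\<And>i \<delta> \<delta>'. P i \<delta> \<Longrightarrow> 0 < \<delta>' \<Longrightarrow> \<delta>' \<le> \<delta> \<Longrightarrow> P i \<delta>'"
  shows "\<exists>\<delta>>0. \<forall>i. P i \<delta>"
proof -
  obtain d where d: "\<And>i. 0 < d i" "\<And>i. P i (d i)" using assms(1) by metis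
  obtain \<delta> where "0 < \<delta>" "\<forall>i\<in>UNIV. \<delta> \<le> d i"
    using finite_positive_lower_bound[of "UNIV :: 'n set" d] d(1) by auto
  then show ?thesis using down[OF d(2)] by blast
qed

text \<open>
  The rows of a Jacobian matrix are the gradients of the components.
\<close>

definition has_gradient ::
  "('a::linordered_field ^ 'n::finite \<Rightarrow> 'a) \<Rightarrow> 'a ^ 'n \<Rightarrow> 'a ^ 'n \<Rightarrow> bool" where
  "has_gradient f g x \<longleftrightarrow> (\<forall>\<epsilon>>0. \<exists>\<delta>>0. \<forall>y\<in>cube UNIV x \<delta>.
     \<bar>f y - f x - (\<Sum>j\<in>UNIV. g $ j * (y - x) $ j)\<bar> \<le> \<epsilon> * sup_norm (y - x))"

abbreviation continuous_at :: "('a::linordered_field ^ 'n::finite \<Rightarrow> 'a) \<Rightarrow> 'a ^ 'n \<Rightarrow> bool" where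
  "continuous_at \<equiv> cont_on_cubes UNIV"

lemma has_gradientE:
  assumes "has_gradient f g x" "0 < \<epsilon>"
  obtains \<delta> where "0 < \<delta>"
    "\<And>y. y \<in> cube UNIV x \<delta> \<Longrightarrow>
      \<bar>f y - f x - (\<Sum>j\<in>UNIV. g $ j * (y - x) $ j)\<bar> \<le> \<epsilon> * sup_norm (y - x)"
proof -
  have "\<exists>\<delta>>0. \<forall>y\<in>cube UNIV x \<delta>.
      \<bar>f y - f x - (\<Sum>j\<in>UNIV. g $ j * (y - x) $ j)\<bar> \<le> \<epsilon> * sup_norm (y - x)"
    using assms by (simp add: has_gradient_def)
  then show ?thesis using that by blast
qed

lemma linear_form_bound:
  fixes g v :: "'a::linordered_field ^ 'n::finite"
  shows "\<bar>\<Sum>j\<in>UNIV. g $ j * v $ j\<bar> \<le> (\<Sum>j\<in>UNIV. \<bar>g $ j\<bar>) * sup_norm v"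
proof -
  have "\<bar>\<Sum>j\<in>UNIV. g $ j * v $ j\<bar> \<le> (\<Sum>j\<in>UNIV. \<bar>g $ j * v $ j\<bar>)" by (rule sum_abs)
  also have "\<dots> \<le> (\<Sum>j\<in>UNIV. \<bar>g $ j\<bar> * sup_norm v)"
    by (intro sum_mono) (simp add: abs_mult mult_left_mono component_le_sup_norm)
  finally show ?thesis by (simp add: sum_distrib_right)
qed

lemma has_gradient_unique:
  fixes f :: "'a::linordered_field ^ 'n::finite \<Rightarrow> 'a"
  assumes "has_gradient f g x" "has_gradient f g' x"
  shows "g = g'"
proof (rule ccontr)
  assume "g \<noteq> g'"
  then obtain i where i: "g $ i \<noteq> g' $ i" by (auto simp: vec_eq_iff)
  define e where "e = \<bar>g $ i - g' $ i\<bar> / 3"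
  have e: "0 < e" using i by (simp add: e_def)
  obtain \<delta> where \<delta>: "0 < \<delta>" "\<And>y. y \<in> cube UNIV x \<delta> \<Longrightarrow>
      \<bar>f y - f x - (\<Sum>j\<in>UNIV. g $ j * (y - x) $ j)\<bar> \<le> e * sup_norm (y - x)"
    using has_gradientE[OF assms(1) e] by blast
  obtain \<delta>' where \<delta>': "0 < \<delta>'" "\<And>y. y \<in> cube UNIV x \<delta>' \<Longrightarrow>
      \<bar>f y - f x - (\<Sum>j\<in>UNIV. g' $ j * (y - x) $ j)\<bar> \<le> e * sup_norm (y - x)"
    using has_gradientE[OF assms(2) e] by blast
  define h where "h = min \<delta> \<delta>' / 2"
  have h: "0 < h" "h < \<delta>" "h < \<delta>'" using \<delta>(1) \<delta>'(1) by (auto simp: h_def min_def)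
  define y where "y = x + axis i h"
  have yx: "(y - x) $ j = (if j = i then h else 0)" for j by (simp add: y_def axis_def)
  have "sup_norm (y - x) \<le> h" unfolding sup_norm_le_iff yx using h(1) by simp
  then have sn: "sup_norm (y - x) = h" using component_le_sup_norm[of "y - x" i] h(1) yx by simp
  have sum: "(\<Sum>j\<in>UNIV. k $ j * (y - x) $ j) = k $ i * h" for k :: "'a ^ 'n"
    unfolding yx by (simp add: if_distrib[of "\<lambda>z. _ * z"] cong: if_cong)
  have "\<bar>f y - f x - g $ i * h\<bar> \<le> e * h" "\<bar>f y - f x - g' $ i * h\<bar> \<le> e * h"
    using \<delta>(2)[of y] \<delta>'(2)[of y] h unfolding mem_cube_UNIV sum sn by auto
  then have "\<bar>g $ i * h - g' $ i * h\<bar> \<le> e * h + e * h" by linarith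
  moreover have "\<bar>g $ i * h - g' $ i * h\<bar> = e * h + e * h + e * h"
    using h(1) by (simp add: e_def abs_mult flip: left_diff_distrib)
  ultimately show False using e h(1) by simp
qed

lemma cube_UNIV_mono: "\<delta>' \<le> \<delta> \<Longrightarrow> y \<in> cube UNIV x \<delta>' \<Longrightarrow> y \<in> cube UNIV x \<delta>"
  using cube_mono by blast

lemma has_gradient_local:
  fixes f f' :: "'a::linordered_field ^ 'n::finite \<Rightarrow> 'a"
  assumes "has_gradient f g x" "0 < r" "\<And>y. y \<in> cube UNIV x r \<Longrightarrow> f' y = f y"
  shows "has_gradient f' g x"
  unfolding has_gradient_def
proof (intro allI impI)
  fix \<epsilon> :: 'a assume "0 < \<epsilon>"
  then obtain \<delta> where \<delta>: "0 < \<delta>" "\<And>y. y \<in> cube UNIV x \<delta> \<Longrightarrow>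
      \<bar>f y - f x - (\<Sum>j\<in>UNIV. g $ j * (y - x) $ j)\<bar> \<le> \<epsilon> * sup_norm (y - x)"
    using has_gradientE[OF assms(1)] by blast
  have "\<bar>f' y - f' x - (\<Sum>j\<in>UNIV. g $ j * (y - x) $ j)\<bar> \<le> \<epsilon> * sup_norm (y - x)"
    if y: "y \<in> cube UNIV x (min \<delta> r)" for y
  proof -
    have "y \<in> cube UNIV x \<delta>" "y \<in> cube UNIV x r" using y by (auto simp: mem_cube_UNIV)
    then show ?thesis using \<delta>(2)[of y] assms(3)[of y] assms(3)[of x] cube_center[OF assms(2), of x UNIV] by simp
  qed
  then show "\<exists>\<delta>>0. \<forall>y\<in>cube UNIV x \<delta>.
      \<bar>f' y - f' x - (\<Sum>j\<in>UNIV. g $ j * (y - x) $ j)\<bar> \<le> \<epsilon> * sup_norm (y - x)"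
    using \<delta>(1) assms(2) by (intro exI[of _ "min \<delta> r"]) auto
qed

lemma has_gradient_lipschitz:
  fixes f :: "'a::linordered_field ^ 'n::finite \<Rightarrow> 'a"
  assumes "has_gradient f g x"
  shows "\<exists>\<delta>>0. \<forall>y\<in>cube UNIV x \<delta>. \<bar>f y - f x\<bar> \<le> ((\<Sum>j\<in>UNIV. \<bar>g $ j\<bar>) + 1) * sup_norm (y - x)"
proof -
  obtain \<delta> where \<delta>: "0 < \<delta>" "\<And>y. y \<in> cube UNIV x \<delta> \<Longrightarrow>
      \<bar>f y - f x - (\<Sum>j\<in>UNIV. g $ j * (y - x) $ j)\<bar> \<le> 1 * sup_norm (y - x)"
    using has_gradientE[OF assms zero_less_one] by blast
  have "\<bar>f y - f x\<bar> \<le> ((\<Sum>j\<in>UNIV. \<bar>g $ j\<bar>) + 1) * sup_norm (y - x)" if "y \<in> cube UNIV x \<delta>" for y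
    using \<delta>(2)[OF that] linear_form_bound[of g "y - x"] unfolding distrib_right mult_1
    by linarith
  then show ?thesis using \<delta>(1) by blast
qed

lemma has_gradient_continuous:
  fixes f :: "'a::linordered_field ^ 'n::finite \<Rightarrow> 'a"
  assumes "has_gradient f g x"
  shows "continuous_at f x"
  unfolding cont_on_cubes_def
proof (intro allI impI)
  fix \<epsilon> :: 'a assume e: "0 < \<epsilon>"
  define K where "K = (\<Sum>j\<in>UNIV. \<bar>g $ j\<bar>) + 1"
  have K: "0 < K" by (simp add: K_def add_nonneg_pos sum_nonneg)
  obtain \<delta> where \<delta>: "0 < \<delta>" "\<forall>y\<in>cube UNIV x \<delta>. \<bar>f y - f x\<bar> \<le> K * sup_norm (y - x)"
    using has_gradient_lipschitz[OF assms] unfolding K_def by blast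
  have "\<bar>f y - f x\<bar> < \<epsilon>" if y: "y \<in> cube UNIV x (min \<delta> (\<epsilon> / K))" for y
  proof -
    have "\<bar>f y - f x\<bar> \<le> K * sup_norm (y - x)" using y \<delta>(2) by (auto simp: mem_cube_UNIV)
    also have "\<dots> < K * (\<epsilon> / K)" using y K by (intro mult_strict_left_mono) (auto simp: mem_cube_UNIV)
    finally show ?thesis using K by simp
  qed
  then show "\<exists>\<delta>>0. \<forall>y\<in>cube UNIV x \<delta>. \<bar>f y - f x\<bar> < \<epsilon>"
    using \<delta>(1) e K by (intro exI[of _ "min \<delta> (\<epsilon> / K)"]) auto
qed

text \<open>
  The row vector \<open>a v* D\<close> is the gradient \<open>a\<close> of \<open>h\<close> times the Jacobian matrix \<open>D\<close> of \<open>F\<close>.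
\<close>

lemma has_gradient_chain:
  fixes F :: "'a::linordered_field ^ 'n::finite \<Rightarrow> 'a ^ 'm::finite"
  assumes h: "has_gradient h a (F x)" and F: "\<And>i. has_gradient (\<lambda>y. F y $ i) (D $ i) x"
  shows "has_gradient (\<lambda>y. h (F y)) (a v* D) x"
  unfolding has_gradient_def
proof (intro allI impI)
  fix \<epsilon> :: 'a assume e: "0 < \<epsilon>"
  define K where "K = (\<Sum>i\<in>UNIV. \<Sum>j\<in>UNIV. \<bar>D $ i $ j\<bar>) + 1"
  define L where "L = (\<Sum>i\<in>UNIV. \<bar>a $ i\<bar>) + 1"
  have K: "0 < K" by (simp add: K_def add_nonneg_pos sum_nonneg)
  have L: "0 < L" by (simp add: L_def add_nonneg_pos sum_nonneg)
  have "\<exists>\<delta>>0. \<forall>i. \<forall>y\<in>cube UNIV x \<delta>. \<bar>F y $ i - F x $ i\<bar> \<le> K * sup_norm (y - x)"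
  proof (rule uniform_radius)
    fix i
    obtain \<delta> where \<delta>: "0 < \<delta>" "\<forall>y\<in>cube UNIV x \<delta>.
        \<bar>F y $ i - F x $ i\<bar> \<le> ((\<Sum>j\<in>UNIV. \<bar>D $ i $ j\<bar>) + 1) * sup_norm (y - x)"
      using has_gradient_lipschitz[OF F[of i]] by blast
    have "(\<Sum>j\<in>UNIV. \<bar>D $ i $ j\<bar>) \<le> (\<Sum>i\<in>UNIV. \<Sum>j\<in>UNIV. \<bar>D $ i $ j\<bar>)"
      by (rule member_le_sum) (auto intro: sum_nonneg)
    then have "((\<Sum>j\<in>UNIV. \<bar>D $ i $ j\<bar>) + 1) * sup_norm v \<le> K * sup_norm v" for v :: "'a ^ 'n"
      unfolding K_def by (intro mult_right_mono) (auto simp: sup_norm_ge_0)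
    then show "\<exists>\<delta>>0. \<forall>y\<in>cube UNIV x \<delta>. \<bar>F y $ i - F x $ i\<bar> \<le> K * sup_norm (y - x)"
      using \<delta> by (meson order_trans)
  qed (auto dest: cube_UNIV_mono)
  then obtain \<delta>1 where \<delta>1: "0 < \<delta>1"
    "\<And>y. y \<in> cube UNIV x \<delta>1 \<Longrightarrow> sup_norm (F y - F x) \<le> K * sup_norm (y - x)"
    by (auto simp: sup_norm_le_iff)
  have e2: "0 < \<epsilon> / (2 * L)" using e L by simp
  have "\<exists>\<delta>>0. \<forall>i. \<forall>y\<in>cube UNIV x \<delta>.
      \<bar>F y $ i - F x $ i - (\<Sum>j\<in>UNIV. D $ i $ j * (y - x) $ j)\<bar> \<le> \<epsilon> / (2 * L) * sup_norm (y - x)"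
  proof (rule uniform_radius)
    fix i
    show "\<exists>\<delta>>0. \<forall>y\<in>cube UNIV x \<delta>.
      \<bar>F y $ i - F x $ i - (\<Sum>j\<in>UNIV. D $ i $ j * (y - x) $ j)\<bar> \<le> \<epsilon> / (2 * L) * sup_norm (y - x)"
      using F[of i] e2 by (simp only: has_gradient_def)
  qed (blast dest: cube_UNIV_mono)
  then obtain \<delta>2 where \<delta>2: "0 < \<delta>2" "\<And>y i. y \<in> cube UNIV x \<delta>2 \<Longrightarrow>
      \<bar>F y $ i - F x $ i - (\<Sum>j\<in>UNIV. D $ i $ j * (y - x) $ j)\<bar> \<le> \<epsilon> / (2 * L) * sup_norm (y - x)"
    by blast
  have e1: "0 < \<epsilon> / (2 * K)" using e K by simp
  obtain \<delta>3 where \<delta>3: "0 < \<delta>3" "\<And>z. z \<in> cube UNIV (F x) \<delta>3 \<Longrightarrow>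
      \<bar>h z - h (F x) - (\<Sum>j\<in>UNIV. a $ j * (z - F x) $ j)\<bar> \<le> \<epsilon> / (2 * K) * sup_norm (z - F x)"
    using has_gradientE[OF h e1] by blast
  define \<delta> where "\<delta> = min \<delta>1 (min \<delta>2 (\<delta>3 / K))"
  have "0 < \<delta>" using \<delta>1(1) \<delta>2(1) \<delta>3(1) K by (simp add: \<delta>_def)
  moreover have "\<bar>h (F y) - h (F x) - (\<Sum>j\<in>UNIV. (a v* D) $ j * (y - x) $ j)\<bar> \<le> \<epsilon> * sup_norm (y - x)"
    if y: "y \<in> cube UNIV x \<delta>" for y
  proof -
    define N where "N = sup_norm (y - x)"
    have N0: "0 \<le> N" by (simp add: N_def sup_norm_ge_0)
    have y1: "y \<in> cube UNIV x \<delta>1" "y \<in> cube UNIV x \<delta>2" and N3: "N < \<delta>3 / K"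
      using y by (auto simp: \<delta>_def mem_cube_UNIV N_def)
    have w: "sup_norm (F y - F x) \<le> K * N" using \<delta>1(2)[OF y1(1)] by (simp add: N_def)
    also have "\<dots> < \<delta>3" using N3 K by (simp add: field_simps)
    finally have "F y \<in> cube UNIV (F x) \<delta>3" by (simp add: mem_cube_UNIV)
    then have "\<bar>h (F y) - h (F x) - (\<Sum>i\<in>UNIV. a $ i * (F y - F x) $ i)\<bar> \<le> \<epsilon> / (2 * K) * sup_norm (F y - F x)"
      by (rule \<delta>3(2))
    also have "\<dots> \<le> \<epsilon> / (2 * K) * (K * N)" using w e1 by (intro mult_left_mono) auto
    also have "\<dots> = \<epsilon> / 2 * N" using K by simp
    finally have A: "\<bar>h (F y) - h (F x) - (\<Sum>i\<in>UNIV. a $ i * (F y - F x) $ i)\<bar> \<le> \<epsilon> / 2 * N" .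
    have "(\<Sum>j\<in>UNIV. (a v* D) $ j * (y - x) $ j) = (\<Sum>j\<in>UNIV. \<Sum>i\<in>UNIV. a $ i * (D $ i $ j * (y - x) $ j))"
      unfolding vector_matrix_mult_def vec_lambda_beta sum_distrib_right
      by (intro sum.cong refl) (simp only: ac_simps)
    also have "\<dots> = (\<Sum>i\<in>UNIV. a $ i * (\<Sum>j\<in>UNIV. D $ i $ j * (y - x) $ j))"
      by (subst sum.swap) (simp add: sum_distrib_left)
    finally have "(\<Sum>i\<in>UNIV. a $ i * (F y - F x) $ i) - (\<Sum>j\<in>UNIV. (a v* D) $ j * (y - x) $ j) =
        (\<Sum>i\<in>UNIV. a $ i * (F y $ i - F x $ i - (\<Sum>j\<in>UNIV. D $ i $ j * (y - x) $ j)))"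
      by (simp add: right_diff_distrib sum_subtractf)
    also have "\<bar>\<dots>\<bar> \<le> (\<Sum>i\<in>UNIV. \<bar>a $ i\<bar> * (\<epsilon> / (2 * L) * N))"
    proof (rule order_trans[OF sum_abs], rule sum_mono)
      fix i
      show "\<bar>a $ i * (F y $ i - F x $ i - (\<Sum>j\<in>UNIV. D $ i $ j * (y - x) $ j))\<bar>
          \<le> \<bar>a $ i\<bar> * (\<epsilon> / (2 * L) * N)"
        unfolding abs_mult N_def by (intro mult_left_mono \<delta>2(2)[OF y1(2)]) auto
    qed
    also have "\<dots> = (\<Sum>i\<in>UNIV. \<bar>a $ i\<bar>) * (\<epsilon> / (2 * L) * N)" by (simp only: sum_distrib_right)
    also have "\<dots> \<le> L * (\<epsilon> / (2 * L) * N)"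
    proof (rule mult_right_mono)
      show "0 \<le> \<epsilon> / (2 * L) * N" using e2 N0 by (intro mult_nonneg_nonneg) auto
    qed (simp add: L_def)
    also have "\<dots> = \<epsilon> / 2 * N" using L by simp
    finally have B: "\<bar>(\<Sum>i\<in>UNIV. a $ i * (F y - F x) $ i) - (\<Sum>j\<in>UNIV. (a v* D) $ j * (y - x) $ j)\<bar> \<le> \<epsilon> / 2 * N" .
    have "\<epsilon> / 2 * N + \<epsilon> / 2 * N = \<epsilon> * N" by (simp flip: distrib_right)
    then show ?thesis using A B unfolding N_def[symmetric] by linarith
  qed
  ultimately show "\<exists>\<delta>>0. \<forall>y\<in>cube UNIV x \<delta>.
      \<bar>h (F y) - h (F x) - (\<Sum>j\<in>UNIV. (a v* D) $ j * (y - x) $ j)\<bar> \<le> \<epsilon> * sup_norm (y - x)" by blast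
qed

lemma has_gradient_coord: "has_gradient (\<lambda>x :: 'a::linordered_field ^ 'n::finite. x $ i) (axis i 1) x"
proof -
  have "(\<Sum>j\<in>UNIV. axis i 1 $ j * v $ j) = v $ i" for v :: "'a ^ 'n"
    by (simp add: axis_def if_distrib[of "\<lambda>z. z * _"] cong: if_cong)
  from this[of "y - x" for y] have *: "(\<Sum>j\<in>UNIV. axis i 1 $ j * (y - x) $ j) = y $ i - x $ i" for y
    by (simp only: vector_minus_component)
  show ?thesis unfolding has_gradient_def *
    by (auto simp: sup_norm_ge_0 intro!: exI[of _ 1] mult_nonneg_nonneg)
qed

lemma has_gradient_scale:
  fixes f :: "'a::linordered_field ^ 'n::finite \<Rightarrow> 'a"
  assumes f: "has_gradient f g x"
  shows "has_gradient (\<lambda>y. c * f y) (c *s g) x"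
  unfolding has_gradient_def
proof (intro allI impI)
  fix \<epsilon> :: 'a assume e: "0 < \<epsilon>"
  have pos: "0 < \<bar>c\<bar> + 1" by (simp add: add_nonneg_pos)
  then obtain \<delta> where \<delta>: "0 < \<delta>" "\<And>y. y \<in> cube UNIV x \<delta> \<Longrightarrow>
      \<bar>f y - f x - (\<Sum>j\<in>UNIV. g $ j * (y - x) $ j)\<bar> \<le> \<epsilon> / (\<bar>c\<bar> + 1) * sup_norm (y - x)"
    using has_gradientE[OF f, of "\<epsilon> / (\<bar>c\<bar> + 1)"] e by auto
  have "\<bar>c * f y - c * f x - (\<Sum>j\<in>UNIV. (c *s g) $ j * (y - x) $ j)\<bar> \<le> \<epsilon> * sup_norm (y - x)"
    if y: "y \<in> cube UNIV x \<delta>" for y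
  proof -
    have "c * f y - c * f x - (\<Sum>j\<in>UNIV. (c *s g) $ j * (y - x) $ j) =
        c * (f y - f x - (\<Sum>j\<in>UNIV. g $ j * (y - x) $ j))"
      by (simp add: algebra_simps sum_distrib_left)
    also have "\<bar>\<dots>\<bar> \<le> (\<bar>c\<bar> + 1) * (\<epsilon> / (\<bar>c\<bar> + 1) * sup_norm (y - x))"
      unfolding abs_mult using \<delta>(2)[OF y] by (intro mult_mono) auto
    finally show ?thesis using pos by simp
  qed
  then show "\<exists>\<delta>>0. \<forall>y\<in>cube UNIV x \<delta>.
      \<bar>c * f y - c * f x - (\<Sum>j\<in>UNIV. (c *s g) $ j * (y - x) $ j)\<bar> \<le> \<epsilon> * sup_norm (y - x)"
    using \<delta>(1) by blast
qed

lemma has_gradient_add: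
  fixes f f' :: "'a::linordered_field ^ 'n::finite \<Rightarrow> 'a"
  assumes f: "has_gradient f g x" and f': "has_gradient f' g' x"
  shows "has_gradient (\<lambda>y. f y + f' y) (g + g') x"
  unfolding has_gradient_def
proof (intro allI impI)
  fix \<epsilon> :: 'a assume e: "0 < \<epsilon>"
  obtain \<delta> where \<delta>: "0 < \<delta>" "\<And>y. y \<in> cube UNIV x \<delta> \<Longrightarrow>
      \<bar>f y - f x - (\<Sum>j\<in>UNIV. g $ j * (y - x) $ j)\<bar> \<le> \<epsilon> / 2 * sup_norm (y - x)"
    using has_gradientE[OF f, of "\<epsilon> / 2"] e by auto
  obtain \<delta>' where \<delta>': "0 < \<delta>'" "\<And>y. y \<in> cube UNIV x \<delta>' \<Longrightarrow>
      \<bar>f' y - f' x - (\<Sum>j\<in>UNIV. g' $ j * (y - x) $ j)\<bar> \<le> \<epsilon> / 2 * sup_norm (y - x)"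
    using has_gradientE[OF f', of "\<epsilon> / 2"] e by auto
  have "\<bar>f y + f' y - (f x + f' x) - (\<Sum>j\<in>UNIV. (g + g') $ j * (y - x) $ j)\<bar> \<le> \<epsilon> * sup_norm (y - x)"
    if y: "y \<in> cube UNIV x (min \<delta> \<delta>')" for y
  proof -
    have "(\<Sum>j\<in>UNIV. (g + g') $ j * (y - x) $ j) =
        (\<Sum>j\<in>UNIV. g $ j * (y - x) $ j) + (\<Sum>j\<in>UNIV. g' $ j * (y - x) $ j)"
      by (simp add: distrib_right sum.distrib)
    moreover have "\<bar>f y - f x - (\<Sum>j\<in>UNIV. g $ j * (y - x) $ j)\<bar> \<le> \<epsilon> / 2 * sup_norm (y - x)"
      using y by (intro \<delta>(2)) (auto simp: mem_cube_UNIV)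
    moreover have "\<bar>f' y - f' x - (\<Sum>j\<in>UNIV. g' $ j * (y - x) $ j)\<bar> \<le> \<epsilon> / 2 * sup_norm (y - x)"
      using y by (intro \<delta>'(2)) (auto simp: mem_cube_UNIV)
    moreover have "\<epsilon> / 2 * sup_norm (y - x) + \<epsilon> / 2 * sup_norm (y - x) = \<epsilon> * sup_norm (y - x)"
      by (simp flip: distrib_right)
    ultimately show ?thesis by linarith
  qed
  then show "\<exists>\<delta>>0. \<forall>y\<in>cube UNIV x \<delta>.
      \<bar>f y + f' y - (f x + f' x) - (\<Sum>j\<in>UNIV. (g + g') $ j * (y - x) $ j)\<bar> \<le> \<epsilon> * sup_norm (y - x)"
    using \<delta>(1) \<delta>'(1) by (intro exI[of _ "min \<delta> \<delta>'"]) auto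
qed

lemma continuous_at_const: "continuous_at (\<lambda>_. c) x"
  by (auto simp: cont_on_cubes_def intro: exI[of _ 1])

lemma continuous_at_local:
  fixes f f' :: "'a::linordered_field ^ 'n::finite \<Rightarrow> 'a"
  assumes "continuous_at f x" "0 < r" "\<And>y. y \<in> cube UNIV x r \<Longrightarrow> f' y = f y"
  shows "continuous_at f' x"
  unfolding cont_on_cubes_def
proof (intro allI impI)
  fix \<epsilon> :: 'a assume "0 < \<epsilon>"
  then obtain \<delta> where \<delta>: "0 < \<delta>" "\<And>y. y \<in> cube UNIV x \<delta> \<Longrightarrow> \<bar>f y - f x\<bar> < \<epsilon>"
    using cont_on_cubesE[OF assms(1)] by blast
  have "\<bar>f' y - f' x\<bar> < \<epsilon>" if y: "y \<in> cube UNIV x (min \<delta> r)" for y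
  proof -
    have "y \<in> cube UNIV x \<delta>" "y \<in> cube UNIV x r" using y by (auto simp: mem_cube_UNIV)
    then show ?thesis using \<delta>(2)[of y] assms(3)[of y] assms(3)[of x] cube_center[OF assms(2), of x UNIV] by simp
  qed
  then show "\<exists>\<delta>>0. \<forall>y\<in>cube UNIV x \<delta>. \<bar>f' y - f' x\<bar> < \<epsilon>"
    using \<delta>(1) assms(2) by (intro exI[of _ "min \<delta> r"]) auto
qed

lemma continuous_at_add:
  fixes f g :: "'a::linordered_field ^ 'n::finite \<Rightarrow> 'a"
  assumes "continuous_at f x" "continuous_at g x"
  shows "continuous_at (\<lambda>y. f y + g y) x"
  unfolding cont_on_cubes_def
proof (intro allI impI)
  fix \<epsilon> :: 'a assume "0 < \<epsilon>"
  then have e: "0 < \<epsilon> / 2" by simp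
  obtain \<delta> where \<delta>: "0 < \<delta>" "\<And>y. y \<in> cube UNIV x \<delta> \<Longrightarrow> \<bar>f y - f x\<bar> < \<epsilon> / 2"
    using cont_on_cubesE[OF assms(1) e] by blast
  obtain \<delta>' where \<delta>': "0 < \<delta>'" "\<And>y. y \<in> cube UNIV x \<delta>' \<Longrightarrow> \<bar>g y - g x\<bar> < \<epsilon> / 2"
    using cont_on_cubesE[OF assms(2) e] by blast
  have "\<bar>f y + g y - (f x + g x)\<bar> < \<epsilon>" if y: "y \<in> cube UNIV x (min \<delta> \<delta>')" for y
  proof -
    have "\<bar>f y - f x\<bar> < \<epsilon> / 2" using y by (intro \<delta>(2)) (auto simp: mem_cube_UNIV)
    moreover have "\<bar>g y - g x\<bar> < \<epsilon> / 2" using y by (intro \<delta>'(2)) (auto simp: mem_cube_UNIV)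
    moreover have "\<epsilon> / 2 + \<epsilon> / 2 = \<epsilon>" by simp
    ultimately show ?thesis by linarith
  qed
  then show "\<exists>\<delta>>0. \<forall>y\<in>cube UNIV x \<delta>. \<bar>f y + g y - (f x + g x)\<bar> < \<epsilon>"
    using \<delta>(1) \<delta>'(1) by (intro exI[of _ "min \<delta> \<delta>'"]) auto
qed

lemma continuous_at_mult:
  fixes f g :: "'a::linordered_field ^ 'n::finite \<Rightarrow> 'a"
  assumes "continuous_at f x" "continuous_at g x"
  shows "continuous_at (\<lambda>y. f y * g y) x"
  unfolding cont_on_cubes_def
proof (intro allI impI)
  fix \<epsilon> :: 'a assume e: "0 < \<epsilon>"
  define B where "B = \<bar>f x\<bar> + \<bar>g x\<bar> + 1"
  have B: "0 < B" by (simp add: B_def add_nonneg_pos)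
  define d where "d = min 1 (\<epsilon> / B)"
  have d: "0 < d" "d \<le> 1" "d \<le> \<epsilon> / B" using e B by (auto simp: d_def)
  obtain \<delta> where \<delta>: "0 < \<delta>" "\<And>y. y \<in> cube UNIV x \<delta> \<Longrightarrow> \<bar>f y - f x\<bar> < d"
    using cont_on_cubesE[OF assms(1) d(1)] by blast
  obtain \<delta>' where \<delta>': "0 < \<delta>'" "\<And>y. y \<in> cube UNIV x \<delta>' \<Longrightarrow> \<bar>g y - g x\<bar> < d"
    using cont_on_cubesE[OF assms(2) d(1)] by blast
  have "\<bar>f y * g y - f x * g x\<bar> < \<epsilon>" if y: "y \<in> cube UNIV x (min \<delta> \<delta>')" for y
  proof -
    have 1: "\<bar>f y - f x\<bar> < d" using y by (intro \<delta>(2)) (auto simp: mem_cube_UNIV)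
    have 2: "\<bar>g y - g x\<bar> < d" using y by (intro \<delta>'(2)) (auto simp: mem_cube_UNIV)
    have "f y * g y - f x * g x = (f y - f x) * (g y - g x) + ((f y - f x) * g x + f x * (g y - g x))"
      by (simp add: algebra_simps)
    also have "\<bar>\<dots>\<bar> \<le> \<bar>f y - f x\<bar> * \<bar>g y - g x\<bar> + (\<bar>f y - f x\<bar> * \<bar>g x\<bar> + \<bar>f x\<bar> * \<bar>g y - g x\<bar>)"
      by (intro order_trans[OF abs_triangle_ineq] add_mono) (auto simp: abs_mult intro: order_trans[OF abs_triangle_ineq])
    also have "\<dots> < d * 1 + (d * \<bar>g x\<bar> + \<bar>f x\<bar> * d)"
      using 1 2 d by (intro add_less_le_mono add_mono mult_strict_mono' mult_mono) auto
    also have "\<dots> = d * B" by (simp add: B_def algebra_simps)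
    also have "\<dots> \<le> \<epsilon>" using d(3) B by (simp add: field_simps)
    finally show ?thesis .
  qed
  then show "\<exists>\<delta>>0. \<forall>y\<in>cube UNIV x \<delta>. \<bar>f y * g y - f x * g x\<bar> < \<epsilon>"
    using \<delta>(1) \<delta>'(1) by (intro exI[of _ "min \<delta> \<delta>'"]) auto
qed

lemma continuous_at_sum:
  "finite A \<Longrightarrow> (\<And>i. i \<in> A \<Longrightarrow> continuous_at (f i) x) \<Longrightarrow> continuous_at (\<lambda>y. \<Sum>i\<in>A. f i y) x"
  by (induction A rule: finite_induct) (auto intro: continuous_at_const continuous_at_add)

lemma continuous_near:
  fixes F :: "'a::linordered_field ^ 'n::finite \<Rightarrow> 'a ^ 'm::finite"
  assumes F: "\<And>i. continuous_at (\<lambda>y. F y $ i) x" and e: "0 < \<epsilon>"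
  shows "\<exists>\<delta>>0. \<forall>y\<in>cube UNIV x \<delta>. F y \<in> cube UNIV (F x) \<epsilon>"
proof -
  have "\<exists>\<delta>>0. \<forall>i. \<forall>y\<in>cube UNIV x \<delta>. \<bar>F y $ i - F x $ i\<bar> < \<epsilon>"
  proof (rule uniform_radius)
    show "\<exists>\<delta>>0. \<forall>y\<in>cube UNIV x \<delta>. \<bar>F y $ i - F x $ i\<bar> < \<epsilon>" for i
      using F[of i] e unfolding cont_on_cubes_def by blast
  qed (auto dest: cube_UNIV_mono)
  then show ?thesis by (auto simp: cube_def)
qed

lemma continuous_at_compose:
  fixes F :: "'a::linordered_field ^ 'n::finite \<Rightarrow> 'a ^ 'm::finite"
  assumes h: "continuous_at h (F x)" and F: "\<And>i. continuous_at (\<lambda>y. F y $ i) x"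
  shows "continuous_at (\<lambda>y. h (F y)) x"
  unfolding cont_on_cubes_def
proof (intro allI impI)
  fix \<epsilon> :: 'a assume "0 < \<epsilon>"
  then obtain \<delta> where \<delta>: "0 < \<delta>" "\<And>y. y \<in> cube UNIV (F x) \<delta> \<Longrightarrow> \<bar>h y - h (F x)\<bar> < \<epsilon>"
    using cont_on_cubesE[OF h] by blast
  then show "\<exists>\<delta>>0. \<forall>y\<in>cube UNIV x \<delta>. \<bar>h (F y) - h (F x)\<bar> < \<epsilon>"
    using continuous_near[OF F \<delta>(1)] by blast
qed

lemma open_iff_cube:
  fixes U :: "('a::{linordered_field,linorder_topology} ^ 'n::finite) set"
  shows "open U \<longleftrightarrow> (\<forall>x\<in>U. \<exists>r>0. cube UNIV x r \<subseteq> U)"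
proof
  assume U: "open U"
  show "\<forall>x\<in>U. \<exists>r>0. cube UNIV x r \<subseteq> U"
  proof
    fix x assume "x \<in> U"
    then obtain A where A: "\<And>i. open (A i) \<and> x $ i \<in> A i" "\<And>y. \<forall>i. y $ i \<in> A i \<Longrightarrow> y \<in> U"
      using U unfolding open_vec_def by blast
    have "\<exists>r>0. \<forall>i. \<forall>t. \<bar>t - x $ i\<bar> < r \<longrightarrow> t \<in> A i"
    proof (rule uniform_radius)
      fix i
      obtain b where b: "x $ i < b" "{x $ i..<b} \<subseteq> A i"
        using open_right[of "A i" "x $ i" "x $ i + 1"] A(1)[of i] by auto
      obtain c where c: "c < x $ i" "{c<..x $ i} \<subseteq> A i"
        using open_left[of "A i" "x $ i" "x $ i - 1"] A(1)[of i] by auto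
      have "t \<in> A i" if "\<bar>t - x $ i\<bar> < min (b - x $ i) (x $ i - c)" for t
      proof (cases "x $ i \<le> t")
        case True
        then have "t \<in> {x $ i..<b}" using that by auto
        then show ?thesis using b(2) by blast
      next
        case False
        then have "t \<in> {c<..x $ i}" using that by auto
        then show ?thesis using c(2) by blast
      qed
      then show "\<exists>r>0. \<forall>t. \<bar>t - x $ i\<bar> < r \<longrightarrow> t \<in> A i"
        using b(1) c(1) by (intro exI[of _ "min (b - x $ i) (x $ i - c)"]) auto
    qed auto
    then show "\<exists>r>0. cube UNIV x r \<subseteq> U" using A(2) by (auto simp: cube_def)
  qed
next
  assume *: "\<forall>x\<in>U. \<exists>r>0. cube UNIV x r \<subseteq> U"
  show "open U" unfolding open_vec_def
  proof
    fix x assume "x \<in> U"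
    then obtain r where r: "0 < r" "cube UNIV x r \<subseteq> U" using * by blast
    then show "\<exists>A. (\<forall>i. open (A i) \<and> x $ i \<in> A i) \<and> (\<forall>y. (\<forall>i. y $ i \<in> A i) \<longrightarrow> y \<in> U)"
      by (intro exI[of _ "\<lambda>i. {x $ i - r<..<x $ i + r}"])
        (auto simp: cube_def abs_less_iff algebra_simps dest!: subsetD)
  qed
qed

lemma continuous_on_iff_cubes:
  fixes g :: "'a::{linordered_field,linorder_topology} ^ 'n::finite \<Rightarrow> 'a"
  assumes U: "open U"
  shows "continuous_on U g \<longleftrightarrow> (\<forall>x\<in>U. continuous_at g x)"
proof
  assume c: "continuous_on U g"
  show "\<forall>x\<in>U. continuous_at g x" unfolding cont_on_cubes_def
  proof (intro ballI allI impI)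
    fix x and \<epsilon> :: 'a assume x: "x \<in> U" "0 < \<epsilon>"
    have "open (g -` {g x - \<epsilon><..<g x + \<epsilon>} \<inter> U)"
      using c continuous_on_open_vimage[OF U, of g] open_greaterThanLessThan by blast
    moreover have "x \<in> g -` {g x - \<epsilon><..<g x + \<epsilon>} \<inter> U" using x by auto
    ultimately obtain r where r: "0 < r" "cube UNIV x r \<subseteq> g -` {g x - \<epsilon><..<g x + \<epsilon>} \<inter> U"
      unfolding open_iff_cube by blast
    have "\<bar>g y - g x\<bar> < \<epsilon>" if "y \<in> cube UNIV x r" for y
    proof -
      have "y \<in> g -` {g x - \<epsilon><..<g x + \<epsilon>} \<inter> U" using r(2) that by blast
      then show ?thesis by (auto simp: abs_less_iff algebra_simps)
    qed
    then show "\<exists>\<delta>>0. \<forall>y\<in>cube UNIV x \<delta>. \<bar>g y - g x\<bar> < \<epsilon>" using r(1) by blast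
  qed
next
  assume c: "\<forall>x\<in>U. continuous_at g x"
  show "continuous_on U g"
    unfolding continuous_on_open_vimage[OF U]
  proof (intro allI impI)
    fix B :: "'a set" assume B: "open B"
    show "open (g -` B \<inter> U)" unfolding open_iff_cube
    proof
      fix x assume x: "x \<in> g -` B \<inter> U"
      have "g x \<in> B" using x by simp
      obtain b where b: "g x < b" "{g x..<b} \<subseteq> B" using open_right[OF B \<open>g x \<in> B\<close>, of "g x + 1"] by auto
      obtain a where a: "a < g x" "{a<..g x} \<subseteq> B" using open_left[OF B \<open>g x \<in> B\<close>, of "g x - 1"] by auto
      obtain \<delta> where \<delta>: "0 < \<delta>" "\<And>y. y \<in> cube UNIV x \<delta> \<Longrightarrow> \<bar>g y - g x\<bar> < min (b - g x) (g x - a)"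
        using cont_on_cubesE[of UNIV g x "min (b - g x) (g x - a)"] c x a(1) b(1) by auto
      have "g y \<in> B" if "y \<in> cube UNIV x \<delta>" for y
      proof (cases "g x \<le> g y")
        case True
        then have "g y \<in> {g x..<b}" using \<delta>(2)[OF that] by auto
        then show ?thesis using b(2) by blast
      next
        case False
        then have "g y \<in> {a<..g x}" using \<delta>(2)[OF that] by auto
        then show ?thesis using a(2) by blast
      qed
      moreover obtain r where "0 < r" "cube UNIV x r \<subseteq> U" using x U unfolding open_iff_cube by blast
      ultimately have "cube UNIV x (min \<delta> r) \<subseteq> g -` B \<inter> U"
        by (auto simp: mem_cube_UNIV subset_iff)
      then show "\<exists>r>0. cube UNIV x r \<subseteq> g -` B \<inter> U"
        using \<delta>(1) \<open>0 < r\<close> by (intro exI[of _ "min \<delta> r"]) auto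
    qed
  qed
qed

lemma has_jacobian_matrix_iff:
  fixes f :: "'a::{linordered_field,linorder_topology} ^ 'n::finite \<Rightarrow> 'a ^ 'm::finite"
  assumes U: "open U" and x: "x \<in> U"
  shows "has_jacobian_matrix f A x U \<longleftrightarrow> (\<forall>i. has_gradient (\<lambda>y. f y $ i) (A $ i) x)"
proof -
  have comp: "(f y - f x - A *v (y - x)) $ i = f y $ i - f x $ i - (\<Sum>j\<in>UNIV. A $ i $ j * (y - x) $ j)" for y i
    by (simp add: matrix_vector_mult_def)
  obtain r where r: "0 < r" "cube UNIV x r \<subseteq> U" using U x unfolding open_iff_cube by blast
  show ?thesis
  proof
    assume h: "has_jacobian_matrix f A x U"
    show "\<forall>i. has_gradient (\<lambda>y. f y $ i) (A $ i) x" unfolding has_gradient_def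
    proof (intro allI impI)
      fix i and \<epsilon> :: 'a assume "0 < \<epsilon>"
      then obtain \<delta> where \<delta>: "0 < \<delta>" "\<And>y. y \<in> U \<Longrightarrow> sup_norm (y - x) < \<delta> \<Longrightarrow>
          sup_norm (f y - f x - A *v (y - x)) \<le> \<epsilon> * sup_norm (y - x)"
        using h unfolding has_jacobian_matrix_def by blast
      have "\<bar>f y $ i - f x $ i - (\<Sum>j\<in>UNIV. A $ i $ j * (y - x) $ j)\<bar> \<le> \<epsilon> * sup_norm (y - x)"
        if y: "y \<in> cube UNIV x (min \<delta> r)" for y
      proof -
        have "y \<in> cube UNIV x r" "sup_norm (y - x) < \<delta>" using y by (auto simp: mem_cube_UNIV)
        then have "sup_norm (f y - f x - A *v (y - x)) \<le> \<epsilon> * sup_norm (y - x)" using \<delta>(2) r(2) by blast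
        then show ?thesis unfolding sup_norm_le_iff comp by blast
      qed
      then show "\<exists>\<delta>>0. \<forall>y\<in>cube UNIV x \<delta>.
          \<bar>f y $ i - f x $ i - (\<Sum>j\<in>UNIV. A $ i $ j * (y - x) $ j)\<bar> \<le> \<epsilon> * sup_norm (y - x)"
        using \<delta>(1) r(1) by (intro exI[of _ "min \<delta> r"]) auto
    qed
  next
    assume h: "\<forall>i. has_gradient (\<lambda>y. f y $ i) (A $ i) x"
    show "has_jacobian_matrix f A x U" unfolding has_jacobian_matrix_def
    proof (intro allI impI)
      fix \<epsilon> :: 'a assume e: "0 < \<epsilon>"
      have "\<exists>\<delta>>0. \<forall>i. \<forall>y\<in>cube UNIV x \<delta>.
          \<bar>f y $ i - f x $ i - (\<Sum>j\<in>UNIV. A $ i $ j * (y - x) $ j)\<bar> \<le> \<epsilon> * sup_norm (y - x)"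
      proof (rule uniform_radius)
        show "\<exists>\<delta>>0. \<forall>y\<in>cube UNIV x \<delta>.
          \<bar>f y $ i - f x $ i - (\<Sum>j\<in>UNIV. A $ i $ j * (y - x) $ j)\<bar> \<le> \<epsilon> * sup_norm (y - x)" for i
          using h[rule_format, of i] e by (simp only: has_gradient_def)
      qed (blast dest: cube_UNIV_mono)
      then show "\<exists>\<delta>>0. \<forall>y\<in>U. sup_norm (y - x) < \<delta> \<longrightarrow>
          sup_norm (f y - f x - A *v (y - x)) \<le> \<epsilon> * sup_norm (y - x)"
        unfolding sup_norm_le_iff comp mem_cube_UNIV Ball_def by blast
    qed
  qed
qed

text \<open>
  A \<open>C1_map\<close> with its derivative named, described entry by entry.
\<close>

definition C1_with_derivative ::
  "('a::linordered_field ^ 'n::finite) set \<Rightarrow> ('a ^ 'n \<Rightarrow> 'a ^ 'm::finite) \<Rightarrow> ('a ^ 'n \<Rightarrow> 'a ^ 'n ^ 'm) \<Rightarrow> bool" where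
  "C1_with_derivative U f D \<longleftrightarrow> (\<forall>x\<in>U. \<forall>i. has_gradient (\<lambda>y. f y $ i) (D x $ i) x \<and>
     (\<forall>j. continuous_at (\<lambda>y. D y $ i $ j) x))"

lemma jacobian_matrix_eq:
  fixes f :: "'a::{linordered_field,linorder_topology} ^ 'n::finite \<Rightarrow> 'a ^ 'm::finite"
  assumes U: "open U" and x: "x \<in> U" and h: "\<And>i. has_gradient (\<lambda>y. f y $ i) (A $ i) x"
  shows "jacobian_matrix U f x = A"
  unfolding jacobian_matrix_def
proof (rule some_equality)
  show "has_jacobian_matrix f A x U" using h by (simp add: has_jacobian_matrix_iff[OF U x])
next
  fix B assume "has_jacobian_matrix f B x U"
  then have "B $ i = A $ i" for i
    using h has_gradient_unique unfolding has_jacobian_matrix_iff[OF U x] by blast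
  then show "B = A" by (simp add: vec_eq_iff)
qed

lemma continuous_on_vec_iff:
  fixes g :: "'b::topological_space \<Rightarrow> 'c::topological_space ^ 'm::finite"
  shows "continuous_on U g \<longleftrightarrow> (\<forall>i. continuous_on U (\<lambda>x. g x $ i))"
proof
  assume "\<forall>i. continuous_on U (\<lambda>x. g x $ i)"
  then have "continuous_on U (\<lambda>x. \<chi> i. g x $ i)" by (intro continuous_on_vec_lambda) auto
  then show "continuous_on U g" by simp
qed (auto intro: continuous_on_component)

lemma C1_map_iff:
  fixes f :: "'a::{linordered_field,linorder_topology} ^ 'n::finite \<Rightarrow> 'a ^ 'm::finite"
  shows "C1_map U f \<longleftrightarrow> open U \<and> (\<exists>D. C1_with_derivative U f D)"
proof (cases "open U")
  case U: True
  have cont: "continuous_on U (jacobian_matrix U f) \<longleftrightarrow>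
      (\<forall>x\<in>U. \<forall>i j. continuous_at (\<lambda>y. jacobian_matrix U f y $ i $ j) x)"
    unfolding continuous_on_vec_iff[of U "jacobian_matrix U f"]
      continuous_on_vec_iff[of U "\<lambda>x. jacobian_matrix U f x $ _"] continuous_on_iff_cubes[OF U] by blast
  show ?thesis
  proof
    assume C: "C1_map U f"
    have "has_gradient (\<lambda>y. f y $ i) (jacobian_matrix U f x $ i) x" if x: "x \<in> U" for x i
    proof -
      obtain A where A: "has_jacobian_matrix f A x U" using C x unfolding C1_map_def by blast
      then show ?thesis using jacobian_matrix_eq[OF U x, of f A] unfolding has_jacobian_matrix_iff[OF U x] by auto
    qed
    moreover have "continuous_on U (jacobian_matrix U f)" using C by (simp add: C1_map_def)
    ultimately have "C1_with_derivative U f (jacobian_matrix U f)"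
      unfolding cont C1_with_derivative_def by simp
    then show "open U \<and> (\<exists>D. C1_with_derivative U f D)" using U by blast
  next
    assume "open U \<and> (\<exists>D. C1_with_derivative U f D)"
    then obtain D where D: "C1_with_derivative U f D" by blast
    have J: "jacobian_matrix U f x = D x" if "x \<in> U" for x
      using D that unfolding C1_with_derivative_def by (intro jacobian_matrix_eq[OF U that]) auto
    have "\<exists>A. has_jacobian_matrix f A x U" if "x \<in> U" for x
      using D that unfolding has_jacobian_matrix_iff[OF U that] C1_with_derivative_def by blast
    moreover have "continuous_at (\<lambda>y. jacobian_matrix U f y $ i $ j) x" if x: "x \<in> U" for x i j
    proof -
      obtain r where r: "0 < r" "cube UNIV x r \<subseteq> U" using U x unfolding open_iff_cube by blast
      have "continuous_at (\<lambda>y. D y $ i $ j) x" using D x unfolding C1_with_derivative_def by blast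
      moreover have "jacobian_matrix U f y $ i $ j = D y $ i $ j" if "y \<in> cube UNIV x r" for y
        using J r(2) that by auto
      ultimately show ?thesis by (rule continuous_at_local[OF _ r(1)])
    qed
    ultimately show "C1_map U f" unfolding C1_map_def cont using U by simp
  qed
qed (simp add: C1_map_def)

section \<open>Definable functions are generically continuously differentiable\<close>

context definability begin

lemma dterm_vec_minus:
  fixes u v :: "'e \<Rightarrow> 'a ^ 'n"
  assumes "\<And>i. dterm C (\<lambda>z. u z $ i)" "\<And>i. dterm C (\<lambda>z. v z $ i)"
  shows "dterm C (\<lambda>z. (u z - v z) $ i)"
  using assms by (simp add: dterm_diff)

lemma dterm_sup_norm:
  fixes v :: "'e \<Rightarrow> 'a ^ 'n::finite"
  assumes "\<And>i. dterm C (\<lambda>z. v z $ i)"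
  shows "dterm C (\<lambda>z. sup_norm (v z))"
proof (rule dtermI[of _ "\<lambda>z a. (\<forall>i\<in>UNIV. \<bar>v z $ i\<bar> \<le> a) \<and> (\<exists>i\<in>UNIV. \<bar>v z $ i\<bar> = a)"])
  show "sup_norm (v z) = a \<longleftrightarrow> (\<forall>i\<in>UNIV. \<bar>v z $ i\<bar> \<le> a) \<and> (\<exists>i\<in>UNIV. \<bar>v z $ i\<bar> = a)" for z a
    using sup_norm_attained[of "v z"] component_le_sup_norm[of "v z"] sup_norm_le_iff[of "v z" a]
    by (auto intro: order_antisym)
  show "dfn (pr C sc) (\<lambda>z. (\<forall>i\<in>UNIV. \<bar>v (fst z) $ i\<bar> \<le> snd z) \<and> (\<exists>i\<in>UNIV. \<bar>v (fst z) $ i\<bar> = snd z))"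
    by (intro dfn_conj dfn_ball_fin dfn_bex_fin dfn_le dfn_eq dterm_abs dterm_snd_sc dterm_fst assms)
qed

lemma dfn_has_gradient:
  fixes f :: "'a ^ 'n::finite \<Rightarrow> 'a"
  assumes f: "dterm vc f" and G: "\<And>j. dterm vc (\<lambda>x. G x $ j)"
  shows "dfn vc (\<lambda>x. has_gradient f (G x) x)"
  unfolding has_gradient_def Ball_def
  by (intro dfn_intros dfn_cube dterm_vec_subst[OF f] dterm_vec_subst[OF G] dterm_vec_minus
      dterm_sup_norm dterm_intros dterm_sum finite dterm_fst dterm_snd)

end

context o_minimal_structure begin

lemma deriv1_unique:
  assumes "deriv1 f t L" "deriv1 f t L'"
  shows "L = L'"
proof -
  have "right_deriv f t L" if "deriv1 f t L" for L
    unfolding right_deriv_def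
  proof (intro allI impI)
    fix \<epsilon> :: 'a assume "0 < \<epsilon>"
    then obtain \<delta> where \<delta>: "0 < \<delta>" "\<And>h. \<bar>h\<bar> < \<delta> \<Longrightarrow> \<bar>f (t + h) - f t - L * h\<bar> \<le> \<epsilon> * \<bar>h\<bar>"
      using \<open>deriv1 f t L\<close> unfolding deriv1_def by blast
    have "\<bar>f (t + h) - f t - L * h\<bar> \<le> \<epsilon> * h" if "0 < h \<and> h < \<delta>" for h
      using \<delta>(2)[of h] that by simp
    then show "\<exists>\<delta>>0. \<forall>h. 0 < h \<and> h < \<delta> \<longrightarrow> \<bar>f (t + h) - f t - L * h\<bar> \<le> \<epsilon> * h"
      using \<delta>(1) by blast
  qed
  then show ?thesis using assms right_deriv_unique by blast
qed

definition has_partial :: "('a ^ 'n \<Rightarrow> 'a) \<Rightarrow> 'n \<Rightarrow> 'a ^ 'n \<Rightarrow> 'a \<Rightarrow> bool" where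
  "has_partial f j x L \<longleftrightarrow> deriv1 (\<lambda>t. f (upd x j t)) (x $ j) L"

lemma dfn_has_partial:
  fixes f :: "'a ^ 'n::finite \<Rightarrow> 'a"
  assumes f: "dterm vc f"
  shows "dfn (pr vc sc) (\<lambda>z. has_partial f j (fst z) (snd z))"
  unfolding has_partial_def deriv1_def
  by (intro dfn_intros dterm_vec_subst[OF f] dterm_upd dterm_intros dterm_fst dterm_snd)

lemma decided_on_subcube_UNIV: "decided_on_subcube (UNIV :: 'n::finite set)"
  using generically_continuous_decided_on_subcube generic_calculus by blast

lemma uniform_on_subcube_UNIV: "uniform_on_subcube (UNIV :: 'n::finite set)"
  using generic_calculus by blast

lemma generic_continuous_at: "dterm vc f \<Longrightarrow> generic (UNIV :: 'n::finite set) (continuous_at f)"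
  using generic_calculus[of "UNIV :: 'n set"] unfolding generically_continuous_def by blast

lemma generic_has_partial:
  fixes f :: "'a ^ 'n::finite \<Rightarrow> 'a"
  assumes f: "dterm vc f"
  shows "generic UNIV (\<lambda>x. \<exists>L. has_partial f j x L)"
proof (rule decided_on_subcube_generic[OF decided_on_subcube_UNIV])
  show "dfn vc (\<lambda>x. \<exists>L. has_partial f j x L)"
    by (intro dfn_ex dfn_has_partial[OF f])
  fix q :: "'a ^ 'n" and s :: 'a assume s: "0 < s"
  have "dterm sc (\<lambda>t. f (upd q j t))" by (intro dterm_vec_subst[OF f] dterm_upd dterm_intros)
  moreover have "q $ j - s < q $ j + s" using s by simp
  ultimately obtain t L where t: "q $ j - s < t" "t < q $ j + s" "deriv1 (\<lambda>t. f (upd q j t)) t L"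
    using exists_deriv1 by metis
  then have "upd q j t \<in> cube UNIV q s" using s by (auto simp: cube_def abs_less_iff)
  moreover have "has_partial f j (upd q j t) L" using t(3) by (simp add: has_partial_def)
  ultimately show "\<exists>x\<in>cube UNIV q s. \<exists>L. has_partial f j x L" by blast
qed

text \<open>
  The partial derivatives exist and are continuous generically, by the results in one variable. The
  usual passage to total differentiability needs the mean value theorem; here uniformity replaces it. If
  the total derivative failed to exist on a cube, the error would exceed \<open>\<eta> * sup_norm (y - x)\<close> with one
  \<open>\<eta>\<close> for all \<open>x\<close> in a subcube and suitable \<open>y\<close> near \<open>x\<close>. But with a uniform radius for the
  partial derivatives, going from \<open>x\<close> to \<open>y\<close> one coordinate at a time gives an error below that.
\<close>

lemma generic_C1:
  fixes f :: "'a ^ 'n::finite \<Rightarrow> 'a"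
  assumes f: "dterm vc f"
  shows "\<exists>G. (\<forall>j. dterm vc (\<lambda>x. G x $ j)) \<and>
    generic UNIV (\<lambda>x. has_gradient f (G x) x \<and> (\<forall>j. continuous_at (\<lambda>y. G y $ j) x))"
proof -
  define p where "p j x = (if \<exists>L. has_partial f j x L then THE L. has_partial f j x L else 0)" for j x
  define G where "G x = (\<chi> j. p j x)" for x
  have G: "dterm vc (\<lambda>x. G x $ j)" for j
    unfolding G_def p_def vec_lambda_beta
    by (rule dterm_the[OF _ dfn_has_partial[OF f]]) (auto simp: has_partial_def intro: deriv1_unique)
  have Gp: "has_partial f j x (G x $ j)" if ex: "\<exists>L. has_partial f j x L" for j x
  proof -
    have "\<exists>!L. has_partial f j x L" using ex unfolding has_partial_def by (blast intro: deriv1_unique)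
    from theI'[OF this] show ?thesis using ex by (simp add: G_def p_def)
  qed
  have gp: "generic UNIV (\<lambda>x. \<forall>j\<in>UNIV. has_partial f j x (G x $ j))"
    by (intro generic_ball finite) (rule generic_mono[OF generic_has_partial[OF f] Gp])
  have gc: "generic UNIV (\<lambda>x. \<forall>j\<in>UNIV. continuous_at (\<lambda>y. G y $ j) x)"
    by (intro generic_ball finite generic_continuous_at G)
  have "generic UNIV (\<lambda>x. has_gradient f (G x) x)"
  proof (rule decided_on_subcube_generic[OF decided_on_subcube_UNIV dfn_has_gradient[OF f G]], rule ccontr)
    fix q :: "'a ^ 'n" and s :: 'a
    assume s: "0 < s" and no: "\<not> (\<exists>x\<in>cube UNIV q s. has_gradient f (G x) x)"
    define Q where "Q x \<eta> \<longleftrightarrow> (\<forall>\<delta>>0. \<exists>y. y \<in> cube UNIV x \<delta> \<and>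
      \<eta> * sup_norm (y - x) < \<bar>f y - f x - (\<Sum>j\<in>UNIV. G x $ j * (y - x) $ j)\<bar>)" for x \<eta>
    have "dfn (pr vc sc) (\<lambda>z. Q (fst z) (snd z))" unfolding Q_def
      by (intro dfn_intros dfn_cube dterm_vec_subst[OF f] dterm_vec_subst[OF G] dterm_vec_minus
          dterm_sup_norm dterm_intros dterm_sum finite dterm_fst dterm_snd)
    moreover have "Q x \<eta>'" if "Q x \<eta>" "0 < \<eta>'" "\<eta>' \<le> \<eta>" for x \<eta> \<eta>'
    proof -
      have "\<eta>' * sup_norm v \<le> \<eta> * sup_norm v" for v :: "'a ^ 'n"
        using that(3) by (rule mult_right_mono) (rule sup_norm_ge_0)
      then show ?thesis using that(1) unfolding Q_def by (meson order_le_less_trans)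
    qed
    moreover have "\<exists>\<eta>>0. Q x \<eta>" if "x \<in> cube UNIV q s" for x
    proof -
      have "\<not> has_gradient f (G x) x" using no that by blast
      then show ?thesis unfolding has_gradient_def Q_def Bex_def by (force simp: not_le)
    qed
    ultimately have "\<exists>q0 s0 \<eta>. 0 < s0 \<and> 0 < \<eta> \<and> cube UNIV q0 s0 \<subseteq> cube UNIV q s \<and> (\<forall>x\<in>cube UNIV q0 s0. Q x \<eta>)"
      by (intro uniform_on_subcube_ex[OF uniform_on_subcube_UNIV] s allI ballI impI)
    then obtain q0 s0 \<eta> where q0: "0 < s0" "0 < \<eta>" "\<And>x. x \<in> cube UNIV q0 s0 \<Longrightarrow> Q x \<eta>" by blast
    define N where "N = (of_nat CARD('n) :: 'a)"
    have N: "0 < N" by (simp add: N_def)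
    \<comment> \<open>each of the \<open>N\<close> steps of the path costs \<open>\<epsilon>\<close> for the difference quotient and \<open>\<epsilon>\<close> for the change of the gradient\<close>
    define \<epsilon> where "\<epsilon> = \<eta> / (2 * N)"
    have \<epsilon>: "0 < \<epsilon>" using q0(2) N by (simp add: \<epsilon>_def)
    have \<epsilon>\<eta>: "N * (\<epsilon> + \<epsilon>) = \<eta>" using N by (simp add: \<epsilon>_def field_simps)
    obtain q1 s1 where q1: "0 < s1" "cube UNIV q1 s1 \<subseteq> cube UNIV q0 s0"
      "\<And>x. x \<in> cube UNIV q1 s1 \<Longrightarrow>
        (\<forall>j\<in>UNIV. has_partial f j x (G x $ j)) \<and> (\<forall>j\<in>UNIV. continuous_at (\<lambda>y. G y $ j) x)"
      using generic_conj[OF gp gc] q0(1) unfolding generic_def by blast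
    define R where "R x \<rho> \<longleftrightarrow> (\<forall>j\<in>UNIV. \<forall>h. \<bar>h\<bar> < \<rho> \<longrightarrow>
      \<bar>f (upd x j (x $ j + h)) - f x - G x $ j * h\<bar> \<le> \<epsilon> * \<bar>h\<bar>)" for x \<rho>
    have "dfn (pr vc sc) (\<lambda>z. R (fst z) (snd z))" unfolding R_def
      by (intro dfn_ball_fin dfn_intros dterm_vec_subst[OF f] dterm_vec_subst[OF G] dterm_upd
          dterm_intros dterm_fst dterm_snd)
    moreover have "R x \<rho>'" if "R x \<rho>" "0 < \<rho>'" "\<rho>' \<le> \<rho>" for x \<rho> \<rho>'
      using that unfolding R_def by (meson order_less_le_trans)
    moreover have "\<exists>\<rho>>0. R x \<rho>" if x: "x \<in> cube UNIV q1 s1" for x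
    proof -
      have "\<exists>\<rho>>0. \<forall>j. \<forall>h. \<bar>h\<bar> < \<rho> \<longrightarrow> \<bar>f (upd x j (x $ j + h)) - f x - G x $ j * h\<bar> \<le> \<epsilon> * \<bar>h\<bar>"
      proof (rule uniform_radius)
        fix j
        have "has_partial f j x (G x $ j)" using q1(3)[OF x] by blast
        then show "\<exists>\<rho>>0. \<forall>h. \<bar>h\<bar> < \<rho> \<longrightarrow> \<bar>f (upd x j (x $ j + h)) - f x - G x $ j * h\<bar> \<le> \<epsilon> * \<bar>h\<bar>"
          using \<epsilon> unfolding has_partial_def deriv1_def by simp
      qed auto
      then show ?thesis unfolding R_def by simp
    qed
    ultimately have "\<exists>q2 s2 \<rho>. 0 < s2 \<and> 0 < \<rho> \<and> cube UNIV q2 s2 \<subseteq> cube UNIV q1 s1 \<and> (\<forall>x\<in>cube UNIV q2 s2. R x \<rho>)"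
      by (intro uniform_on_subcube_ex[OF uniform_on_subcube_UNIV] q1(1) allI ballI impI)
    then obtain x s2 \<rho> where x: "0 < s2" "0 < \<rho>" "cube UNIV x s2 \<subseteq> cube UNIV q1 s1"
      "\<And>y. y \<in> cube UNIV x s2 \<Longrightarrow> R y \<rho>" by blast
    have xm: "x \<in> cube UNIV x s2" using x(1) by (rule cube_center)
    then have "continuous_at (\<lambda>y. G y $ j) x" for j using x(3) q1(3) by blast
    then have "\<exists>\<delta>>0. \<forall>y\<in>cube UNIV x \<delta>. G y \<in> cube UNIV (G x) \<epsilon>"
      using \<epsilon> by (intro continuous_near)
    then obtain \<delta>1 where \<delta>1: "0 < \<delta>1" "\<And>y j. y \<in> cube UNIV x \<delta>1 \<Longrightarrow> \<bar>G y $ j - G x $ j\<bar> < \<epsilon>"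
      by (auto simp: cube_def)
    define \<delta> where "\<delta> = min \<delta>1 (min s2 \<rho>)"
    have "0 < \<delta>" using \<delta>1(1) x(1,2) by (simp add: \<delta>_def)
    moreover have "Q x \<eta>" using q0(3) q1(2) x(3) xm by blast
    ultimately obtain y where y: "y \<in> cube UNIV x \<delta>"
      "\<eta> * sup_norm (y - x) < \<bar>f y - f x - (\<Sum>j\<in>UNIV. G x $ j * (y - x) $ j)\<bar>"
      unfolding Q_def by blast
    \<comment> \<open>the path from \<open>x\<close> to \<open>y\<close> that changes the coordinates one after the other\<close>
    define mix where "mix A = (\<chi> i. if i \<in> A then y $ i else x $ i)" for A
    have mix_nth: "mix A $ i = (if i \<in> A then y $ i else x $ i)" for A i by (simp add: mix_def)
    have mixc: "mix A \<in> cube UNIV x \<delta>" for A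
      using y(1) \<open>0 < \<delta>\<close> by (auto simp: cube_def mix_def)
    let ?n = "sup_norm (y - x)"
    have "\<bar>f (mix A) - f x - (\<Sum>j\<in>A. G x $ j * (y - x) $ j)\<bar> \<le> of_nat (card A) * ((\<epsilon> + \<epsilon>) * ?n)" for A
      using finite[of A]
    proof (induction A)
      case empty
      have "mix {} = x" by (simp add: vec_eq_iff mix_nth)
      then show ?case by simp
    next
      case (insert j A)
      let ?z = "mix A" and ?h = "(y - x) $ j"
      have zj: "mix (insert j A) = upd ?z j (?z $ j + ?h)"
        using insert(2) by (auto simp: vec_eq_iff mix_nth)
      have z: "?z \<in> cube UNIV x \<delta>1" "?z \<in> cube UNIV x s2"
        using mixc[of A] by (auto simp: \<delta>_def mem_cube_UNIV)
      have "\<bar>?h\<bar> < \<rho>" using y(1) by (auto simp: \<delta>_def cube_def)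
      then have 1: "\<bar>f (mix (insert j A)) - f ?z - G ?z $ j * ?h\<bar> \<le> \<epsilon> * \<bar>?h\<bar>"
        using x(4)[OF z(2)] unfolding zj R_def by blast
      have 2: "\<bar>G ?z $ j * ?h - G x $ j * ?h\<bar> \<le> \<epsilon> * \<bar>?h\<bar>"
        unfolding left_diff_distrib[symmetric] abs_mult
        using \<delta>1(2)[OF z(1), of j] by (intro mult_right_mono) auto
      have 3: "\<epsilon> * \<bar>?h\<bar> \<le> \<epsilon> * ?n" using \<epsilon> by (intro mult_left_mono component_le_sup_norm) auto
      have "(\<Sum>i\<in>insert j A. G x $ i * (y - x) $ i) = G x $ j * ?h + (\<Sum>i\<in>A. G x $ i * (y - x) $ i)"
        using insert(1,2) by simp
      moreover have "of_nat (card (insert j A)) * ((\<epsilon> + \<epsilon>) * ?n) = of_nat (card A) * ((\<epsilon> + \<epsilon>) * ?n) + (\<epsilon> * ?n + \<epsilon> * ?n)"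
        using insert(1,2) by (simp add: algebra_simps)
      ultimately show ?case using insert(3) 1 2 3 by linarith
    qed
    from this[of UNIV] have "\<bar>f y - f x - (\<Sum>j\<in>UNIV. G x $ j * (y - x) $ j)\<bar> \<le> N * ((\<epsilon> + \<epsilon>) * ?n)"
      by (simp add: N_def mix_def)
    also have "\<dots> = \<eta> * ?n" unfolding \<epsilon>\<eta>[symmetric] by (simp only: mult.assoc)
    finally show False using y(2) by simp
  qed
  from generic_conj[OF this gc] show ?thesis using G by (intro exI[of _ G]) simp
qed

end

section \<open>Volume-preserving diffeomorphisms\<close>

lemma open_cube: "open (cube UNIV p r :: ('a::{linordered_field,linorder_topology} ^ 'n::finite) set)"
  unfolding open_iff_cube using cube_subcube by metis

lemma C1_with_derivativeD:
  assumes "C1_with_derivative U f D" "x \<in> U"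
  shows "has_gradient (\<lambda>y. f y $ i) (D x $ i) x" "continuous_at (\<lambda>y. D y $ i $ j) x"
    "continuous_at (\<lambda>y. f y $ i) x"
  using assms unfolding C1_with_derivative_def by (blast intro: has_gradient_continuous)+

lemma C1_with_derivative_cong:
  fixes U :: "('a::{linordered_field,linorder_topology} ^ 'n::finite) set"
  assumes U: "open U" and D: "C1_with_derivative U f D" and eq: "\<And>x. x \<in> U \<Longrightarrow> f' x = f x"
  shows "C1_with_derivative U f' D"
  unfolding C1_with_derivative_def
proof (intro ballI allI conjI)
  fix x i assume x: "x \<in> U"
  then obtain r where r: "0 < r" "cube UNIV x r \<subseteq> U" using U unfolding open_iff_cube by blast
  show "has_gradient (\<lambda>y. f' y $ i) (D x $ i) x"
    using eq r(2) by (intro has_gradient_local[OF C1_with_derivativeD(1)[OF D x] r(1)]) auto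
qed (use D C1_with_derivativeD(2) in blast)

lemma C1_with_derivative_subset:
  "C1_with_derivative U f D \<Longrightarrow> W \<subseteq> U \<Longrightarrow> C1_with_derivative W f D"
  unfolding C1_with_derivative_def by blast

lemma matrix_mult_row: "(A ** B) $ i = A $ i v* (B :: 'a::comm_semiring_1 ^ 'n::finite ^ 'm::finite)"
  by (simp add: matrix_matrix_mult_def vector_matrix_mult_def vec_eq_iff mult.commute)

lemma C1_with_derivative_compose:
  fixes f :: "'a::{linordered_field,linorder_topology} ^ 'n::finite \<Rightarrow> 'a ^ 'm::finite"
    and h :: "'a ^ 'm \<Rightarrow> 'a ^ 'k::finite"
  assumes f: "C1_with_derivative U f D" and h: "C1_with_derivative V h E" and fU: "f ` U \<subseteq> V"
  shows "C1_with_derivative U (\<lambda>x. h (f x)) (\<lambda>x. E (f x) ** D x)"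
  unfolding C1_with_derivative_def
proof (intro ballI allI conjI)
  fix x i assume x: "x \<in> U"
  then have fx: "f x \<in> V" using fU by blast
  show "has_gradient (\<lambda>y. h (f y) $ i) ((E (f x) ** D x) $ i) x"
    unfolding matrix_mult_row
    by (rule has_gradient_chain[where h = "\<lambda>z. h z $ i"])
      (rule C1_with_derivativeD(1)[OF h fx], rule C1_with_derivativeD(1)[OF f x])
  fix j
  show "continuous_at (\<lambda>y. (E (f y) ** D y) $ i $ j) x"
    unfolding matrix_matrix_mult_def vec_lambda_beta
  proof (intro continuous_at_sum continuous_at_mult finite)
    show "continuous_at (\<lambda>y. E (f y) $ i $ k) x" for k
      by (rule continuous_at_compose[where h = "\<lambda>z. E z $ i $ k"])
        (rule C1_with_derivativeD(2)[OF h fx], rule C1_with_derivativeD(3)[OF f x])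
    show "continuous_at (\<lambda>y. D y $ k $ j) x" for k by (rule C1_with_derivativeD(2)[OF f x])
  qed
qed

lemma open_preimage:
  fixes f :: "'a::{linordered_field,linorder_topology} ^ 'n::finite \<Rightarrow> 'a ^ 'm::finite"
  assumes f: "\<And>x i. x \<in> U \<Longrightarrow> continuous_at (\<lambda>y. f y $ i) x" and U: "open U" and W: "open W"
  shows "open {x \<in> U. f x \<in> W}"
  unfolding open_iff_cube
proof
  fix x assume x: "x \<in> {x \<in> U. f x \<in> W}"
  obtain r where r: "0 < r" "cube UNIV x r \<subseteq> U" using U x unfolding open_iff_cube by blast
  obtain t where t: "0 < t" "cube UNIV (f x) t \<subseteq> W" using W x unfolding open_iff_cube by blast
  obtain \<delta> where \<delta>: "0 < \<delta>" "\<forall>y\<in>cube UNIV x \<delta>. f y \<in> cube UNIV (f x) t"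
    using continuous_near[OF f t(1)] x by blast
  have "y \<in> {x \<in> U. f x \<in> W}" if y: "y \<in> cube UNIV x (min r \<delta>)" for y
  proof -
    have "y \<in> cube UNIV x r" "y \<in> cube UNIV x \<delta>" using y by (auto simp: mem_cube_UNIV)
    then show ?thesis using r(2) t(2) \<delta>(2) by blast
  qed
  then show "\<exists>r>0. cube UNIV x r \<subseteq> {x \<in> U. f x \<in> W}"
    using r(1) \<delta>(1) by (intro exI[of _ "min r \<delta>"]) auto
qed

text \<open>
  An \<open>n_isomorphism\<close> up to definability, with the inverse map named.
\<close>

definition volume_diffeo ::
  "('a::{linordered_field,linorder_topology} ^ 'n::finite) set \<Rightarrow> ('a ^ 'n \<Rightarrow> 'a ^ 'n) \<Rightarrow>
    ('a ^ 'n) set \<Rightarrow> ('a ^ 'n \<Rightarrow> 'a ^ 'n) \<Rightarrow> bool" where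
  "volume_diffeo U f V g \<longleftrightarrow> open U \<and> open V \<and> f ` U = V \<and> (\<forall>x\<in>U. g (f x) = x) \<and>
     (\<exists>D. C1_with_derivative U f D \<and> (\<forall>x\<in>U. \<bar>det (D x)\<bar> = 1)) \<and> (\<exists>E. C1_with_derivative V g E)"

text \<open>
  By the chain rule the two Jacobian matrices are inverse to each other.
\<close>

lemma volume_diffeo_sym:
  assumes "volume_diffeo U f V g"
  shows "volume_diffeo V g U f"
proof -
  obtain D E where U: "open U" "open V" "f ` U = V" and gf: "\<And>x. x \<in> U \<Longrightarrow> g (f x) = x"
    and D: "C1_with_derivative U f D" "\<And>x. x \<in> U \<Longrightarrow> \<bar>det (D x)\<bar> = 1"
    and E: "C1_with_derivative V g E"
    using assms unfolding volume_diffeo_def by blast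
  have "\<bar>det (E (f x))\<bar> = 1" if x: "x \<in> U" for x
  proof -
    have "(E (f x) ** D x) $ i = mat 1 $ i" for i
    proof -
      have "C1_with_derivative U (\<lambda>x. g (f x)) (\<lambda>x. E (f x) ** D x)"
        using C1_with_derivative_compose[OF D(1) E] U(3) by simp
      then have "C1_with_derivative U (\<lambda>x. x) (\<lambda>x. E (f x) ** D x)"
        by (rule C1_with_derivative_cong[OF U(1)]) (simp add: gf)
      from C1_with_derivativeD(1)[OF this x, of i] have "(E (f x) ** D x) $ i = axis i 1"
        using has_gradient_unique has_gradient_coord by blast
      also have "\<dots> = mat 1 $ i" by (simp add: mat_def axis_def vec_eq_iff)
      finally show ?thesis .
    qed
    then have "E (f x) ** D x = mat 1" by (simp add: vec_eq_iff)
    then have "det (E (f x)) * det (D x) = 1" by (metis det_I det_mul)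
    then have "\<bar>det (E (f x))\<bar> * \<bar>det (D x)\<bar> = 1" by (metis abs_mult abs_one)
    then show ?thesis using D(2)[OF x] by simp
  qed
  then have "\<forall>y\<in>V. \<bar>det (E y)\<bar> = 1" using U(3) by blast
  moreover have "g ` V = U" "\<forall>y\<in>V. f (g y) = y" using U(3) gf by force+
  ultimately show ?thesis unfolding volume_diffeo_def using U D(1) E by blast
qed

lemma volume_diffeo_restrict:
  assumes d: "volume_diffeo U f V g" and W: "W \<subseteq> U" "open W"
  shows "volume_diffeo W f (f ` W) g"
proof -
  obtain D E where U: "open U" "open V" "f ` U = V" and gf: "\<And>x. x \<in> U \<Longrightarrow> g (f x) = x"
    and D: "C1_with_derivative U f D" "\<And>x. x \<in> U \<Longrightarrow> \<bar>det (D x)\<bar> = 1"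
    and E: "C1_with_derivative V g E"
    using d unfolding volume_diffeo_def by blast
  have "f ` W = {y \<in> V. g y \<in> W}" using U(3) gf W(1) by force
  then have "open (f ` W)" using open_preimage[OF C1_with_derivativeD(3)[OF E] U(2) W(2)] by simp
  moreover have "f ` W \<subseteq> V" using W(1) U(3) by blast
  ultimately show ?thesis unfolding volume_diffeo_def
    using W gf D(2) C1_with_derivative_subset[OF D(1) W(1)] C1_with_derivative_subset[OF E] by blast
qed

lemma volume_diffeo_trans:
  assumes d: "volume_diffeo U f V g" and e: "volume_diffeo V h W k"
  shows "volume_diffeo U (\<lambda>x. h (f x)) W (\<lambda>z. g (k z))"
proof -
  obtain D E where U: "open U" "open V" "f ` U = V" and gf: "\<And>x. x \<in> U \<Longrightarrow> g (f x) = x"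
    and D: "C1_with_derivative U f D" "\<And>x. x \<in> U \<Longrightarrow> \<bar>det (D x)\<bar> = 1"
    and E: "C1_with_derivative V g E"
    using d unfolding volume_diffeo_def by blast
  obtain D' E' where V: "open W" "h ` V = W" and kh: "\<And>x. x \<in> V \<Longrightarrow> k (h x) = x"
    and D': "C1_with_derivative V h D'" "\<And>x. x \<in> V \<Longrightarrow> \<bar>det (D' x)\<bar> = 1"
    and E': "C1_with_derivative W k E'"
    using e unfolding volume_diffeo_def by blast
  have "k ` W \<subseteq> V" using V(2) kh by auto
  then have "C1_with_derivative W (\<lambda>z. g (k z)) (\<lambda>z. E (k z) ** E' z)"
    by (rule C1_with_derivative_compose[OF E' E])
  moreover have "C1_with_derivative U (\<lambda>x. h (f x)) (\<lambda>x. D' (f x) ** D x)"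
    using U(3) by (intro C1_with_derivative_compose[OF D(1) D'(1)]) auto
  moreover have "\<bar>det (D' (f x) ** D x)\<bar> = 1" if "x \<in> U" for x
    using D(2)[OF that] D'(2)[of "f x"] U(3) that by (auto simp: det_mul abs_mult)
  moreover have "(\<lambda>x. h (f x)) ` U = W" using U(3) V(2) by (simp flip: image_image)
  moreover have "\<forall>x\<in>U. g (k (h (f x))) = x" using gf kh U(3) by auto
  ultimately show ?thesis unfolding volume_diffeo_def using U(1) V(1) by blast
qed

text \<open>
  A dense open condition pulls back under a continuous open map.
\<close>

lemma generic_transport:
  fixes f :: "'a::{linordered_field,linorder_topology} ^ 'n::finite \<Rightarrow> 'a ^ 'n"
  assumes P: "generic UNIV P" and U: "open U"
    and cont: "\<And>x i. x \<in> U \<Longrightarrow> continuous_at (\<lambda>y. f y $ i) x"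
    and op: "\<And>x r. x \<in> U \<Longrightarrow> 0 < r \<Longrightarrow> \<exists>t>0. cube UNIV (f x) t \<subseteq> f ` cube UNIV x r"
  shows "generic UNIV (\<lambda>x. x \<in> U \<longrightarrow> P (f x))"
  unfolding generic_def
proof (intro allI impI)
  fix p :: "'a ^ 'n" and r :: 'a assume r: "0 < r"
  show "\<exists>q s. 0 < s \<and> cube UNIV q s \<subseteq> cube UNIV p r \<and> (\<forall>x\<in>cube UNIV q s. x \<in> U \<longrightarrow> P (f x))"
  proof (cases "cube UNIV p r \<inter> U = {}")
    case True
    then show ?thesis using r by blast
  next
    case False
    then obtain x where x: "x \<in> cube UNIV p r \<inter> U" by blast
    have "open (cube UNIV p r \<inter> U)" using U by (intro open_Int open_cube)
    then obtain s where s: "0 < s" "cube UNIV x s \<subseteq> cube UNIV p r \<inter> U"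
      using x unfolding open_iff_cube by blast
    obtain t where t: "0 < t" "cube UNIV (f x) t \<subseteq> f ` cube UNIV x s" using op x s(1) by blast
    obtain q u where q: "0 < u" "cube UNIV q u \<subseteq> cube UNIV (f x) t" "\<forall>y\<in>cube UNIV q u. P y"
      using P t(1) unfolding generic_def by blast
    let ?W = "{z \<in> cube UNIV x s. f z \<in> cube UNIV q u}"
    have "open ?W" using s(2) by (intro open_preimage cont open_cube) auto
    moreover obtain z where "z \<in> ?W" using t(2) q(2) cube_center[OF q(1), of q UNIV] by blast
    ultimately obtain v where v: "0 < v" "cube UNIV z v \<subseteq> ?W" unfolding open_iff_cube by blast
    then show ?thesis using s(2) q(3) by (intro exI[of _ z] exI[of _ v]) blast
  qed
qed

lemma generic_volume_diffeo:
  fixes f :: "'a::{linordered_field,linorder_topology} ^ 'n::finite \<Rightarrow> 'a ^ 'n"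
  assumes P: "generic UNIV P" and d: "volume_diffeo U f V g"
  shows "generic UNIV (\<lambda>x. x \<in> U \<longrightarrow> P (f x))"
proof -
  obtain D where U: "open U" "f ` U = V" and D: "C1_with_derivative U f D"
    using d unfolding volume_diffeo_def by blast
  show ?thesis
  proof (rule generic_transport[OF P U(1) C1_with_derivativeD(3)[OF D]])
    fix x and r :: 'a assume x: "x \<in> U" and r: "0 < r"
    let ?W = "cube UNIV x r \<inter> U"
    have "open ?W" using U(1) by (intro open_Int open_cube)
    then have "open (f ` ?W)"
      using volume_diffeo_restrict[OF d, of ?W] unfolding volume_diffeo_def by blast
    moreover have "f x \<in> f ` ?W" using x cube_center[OF r] by blast
    ultimately show "\<exists>t>0. cube UNIV (f x) t \<subseteq> f ` cube UNIV x r" unfolding open_iff_cube by blast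
  qed
qed

context definability begin

lemma dfn_rel_subst:
  fixes u :: "'e \<Rightarrow> 'a ^ 'n::finite" and v :: "'e \<Rightarrow> 'a ^ 'm::finite"
  assumes "dfn (pr vc vc) (\<lambda>z. R (fst z) (snd z))"
    "\<And>i. dterm C (\<lambda>z. u z $ i)" "\<And>i. dterm C (\<lambda>z. v z $ i)"
  shows "dfn C (\<lambda>z. R (u z) (v z))"
  by (rule dfn_subst[OF coord_system_pr[OF coord_system_vc coord_system_vc] assms(1),
        of C "\<lambda>z. (u z, v z)", simplified]) (use assms(2,3) in \<open>auto simp: pr_def vc_def\<close>)

lemma definable_mapD:
  fixes u :: "'e \<Rightarrow> 'a ^ 'n::finite" and v :: "'e \<Rightarrow> 'a ^ 'm::finite"
  assumes "definable_map M U f" "\<And>i. dterm C (\<lambda>z. u z $ i)" "\<And>i. dterm C (\<lambda>z. v z $ i)"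
  shows "dfn C (\<lambda>z. u z \<in> U \<and> f (u z) = v z)"
  by (rule dfn_rel_subst[where R = "\<lambda>x y. x \<in> U \<and> f x = y"])
    (use assms in \<open>auto simp: definable_map_iff_dfn\<close>)

lemma definable_setD:
  fixes u :: "'e \<Rightarrow> 'a ^ 'n::finite"
  assumes "definable_set M U" "\<And>i. dterm C (\<lambda>z. u z $ i)"
  shows "dfn C (\<lambda>z. u z \<in> U)"
  by (rule dfn_vec_subst[OF assms(1)[unfolded definable_set_iff_dfn] assms(2)])

lemma definable_image:
  fixes f :: "'a ^ 'n::finite \<Rightarrow> 'a ^ 'm::finite"
  assumes "definable_map M U f"
  shows "definable_set M (f ` U)"
proof -
  have "dfn vc (\<lambda>y. \<exists>x. x \<in> U \<and> f x = y)"
    by (intro dfn_exv definable_mapD[OF assms] dterm_fst dterm_snd dterm_vc)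
  moreover have "(\<exists>x. x \<in> U \<and> f x = y) \<longleftrightarrow> y \<in> f ` U" for y by auto
  ultimately show ?thesis by (simp add: definable_set_iff_dfn)
qed

end

context o_minimal_structure begin

text \<open>
  An \<open>n_isomorphism\<close> with its inverse map, which makes the relation visibly symmetric.
\<close>

definition n_iso ::
  "('a ^ 'n::finite) set \<Rightarrow> ('a ^ 'n \<Rightarrow> 'a ^ 'n) \<Rightarrow> ('a ^ 'n) set \<Rightarrow> ('a ^ 'n \<Rightarrow> 'a ^ 'n) \<Rightarrow> bool" where
  "n_iso U f V g \<longleftrightarrow> definable_set M U \<and> definable_map M U f \<and> volume_diffeo U f V g"

lemma n_isoD:
  assumes "n_iso U f V g"
  shows "definable_set M U" "definable_map M U f" "volume_diffeo U f V g" "open U" "open V" "f ` U = V"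
    "x \<in> U \<Longrightarrow> g (f x) = x"
  using assms unfolding n_iso_def volume_diffeo_def by blast+

lemma n_isomorphism_iff: "n_isomorphism M U f \<longleftrightarrow> (\<exists>g. n_iso U f (f ` U) g)"
proof
  assume n: "n_isomorphism M U f"
  then have U: "open U" "open (f ` U)" "definable_set M U" "definable_map M U f" "inj_on f U"
    and C: "C1_map U f" "C1_map (f ` U) (the_inv_into U f)"
    and J: "\<And>x. x \<in> U \<Longrightarrow> \<bar>det (jacobian_matrix U f x)\<bar> = 1"
    unfolding n_isomorphism_def by auto
  obtain D where D: "C1_with_derivative U f D" using C(1) unfolding C1_map_iff by blast
  obtain E where E: "C1_with_derivative (f ` U) (the_inv_into U f) E" using C(2) unfolding C1_map_iff by blast
  have "jacobian_matrix U f x = D x" if "x \<in> U" for x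
    by (rule jacobian_matrix_eq[OF U(1) that]) (rule C1_with_derivativeD(1)[OF D that])
  then have "\<forall>x\<in>U. \<bar>det (D x)\<bar> = 1" using J by metis
  moreover have "\<forall>x\<in>U. the_inv_into U f (f x) = x" using the_inv_into_f_f[OF U(5)] by blast
  ultimately have "volume_diffeo U f (f ` U) (the_inv_into U f)"
    unfolding volume_diffeo_def using U(1,2) D E by blast
  then show "\<exists>g. n_iso U f (f ` U) g" unfolding n_iso_def using U by blast
next
  assume "\<exists>g. n_iso U f (f ` U) g"
  then obtain g where g: "n_iso U f (f ` U) g" by blast
  obtain D E where D: "C1_with_derivative U f D" "\<And>x. x \<in> U \<Longrightarrow> \<bar>det (D x)\<bar> = 1"
    and E: "C1_with_derivative (f ` U) g E"
    using n_isoD(3)[OF g] unfolding volume_diffeo_def by blast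
  note U = n_isoD(4,5)[OF g] and gf = n_isoD(7)[OF g]
  have inj: "inj_on f U" using gf by (rule inj_on_inverseI)
  have "the_inv_into U f y = g y" if "y \<in> f ` U" for y
    using that gf the_inv_into_f_f[OF inj] by auto
  then have "C1_with_derivative (f ` U) (the_inv_into U f) E"
    by (rule C1_with_derivative_cong[OF U(2) E])
  moreover have "jacobian_matrix U f x = D x" if "x \<in> U" for x
    by (rule jacobian_matrix_eq[OF U(1) that]) (rule C1_with_derivativeD(1)[OF D(1) that])
  ultimately show "n_isomorphism M U f"
    unfolding n_isomorphism_def C1_map_iff using n_isoD(1,2)[OF g] U inj D by auto
qed

lemma n_iso_sym:
  fixes U :: "('a ^ 'n::finite) set"
  assumes n: "n_iso U f V g"
  shows "n_iso V g U f"
proof -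
  note U = n_isoD(6)[OF n] and gf = n_isoD(7)[OF n]
  have "definable_set M V" using definable_image[OF n_isoD(2)[OF n]] U by simp
  moreover have "definable_map M V g"
  proof -
    have "dfn (pr vc vc) (\<lambda>z :: ('a ^ 'n) \<times> ('a ^ 'n). snd z \<in> U \<and> f (snd z) = fst z)"
      by (intro definable_mapD[OF n_isoD(2)[OF n]] dterm_fst dterm_snd dterm_vc)
    moreover have "snd z \<in> U \<and> f (snd z) = fst z \<longleftrightarrow> fst z \<in> V \<and> g (fst z) = snd z" for z
      using U gf by force
    ultimately show ?thesis by (simp add: definable_map_iff_dfn)
  qed
  ultimately show ?thesis unfolding n_iso_def using volume_diffeo_sym[OF n_isoD(3)[OF n]] by blast
qed

lemma n_iso_restrict:
  fixes U :: "('a ^ 'n::finite) set"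
  assumes n: "n_iso U f V g" and W: "W \<subseteq> U" "open W" "definable_set M W"
  shows "n_iso W f (f ` W) g"
proof -
  have "dfn (pr vc vc) (\<lambda>z :: ('a ^ 'n) \<times> ('a ^ 'n). fst z \<in> W \<and> (fst z \<in> U \<and> f (fst z) = snd z))"
    by (intro dfn_conj definable_mapD[OF n_isoD(2)[OF n]] definable_setD[OF W(3)]
        dterm_fst dterm_snd dterm_vc)
  moreover have "fst z \<in> W \<and> (fst z \<in> U \<and> f (fst z) = snd z) \<longleftrightarrow> fst z \<in> W \<and> f (fst z) = snd z" for z
    using W(1) by blast
  ultimately have "definable_map M W f" by (simp add: definable_map_iff_dfn)
  then show ?thesis unfolding n_iso_def using W volume_diffeo_restrict[OF n_isoD(3)[OF n]] by blast
qed

lemma n_iso_trans: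
  fixes U :: "('a ^ 'n::finite) set"
  assumes n: "n_iso U f V g" and m: "n_iso V h W k"
  shows "n_iso U (\<lambda>x. h (f x)) W (\<lambda>z. g (k z))"
proof -
  have "dfn (pr vc vc) (\<lambda>z :: ('a ^ 'n) \<times> ('a ^ 'n). \<exists>w :: 'a ^ 'n.
      (fst z \<in> U \<and> f (fst z) = w) \<and> (w \<in> V \<and> h w = snd z))"
    by (intro dfn_exv dfn_conj definable_mapD[OF n_isoD(2)[OF n]] definable_mapD[OF n_isoD(2)[OF m]]
        dterm_fst dterm_snd dterm_vc)
  moreover have "(\<exists>w. (fst z \<in> U \<and> f (fst z) = w) \<and> (w \<in> V \<and> h w = snd z)) \<longleftrightarrow>
      fst z \<in> U \<and> h (f (fst z)) = snd z" for z
    using n_isoD(6)[OF n] by auto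
  ultimately have "definable_map M U (\<lambda>x. h (f x))" by (simp add: definable_map_iff_dfn)
  then show ?thesis unfolding n_iso_def
    using n_isoD(1)[OF n] volume_diffeo_trans[OF n_isoD(3)[OF n] n_isoD(3)[OF m]] by blast
qed

end

section \<open>Piecewise isomorphism is an equivalence relation\<close>

text \<open>
  Only the projection to all coordinates can have full dimension.
\<close>

lemma dimension_less_iff:
  fixes Z :: "('a::linordered_field ^ 'n::finite) set"
  shows "dimension Z < ereal (real CARD('n)) \<longleftrightarrow> \<not> projection_has_interior Z UNIV"
proof
  assume d: "dimension Z < ereal (real CARD('n))"
  show "\<not> projection_has_interior Z UNIV"
  proof
    assume "projection_has_interior Z UNIV"
    then have "ereal (real (card (UNIV :: 'n set))) \<le> dimension Z"
      unfolding dimension_def by (intro SUP_upper) simp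
    then show False using d by simp
  qed
next
  assume n: "\<not> projection_has_interior Z UNIV"
  have "dimension Z \<le> ereal (real (CARD('n) - 1))" unfolding dimension_def
  proof (rule SUP_least)
    fix J :: "'n set" assume "J \<in> {J. projection_has_interior Z J}"
    then have "J \<subset> UNIV" using n by auto
    then have "card J < CARD('n)" by (intro psubset_card_mono) auto
    then show "ereal (real (card J)) \<le> ereal (real (CARD('n) - 1))" by simp
  qed
  also have "\<dots> < ereal (real CARD('n))" by simp
  finally show "dimension Z < ereal (real CARD('n))" .
qed

context o_minimal_structure begin

lemma dimension_less_iff_generic:
  fixes Z :: "('a ^ 'n::finite) set"
  assumes Z: "definable_set M Z"
  shows "dimension Z < ereal (real CARD('n)) \<longleftrightarrow> generic UNIV (\<lambda>x. x \<notin> Z)"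
  unfolding dimension_less_iff
proof
  assume n: "\<not> projection_has_interior Z UNIV"
  show "generic UNIV (\<lambda>x. x \<notin> Z)"
  proof (rule decided_on_subcube_generic[OF decided_on_subcube_UNIV])
    show "dfn vc (\<lambda>x. x \<notin> Z)" by (intro dfn_not definable_setD[OF Z] dterm_vc)
    fix q :: "'a ^ 'n" and s :: 'a assume s: "0 < s"
    show "\<exists>x\<in>cube UNIV q s. x \<notin> Z"
    proof (rule ccontr)
      assume "\<not> (\<exists>x\<in>cube UNIV q s. x \<notin> Z)"
      then have sub: "\<And>x. x \<in> cube UNIV q s \<Longrightarrow> x \<in> Z" by blast
      have "projection_has_interior Z UNIV" unfolding projection_has_interior_def
        by (rule exI[of _ "\<chi> i. q $ i - s"], rule exI[of _ "\<chi> i. q $ i + s"])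
          (use s in \<open>auto intro!: bexI[OF _ sub] simp: cube_def abs_less_iff algebra_simps\<close>)
      then show False using n by blast
    qed
  qed
next
  assume g: "generic UNIV (\<lambda>x. x \<notin> Z)"
  show "\<not> projection_has_interior Z UNIV"
  proof
    assume "projection_has_interior Z UNIV"
    then obtain a b :: "'a ^ 'n" where ab: "\<And>j. a $ j < b $ j"
      "\<And>y. (\<forall>j. a $ j < y $ j \<and> y $ j < b $ j) \<Longrightarrow> \<exists>x\<in>Z. \<forall>j. x $ j = y $ j"
      unfolding projection_has_interior_def by auto
    obtain r where r: "0 < r" "\<forall>j\<in>UNIV. r \<le> (b $ j - a $ j) / 2"
      using finite_positive_lower_bound[of "UNIV :: 'n set" "\<lambda>j. (b $ j - a $ j) / 2"] ab(1) by auto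
    define p where "p = (\<chi> j. (a $ j + b $ j) / 2)"
    obtain q s where q: "0 < s" "cube UNIV q s \<subseteq> cube UNIV p r" "\<forall>x\<in>cube UNIV q s. x \<notin> Z"
      using g r(1) unfolding generic_def by blast
    have qs: "q \<in> cube UNIV q s" using q(1) by (rule cube_center)
    have mid: "lo < x \<and> x < hi" if "\<bar>x - m\<bar> < r" "r \<le> d" "m - d = lo" "m + d = hi" for x m d lo hi :: 'a
      using that by linarith
    have "a $ j < q $ j \<and> q $ j < b $ j" for j
    proof -
      have "q \<in> cube UNIV p r" using qs q(2) by blast
      then have "\<bar>q $ j - (a $ j + b $ j) / 2\<bar> < r" by (simp add: cube_def p_def)
      moreover have "r \<le> (b $ j - a $ j) / 2" using r(2) by blast
      moreover have "(a $ j + b $ j) / 2 - (b $ j - a $ j) / 2 = a $ j"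
        "(a $ j + b $ j) / 2 + (b $ j - a $ j) / 2 = b $ j" by (simp_all add: field_simps)
      ultimately show ?thesis by (rule mid)
    qed
    then obtain x where "x \<in> Z" "\<forall>j. x $ j = q $ j" using ab(2) by blast
    then have "q \<in> Z" by (simp add: vec_eq_iff[of x q, symmetric])
    then show False using q(3) qs by blast
  qed
qed

text \<open>
  The data that witness \<open>iso_rel\<close>, with an arbitrary finite index set instead of an initial segment of
  the naturals, and with genericity instead of the dimension condition.
\<close>

definition pieces ::
  "'i set \<Rightarrow> ('a ^ 'n::finite) set \<Rightarrow> ('a ^ 'n) set \<Rightarrow> ('i \<Rightarrow> ('a ^ 'n) set) \<Rightarrow> ('i \<Rightarrow> 'a ^ 'n \<Rightarrow> 'a ^ 'n) \<Rightarrow>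
    ('i \<Rightarrow> ('a ^ 'n) set) \<Rightarrow> ('i \<Rightarrow> 'a ^ 'n \<Rightarrow> 'a ^ 'n) \<Rightarrow> bool" where
  "pieces I X Y P f Q g \<longleftrightarrow> finite I \<and> (\<forall>i\<in>I. n_iso (P i) (f i) (Q i) (g i) \<and> P i \<subseteq> X \<and> Q i \<subseteq> Y) \<and>
     disjoint_family_on P I \<and> disjoint_family_on Q I \<and>
     generic UNIV (\<lambda>x. x \<in> X \<longrightarrow> (\<exists>i\<in>I. x \<in> P i)) \<and> generic UNIV (\<lambda>y. y \<in> Y \<longrightarrow> (\<exists>i\<in>I. y \<in> Q i))"

lemma definable_open_partition_iff:
  fixes X :: "('a ^ 'n::finite) set"
  assumes X: "definable_set M X"
  shows "definable_open_partition M X k P \<longleftrightarrow>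
    (\<forall>i<k. definable_set M (P i) \<and> open (P i) \<and> P i \<subseteq> X) \<and> disjoint_family_on P {..<k} \<and>
    generic UNIV (\<lambda>x. x \<in> X \<longrightarrow> (\<exists>i<k. x \<in> P i))"
proof -
  have "definable_set M (X - (\<Union>i<k. P i))" if d: "\<forall>i<k. definable_set M (P i)"
  proof -
    have "dfn vc (\<lambda>x. x \<in> X \<and> \<not> (\<exists>i\<in>{..<k}. x \<in> P i))"
      using d by (intro dfn_conj dfn_not dfn_bex definable_setD[OF X] definable_setD dterm_vc) auto
    then show ?thesis by (simp add: definable_set_iff_dfn)
  qed
  moreover have "x \<notin> X - (\<Union>i<k. P i) \<longleftrightarrow> (x \<in> X \<longrightarrow> (\<exists>i<k. x \<in> P i))" for x by auto
  ultimately show ?thesis unfolding definable_open_partition_def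
    using dimension_less_iff_generic[of "X - (\<Union>i<k. P i)"] by auto
qed

lemma bounded_definableD: "X \<in> bounded_definable M \<Longrightarrow> definable_set M X"
  by (simp add: bounded_definable_def)

lemma iso_relI:
  fixes X :: "('a ^ 'n::finite) set"
  assumes X: "X \<in> bounded_definable M" and Y: "Y \<in> bounded_definable M" and p: "pieces I X Y P f Q g"
  shows "(X, Y) \<in> iso_rel M"
proof -
  have "finite I" using p by (simp add: pieces_def)
  then obtain h where h: "bij_betw h {..<card I} I"
    using ex_bij_betw_nat_finite[of I] by (auto simp: lessThan_atLeast0)
  have I: "I = h ` {..<card I}" using h by (simp add: bij_betw_def)
  have n: "n_iso (P (h k)) (f (h k)) (Q (h k)) (g (h k))" "P (h k) \<subseteq> X" "Q (h k) \<subseteq> Y" if "k < card I" for k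
    using p that bij_betwE[OF h] unfolding pieces_def by blast+
  have disj: "disjoint_family_on (\<lambda>k. R (h k)) {..<card I}" if "disjoint_family_on R I" for R :: "_ \<Rightarrow> ('a ^ 'n) set"
    using that h unfolding disjoint_family_on_def bij_betw_def inj_on_def by blast
  have ex: "(\<exists>i\<in>I. x \<in> R i) \<longleftrightarrow> (\<exists>k<card I. x \<in> R (h k))" for R :: "_ \<Rightarrow> ('a ^ 'n) set" and x
    by (subst I) auto
  have "definable_open_partition M X (card I) (\<lambda>k. P (h k))"
    unfolding definable_open_partition_iff[OF bounded_definableD[OF X]]
    using p n(2) n_isoD(1,4)[OF n(1)] disj[of P] unfolding pieces_def ex by blast
  moreover have "definable_open_partition M Y (card I) (\<lambda>k. Q (h k))"
    unfolding definable_open_partition_iff[OF bounded_definableD[OF Y]]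
    using p n(3) n_isoD(1,4)[OF n_iso_sym[OF n(1)]] disj[of Q] unfolding pieces_def ex by blast
  moreover have "n_isomorphism M (P (h k)) (f (h k)) \<and> Q (h k) = f (h k) ` P (h k)" if "k < card I" for k
    using n(1)[OF that] n_isoD(6)[OF n(1)[OF that]] unfolding n_isomorphism_iff by auto
  ultimately have "\<exists>k P Q f. definable_open_partition M X k P \<and> definable_open_partition M Y k Q \<and>
      (\<forall>i<k. n_isomorphism M (P i) (f i) \<and> Q i = f i ` P i)"
    by (rule_tac x = "card I" in exI, rule_tac x = "\<lambda>k. P (h k)" in exI,
        rule_tac x = "\<lambda>k. Q (h k)" in exI, rule_tac x = "\<lambda>k. f (h k)" in exI) blast
  then show ?thesis unfolding iso_rel_def using X Y by blast
qed

lemma iso_relE: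
  fixes X :: "('a ^ 'n::finite) set"
  assumes "(X, Y) \<in> iso_rel M"
  obtains I :: "nat set" and P f Q g where "X \<in> bounded_definable M" "Y \<in> bounded_definable M"
    "pieces I X Y P f Q g"
proof -
  obtain k P Q f where X: "X \<in> bounded_definable M" and Y: "Y \<in> bounded_definable M"
    and P: "definable_open_partition M X k P" and Q: "definable_open_partition M Y k Q"
    and f: "\<And>i. i < k \<Longrightarrow> n_isomorphism M (P i) (f i) \<and> Q i = f i ` P i"
    using assms unfolding iso_rel_def by blast
  have "\<exists>g. n_iso (P i) (f i) (Q i) g" if "i < k" for i
    using f[OF that] unfolding n_isomorphism_iff by auto
  then obtain g where g: "\<And>i. i < k \<Longrightarrow> n_iso (P i) (f i) (Q i) (g i)" by metis
  have "pieces {..<k} X Y P f Q g"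
    using P Q g unfolding definable_open_partition_iff[OF bounded_definableD[OF X]]
      definable_open_partition_iff[OF bounded_definableD[OF Y]] pieces_def lessThan_iff Bex_def Ball_def
    by simp
  then show ?thesis using that X Y by blast
qed

lemma iso_rel_sym:
  fixes X :: "('a ^ 'n::finite) set"
  assumes "(X, Y) \<in> iso_rel M"
  shows "(Y, X) \<in> iso_rel M"
proof -
  obtain I :: "nat set" and P f Q g where X: "X \<in> bounded_definable M" and Y: "Y \<in> bounded_definable M"
    and p: "pieces I X Y P f Q g" using assms by (rule iso_relE)
  have "pieces I Y X Q g P f" using p n_iso_sym unfolding pieces_def by blast
  then show ?thesis by (rule iso_relI[OF Y X])
qed

text \<open>
  The partition of \<open>X\<close> is refined by pulling back, along the maps of the first equivalence, the
  intersections of its pieces of \<open>Y\<close> with those of the second one. The refined pieces still cover \<open>X\<close>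
  generically because genericity is transported by the maps; similarly for \<open>Z\<close>.
\<close>

lemma iso_rel_trans:
  fixes X :: "('a ^ 'n::finite) set"
  assumes XY: "(X, Y) \<in> iso_rel M" and YZ: "(Y, Z) \<in> iso_rel M"
  shows "(X, Z) \<in> iso_rel M"
proof -
  obtain I :: "nat set" and P f Q g where X: "X \<in> bounded_definable M"
    and p: "pieces I X Y P f Q g" using XY by (rule iso_relE)
  obtain I' :: "nat set" and P' f' Q' g' where Z: "Z \<in> bounded_definable M"
    and p': "pieces I' Y Z P' f' Q' g'" using YZ by (rule iso_relE)
  have n: "n_iso (P i) (f i) (Q i) (g i)" "P i \<subseteq> X" "Q i \<subseteq> Y" if "i \<in> I" for i
    using p that unfolding pieces_def by blast+
  have n': "n_iso (P' j) (f' j) (Q' j) (g' j)" "P' j \<subseteq> Y" "Q' j \<subseteq> Z" if "j \<in> I'" for j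
    using p' that unfolding pieces_def by blast+
  define R where "R = (\<lambda>(i, j). g i ` (Q i \<inter> P' j))"
  define W where "W = (\<lambda>(i, j). f' j ` (Q i \<inter> P' j))"
  have RW: "n_iso (R (i, j)) (\<lambda>x. f' j (f i x)) (W (i, j)) (\<lambda>z. g i (g' j z))" "R (i, j) \<subseteq> P i" "W (i, j) \<subseteq> Q' j"
    if ij: "i \<in> I" "j \<in> I'" for i j
  proof -
    have s: "n_iso (Q i) (g i) (P i) (f i)" using n_iso_sym n(1) ij by blast
    have "open (Q i \<inter> P' j)" using n_isoD(5)[OF n(1)] n_isoD(4)[OF n'(1)] ij by blast
    moreover have "definable_set M (Q i \<inter> P' j)"
    proof -
      have "dfn vc (\<lambda>x. x \<in> Q i \<and> x \<in> P' j)"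
        using n_isoD(1)[OF s] n_isoD(1)[OF n'(1)] ij by (intro dfn_conj definable_setD dterm_vc) auto
      then show ?thesis by (simp add: definable_set_iff_dfn)
    qed
    ultimately have 1: "n_iso (Q i \<inter> P' j) (g i) (R (i, j)) (f i)"
      and 2: "n_iso (Q i \<inter> P' j) (f' j) (W (i, j)) (g' j)"
      using n_iso_restrict[OF s, of "Q i \<inter> P' j"] n_iso_restrict[OF n'(1), of j "Q i \<inter> P' j"] ij
      by (auto simp: R_def W_def)
    show "n_iso (R (i, j)) (\<lambda>x. f' j (f i x)) (W (i, j)) (\<lambda>z. g i (g' j z))"
      by (rule n_iso_trans[OF n_iso_sym[OF 1] 2])
    show "R (i, j) \<subseteq> P i" using n_isoD(6)[OF s] by (auto simp: R_def)
    show "W (i, j) \<subseteq> Q' j" using n_isoD(6)[OF n'(1)[OF ij(2)]] by (auto simp: W_def)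
  qed
  have memR: "x \<in> R (i, j)" if "i \<in> I" "x \<in> P i" "f i x \<in> P' j" for i j x
  proof -
    have "f i x \<in> Q i" "g i (f i x) = x" using n_isoD(6,7)[OF n(1)[OF that(1)]] that(2) by auto
    then show ?thesis using that(3) unfolding R_def by force
  qed
  have memW: "z \<in> W (i, j)" if "j \<in> I'" "z \<in> Q' j" "g' j z \<in> Q i" for i j z
  proof -
    have "g' j z \<in> P' j" "f' j (g' j z) = z" using n_isoD(6,7)[OF n_iso_sym[OF n'(1)[OF that(1)]]] that(2) by auto
    then show ?thesis using that(3) unfolding W_def by force
  qed
  have finv: "f i x \<in> Q i \<inter> P' j" if "i \<in> I" "x \<in> R (i, j)" for i j x
    using that n_isoD(7)[OF n_iso_sym[OF n(1)[OF that(1)]]] unfolding R_def by auto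
  have ginv: "g' j z \<in> Q i \<inter> P' j" if "j \<in> I'" "z \<in> W (i, j)" for i j z
    using that n_isoD(7)[OF n'(1)[OF that(1)]] unfolding W_def by auto
  have dP: "x \<in> P i \<Longrightarrow> x \<in> P k \<Longrightarrow> i \<in> I \<Longrightarrow> k \<in> I \<Longrightarrow> i = k"
    and dQ: "x \<in> Q i \<Longrightarrow> x \<in> Q k \<Longrightarrow> i \<in> I \<Longrightarrow> k \<in> I \<Longrightarrow> i = k" for x i k
    using p unfolding pieces_def disjoint_family_on_def by blast+
  have dP': "x \<in> P' i \<Longrightarrow> x \<in> P' k \<Longrightarrow> i \<in> I' \<Longrightarrow> k \<in> I' \<Longrightarrow> i = k"
    and dQ': "x \<in> Q' i \<Longrightarrow> x \<in> Q' k \<Longrightarrow> i \<in> I' \<Longrightarrow> k \<in> I' \<Longrightarrow> i = k" for x i k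
    using p' unfolding pieces_def disjoint_family_on_def by blast+
  have "R a \<inter> R b = {}" if ab: "a \<in> I \<times> I'" "b \<in> I \<times> I'" "a \<noteq> b" for a b
  proof (rule ccontr)
    assume "R a \<inter> R b \<noteq> {}"
    then obtain x where x: "x \<in> R (fst a, snd a)" "x \<in> R (fst b, snd b)" by auto
    have m: "fst a \<in> I" "snd a \<in> I'" "fst b \<in> I" "snd b \<in> I'" using ab by auto
    have "fst a = fst b" using dP RW(2) m x by blast
    moreover have "snd a = snd b"
      using dP' finv[OF m(1) x(1)] finv[OF m(3) x(2)] m \<open>fst a = fst b\<close> by auto
    ultimately show False using ab(3) by (simp add: prod_eq_iff)
  qed
  then have disR: "disjoint_family_on R (I \<times> I')" unfolding disjoint_family_on_def by blast
  have "W a \<inter> W b = {}" if ab: "a \<in> I \<times> I'" "b \<in> I \<times> I'" "a \<noteq> b" for a b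
  proof (rule ccontr)
    assume "W a \<inter> W b \<noteq> {}"
    then obtain x where x: "x \<in> W (fst a, snd a)" "x \<in> W (fst b, snd b)" by auto
    have m: "fst a \<in> I" "snd a \<in> I'" "fst b \<in> I" "snd b \<in> I'" using ab by auto
    have "snd a = snd b" using dQ' RW(3) m x by blast
    moreover have "fst a = fst b"
      using dQ ginv[OF m(2) x(1)] ginv[OF m(4) x(2)] m \<open>snd a = snd b\<close> by auto
    ultimately show False using ab(3) by (simp add: prod_eq_iff)
  qed
  then have disW: "disjoint_family_on W (I \<times> I')" unfolding disjoint_family_on_def by blast
  have gX: "generic UNIV (\<lambda>x. x \<in> X \<longrightarrow> (\<exists>i\<in>I. x \<in> P i))"
    and gY: "generic UNIV (\<lambda>y. y \<in> Y \<longrightarrow> (\<exists>i\<in>I. y \<in> Q i))" and fin: "finite I"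
    using p unfolding pieces_def by blast+
  have gY': "generic UNIV (\<lambda>x. x \<in> Y \<longrightarrow> (\<exists>i\<in>I'. x \<in> P' i))"
    and gZ: "generic UNIV (\<lambda>y. y \<in> Z \<longrightarrow> (\<exists>i\<in>I'. y \<in> Q' i))" and fin': "finite I'"
    using p' unfolding pieces_def by blast+
  have gf: "generic UNIV (\<lambda>x. x \<in> P i \<longrightarrow> f i x \<in> Y \<longrightarrow> (\<exists>j\<in>I'. f i x \<in> P' j))" if "i \<in> I" for i
    by (rule generic_volume_diffeo[OF gY' n_isoD(3)[OF n(1)[OF that]]])
  have gg: "generic UNIV (\<lambda>z. z \<in> Q' j \<longrightarrow> g' j z \<in> Y \<longrightarrow> (\<exists>i\<in>I. g' j z \<in> Q i))" if "j \<in> I'" for j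
    by (rule generic_volume_diffeo[OF gY n_isoD(3)[OF n_iso_sym[OF n'(1)[OF that]]]])
  have "generic UNIV (\<lambda>x. x \<in> X \<longrightarrow> (\<exists>a\<in>I \<times> I'. x \<in> R a))"
  proof (rule generic_mono)
    show "generic UNIV (\<lambda>x. (x \<in> X \<longrightarrow> (\<exists>i\<in>I. x \<in> P i)) \<and>
        (\<forall>i\<in>I. x \<in> P i \<longrightarrow> f i x \<in> Y \<longrightarrow> (\<exists>j\<in>I'. f i x \<in> P' j)))"
      by (intro generic_conj gX generic_ball fin gf)
    fix x assume *: "(x \<in> X \<longrightarrow> (\<exists>i\<in>I. x \<in> P i)) \<and>
        (\<forall>i\<in>I. x \<in> P i \<longrightarrow> f i x \<in> Y \<longrightarrow> (\<exists>j\<in>I'. f i x \<in> P' j))"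
    show "x \<in> X \<longrightarrow> (\<exists>a\<in>I \<times> I'. x \<in> R a)"
    proof
      assume "x \<in> X"
      then obtain i where i: "i \<in> I" "x \<in> P i" using * by blast
      then have "f i x \<in> Y" using n_isoD(6)[OF n(1)] n(3) by blast
      then obtain j where "j \<in> I'" "f i x \<in> P' j" using * i by blast
      then show "\<exists>a\<in>I \<times> I'. x \<in> R a" using memR i by blast
    qed
  qed
  moreover have "generic UNIV (\<lambda>z. z \<in> Z \<longrightarrow> (\<exists>a\<in>I \<times> I'. z \<in> W a))"
  proof (rule generic_mono)
    show "generic UNIV (\<lambda>z. (z \<in> Z \<longrightarrow> (\<exists>j\<in>I'. z \<in> Q' j)) \<and>
        (\<forall>j\<in>I'. z \<in> Q' j \<longrightarrow> g' j z \<in> Y \<longrightarrow> (\<exists>i\<in>I. g' j z \<in> Q i)))"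
      by (intro generic_conj gZ generic_ball fin' gg)
    fix z assume *: "(z \<in> Z \<longrightarrow> (\<exists>j\<in>I'. z \<in> Q' j)) \<and>
        (\<forall>j\<in>I'. z \<in> Q' j \<longrightarrow> g' j z \<in> Y \<longrightarrow> (\<exists>i\<in>I. g' j z \<in> Q i))"
    show "z \<in> Z \<longrightarrow> (\<exists>a\<in>I \<times> I'. z \<in> W a)"
    proof
      assume "z \<in> Z"
      then obtain j where j: "j \<in> I'" "z \<in> Q' j" using * by blast
      then have "g' j z \<in> Y" using n_isoD(6)[OF n_iso_sym[OF n'(1)]] n'(2) by blast
      then obtain i where "i \<in> I" "g' j z \<in> Q i" using * j by blast
      then show "\<exists>a\<in>I \<times> I'. z \<in> W a" using memW j by blast
    qed
  qed
  moreover have "\<forall>a\<in>I \<times> I'. n_iso (R a) (\<lambda>x. f' (snd a) (f (fst a) x)) (W a) (\<lambda>z. g (fst a) (g' (snd a) z)) \<and>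
      R a \<subseteq> X \<and> W a \<subseteq> Z"
    using RW n(2) n'(3) by fastforce
  ultimately have "pieces (I \<times> I') X Z R (\<lambda>a x. f' (snd a) (f (fst a) x)) W (\<lambda>a z. g (fst a) (g' (snd a) z))"
    unfolding pieces_def using fin fin' disR disW by blast
  then show ?thesis by (rule iso_relI[OF X Z])
qed

lemma bounded_definable_Un:
  fixes X :: "('a ^ 'n::finite) set"
  assumes "X \<in> bounded_definable M" "Y \<in> bounded_definable M"
  shows "X \<union> Y \<in> bounded_definable M"
proof -
  obtain r s where r: "\<forall>x\<in>X. \<forall>i. - r \<le> x $ i \<and> x $ i \<le> r" and s: "\<forall>x\<in>Y. \<forall>i. - s \<le> x $ i \<and> x $ i \<le> s"
    using assms unfolding bounded_definable_def by auto
  have "dfn vc (\<lambda>x. x \<in> X \<or> x \<in> Y)"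
    using assms by (intro dfn_disj definable_setD dterm_vc bounded_definableD)
  then have "definable_set M (X \<union> Y)" by (simp add: definable_set_iff_dfn)
  moreover have "\<forall>x\<in>X \<union> Y. \<forall>i. - max r s \<le> x $ i \<and> x $ i \<le> max r s"
    using r s by (auto simp: le_max_iff_disj minus_le_iff)
  ultimately show ?thesis unfolding bounded_definable_def by blast
qed

lemma iso_rel_Un:
  fixes X :: "('a ^ 'n::finite) set"
  assumes XX: "(X, X') \<in> iso_rel M" and YY: "(Y, Y') \<in> iso_rel M" and d: "X \<inter> Y = {}" "X' \<inter> Y' = {}"
  shows "(X \<union> Y, X' \<union> Y') \<in> iso_rel M"
proof -
  obtain I :: "nat set" and P f Q g where X: "X \<in> bounded_definable M" "X' \<in> bounded_definable M"
    and p: "pieces I X X' P f Q g" using XX by (rule iso_relE)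
  obtain I' :: "nat set" and P' f' Q' g' where Y: "Y \<in> bounded_definable M" "Y' \<in> bounded_definable M"
    and p': "pieces I' Y Y' P' f' Q' g'" using YY by (rule iso_relE)
  have dis: "disjoint_family_on (case_sum A B) (I <+> I')"
    if "disjoint_family_on A I" "disjoint_family_on B I'" "\<forall>i\<in>I. A i \<subseteq> U" "\<forall>i\<in>I'. B i \<subseteq> V" "U \<inter> V = {}"
    for A B :: "nat \<Rightarrow> ('a ^ 'n) set" and U V
    using that unfolding disjoint_family_on_def by (auto simp: Plus_def) blast+
  have gen: "generic UNIV (\<lambda>x. x \<in> U \<union> V \<longrightarrow> (\<exists>i\<in>I <+> I'. x \<in> case_sum A B i))"
    if "generic UNIV (\<lambda>x. x \<in> U \<longrightarrow> (\<exists>i\<in>I. x \<in> A i))" "generic UNIV (\<lambda>x. x \<in> V \<longrightarrow> (\<exists>i\<in>I'. x \<in> B i))"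
    for A B :: "nat \<Rightarrow> ('a ^ 'n) set" and U V
    by (rule generic_mono[OF generic_conj[OF that]]) (simp add: Plus_def bex_Un; blast)
  have "pieces (I <+> I') (X \<union> Y) (X' \<union> Y') (case_sum P P') (case_sum f f') (case_sum Q Q') (case_sum g g')"
  proof -
    have n: "n_iso (P i) (f i) (Q i) (g i)" "P i \<subseteq> X" "Q i \<subseteq> X'" if "i \<in> I" for i
      using p that unfolding pieces_def by blast+
    have n': "n_iso (P' i) (f' i) (Q' i) (g' i)" "P' i \<subseteq> Y" "Q' i \<subseteq> Y'" if "i \<in> I'" for i
      using p' that unfolding pieces_def by blast+
    have "n_iso (case_sum P P' a) (case_sum f f' a) (case_sum Q Q' a) (case_sum g g' a) \<and>
        case_sum P P' a \<subseteq> X \<union> Y \<and> case_sum Q Q' a \<subseteq> X' \<union> Y'" if "a \<in> I <+> I'" for a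
    proof (cases a)
      case (Inl i)
      then have "i \<in> I" using that by auto
      from n[OF this] show ?thesis unfolding Inl sum.case by blast
    next
      case (Inr i)
      then have "i \<in> I'" using that by auto
      from n'[OF this] show ?thesis unfolding Inr sum.case by blast
    qed
    moreover have "finite (I <+> I')" using p p' by (simp add: pieces_def)
    moreover have "disjoint_family_on (case_sum P P') (I <+> I')"
      using p p' d n n' by (intro dis[of P P' X Y]) (auto simp only: pieces_def)
    moreover have "disjoint_family_on (case_sum Q Q') (I <+> I')"
      using p p' d n n' by (intro dis[of Q Q' X' Y']) (auto simp only: pieces_def)
    ultimately show ?thesis using p p' unfolding pieces_def by (intro conjI gen) blast+
  qed
  then show ?thesis by (rule iso_relI[OF bounded_definable_Un bounded_definable_Un, OF X(1) Y(1) X(2) Y(2)])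
qed

end

section \<open>Shears\<close>

definition shear :: "('a::linordered_field ^ 'n \<Rightarrow> 'a) \<Rightarrow> 'n \<Rightarrow> 'a ^ 'n \<Rightarrow> 'a ^ 'n" where
  "shear a j x = upd x j (x $ j + a x)"

lemma has_gradient_const: "has_gradient (\<lambda>_ :: 'a::linordered_field ^ 'n::finite. c) 0 x"
  by (auto simp: has_gradient_def sup_norm_ge_0 intro!: exI[of _ 1] mult_nonneg_nonneg)

text \<open>
  The identity matrix with its \<open>j\<close>-th row replaced, so Cramer's rule reads off the determinant.
\<close>

lemma det_shear_matrix:
  fixes g :: "'a::field ^ 'n::finite"
  assumes "g $ j = 0"
  shows "det (\<chi> i. if i = j then axis j 1 + g else axis i 1) = 1"
proof -
  let ?x = "axis j 1 + g"
  have row: "row i (mat 1 :: 'a ^ 'n ^ 'n) = axis i 1" for i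
    by (simp add: row_def mat_def axis_def vec_eq_iff)
  have "(\<Sum>i\<in>UNIV. ?x $ i *s axis i 1) = ?x" by (rule basis_expansion)
  then have "(\<chi> i. if i = j then ?x else axis i 1) =
      (\<chi> i. if i = j then (\<Sum>i\<in>UNIV. ?x $ i *s row i (mat 1)) else row i (mat 1) :: 'a ^ 'n ^ 'n)"
    by (simp only: row)
  then show ?thesis using cramer_lemma_transpose[of j ?x "mat 1 :: 'a ^ 'n ^ 'n"] assms
    by (simp only: det_I) simp
qed

text \<open>
  The function does not change in direction \<open>j\<close> inside any cube contained in \<open>X\<close>. This is the form in
  which the ends of a fibre component are constant along the component.
\<close>

definition vertically_constant ::
  "('a::linordered_field ^ 'n) set \<Rightarrow> 'n \<Rightarrow> ('a ^ 'n \<Rightarrow> 'a) \<Rightarrow> bool" where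
  "vertically_constant X j a \<longleftrightarrow> (\<forall>x r y t. cube UNIV x r \<subseteq> X \<longrightarrow> y \<in> cube UNIV x r \<longrightarrow>
     \<bar>t - x $ j\<bar> < r \<longrightarrow> a (upd y j t) = a y)"

text \<open>
  Inside a cube \<open>a z\<close> depends only on the coordinates other than \<open>j\<close>, which the shear does not change.
  So \<open>y\<close> is the image of the point obtained by lowering its \<open>j\<close>-th coordinate by the value that \<open>a\<close>
  takes on the line through \<open>y\<close>.
\<close>

lemma shear_open_map:
  fixes a :: "'a::linordered_field ^ 'n::finite \<Rightarrow> 'a"
  assumes v: "vertically_constant X j a" and X: "cube UNIV x r0 \<subseteq> X" "0 < r0"
    and c: "continuous_at a x" and r: "0 < r"
  shows "\<exists>t>0. cube UNIV (shear a j x) t \<subseteq> shear a j ` cube UNIV x r"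
proof -
  define s where "s = min r r0"
  have s: "0 < s" "s \<le> r" "s \<le> r0" using r X(2) by (auto simp: s_def)
  have sX: "cube UNIV x s \<subseteq> X" using X(1) cube_mono[OF s(3)] by blast
  have "0 < s / 2" using s by simp
  then obtain \<delta> where \<delta>: "0 < \<delta>" "\<And>y. y \<in> cube UNIV x \<delta> \<Longrightarrow> \<bar>a y - a x\<bar> < s / 2"
    using cont_on_cubesE[OF c] by blast
  define t where "t = min \<delta> (s / 2)"
  have t: "0 < t" "t \<le> \<delta>" "t \<le> s / 2" "t \<le> s" using \<delta>(1) s by (auto simp: t_def min_le_iff_disj)
  have "y \<in> shear a j ` cube UNIV x r" if y: "y \<in> cube UNIV (shear a j x) t" for y
  proof -
    have yi: "\<bar>y $ i - x $ i\<bar> < t" if "i \<noteq> j" for i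
    proof -
      have "\<bar>y $ i - shear a j x $ i\<bar> < t" using y by (simp add: cube_def)
      then show ?thesis using that by (simp add: shear_def)
    qed
    have "\<bar>y $ j - shear a j x $ j\<bar> < t" using y by (simp add: cube_def)
    then have yj: "\<bar>y $ j - (x $ j + a x)\<bar> < t" by (simp add: shear_def)
    define b where "b = a (upd y j (x $ j))"
    have u: "upd y j (x $ j) \<in> cube UNIV x t" using yi t(1) by (auto simp: cube_def)
    then have "\<bar>b - a x\<bar> < s / 2" unfolding b_def using cube_UNIV_mono[OF t(2)] by (intro \<delta>(2)) blast
    moreover have "s / 2 + s / 2 = s" by simp
    ultimately have sj: "\<bar>y $ j - b - x $ j\<bar> < s" using yj t(3) by linarith
    \<comment> \<open>the preimage of \<open>y\<close>: both \<open>z\<close> and \<open>upd y j (x $ j)\<close> lie in the cube around \<open>x\<close>, so \<open>a\<close> takes the value \<open>b\<close> at both\<close>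
    define z where "z = upd y j (y $ j - b)"
    have z: "z \<in> cube UNIV x s" using yi t(4) sj unfolding z_def cube_def
      by (auto intro: order_less_le_trans)
    have "a (upd (upd y j (x $ j)) j (y $ j - b)) = a (upd y j (x $ j))"
      using v sX cube_UNIV_mono[OF t(4) u] sj unfolding vertically_constant_def by blast
    then have "a z = b" by (simp add: z_def b_def)
    then have "shear a j z = y" by (simp add: shear_def z_def vec_eq_iff)
    then show ?thesis using cube_UNIV_mono[OF s(2) z] by blast
  qed
  then show ?thesis using t(1) by blast
qed

context o_minimal_structure begin

lemma dterm_shear:
  fixes a :: "'a ^ 'n::finite \<Rightarrow> 'a"
  assumes a: "dterm vc a" and u: "\<And>i. dterm C (\<lambda>z. u z $ i)"
  shows "dterm C (\<lambda>z. shear a j (u z) $ i)"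
  unfolding shear_def by (intro dterm_upd dterm_add dterm_vec_subst[OF a] u)

text \<open>
  The points near which \<open>a\<close> is continuously differentiable and which lie in the interior of \<open>X\<close>. There
  the gradient of \<open>a\<close> has \<open>j\<close>-th component \<open>0\<close>, since \<open>a\<close> is constant in that direction.
\<close>

lemma shear_regular_locus:
  fixes X :: "('a ^ 'n::finite) set"
  assumes X: "definable_set M X" and a: "dterm vc a" and v: "vertically_constant X j a"
  obtains U D where "definable_set M U" "open U" "U \<subseteq> X" "generic UNIV (\<lambda>x. x \<in> X \<longrightarrow> x \<in> U)"
    "C1_with_derivative U (shear a j) D" "\<And>x. x \<in> U \<Longrightarrow> det (D x) = 1"
    "\<And>x r. x \<in> U \<Longrightarrow> 0 < r \<Longrightarrow> \<exists>t>0. cube UNIV (shear a j x) t \<subseteq> shear a j ` cube UNIV x r"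
proof -
  obtain G where G: "\<And>k. dterm vc (\<lambda>x. G x $ k)"
    and gen: "generic UNIV (\<lambda>x. has_gradient a (G x) x \<and> (\<forall>k. continuous_at (\<lambda>y. G y $ k) x))"
    using generic_C1[OF a] by blast
  define C where "C x \<longleftrightarrow> has_gradient a (G x) x \<and> (\<forall>k\<in>UNIV. continuous_at (\<lambda>y. G y $ k) x)" for x
  have gC: "generic UNIV C" using generic_mono[OF gen, of C] by (simp add: C_def)
  have dC: "dfn vc C" unfolding C_def
    by (intro dfn_conj dfn_has_gradient a G dfn_ball_fin dfn_cont_on_cubes)
  define U where "U = {x. \<exists>r. 0 < r \<and> (\<forall>y. y \<in> cube UNIV x r \<longrightarrow> y \<in> X \<and> C y)}"
  have U: "definable_set M U" unfolding definable_set_iff_dfn U_def mem_Collect_eq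
    by (intro dfn_intros dfn_cube definable_setD[OF X] dfn_vec_subst[OF dC] dterm_intros dterm_fst dterm_snd)
  have oU: "open U" unfolding open_iff_cube
  proof
    fix x assume "x \<in> U"
    then obtain r where r: "0 < r" "\<And>y. y \<in> cube UNIV x r \<Longrightarrow> y \<in> X \<and> C y" unfolding U_def by blast
    have "y \<in> U" if y: "y \<in> cube UNIV x r" for y
    proof -
      obtain s where "0 < s" "cube UNIV y s \<subseteq> cube UNIV x r" using cube_subcube[OF y] .
      then show ?thesis unfolding U_def using r(2) by blast
    qed
    then show "\<exists>r>0. cube UNIV x r \<subseteq> U" using r(1) by blast
  qed
  have UX: "x \<in> X \<and> C x" if "x \<in> U" for x
    using that cube_center unfolding U_def by blast
  have gU: "generic UNIV (\<lambda>x. x \<in> X \<longrightarrow> x \<in> U)" unfolding generic_def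
  proof (intro allI impI)
    fix p :: "'a ^ 'n" and r :: 'a assume "0 < r"
    then obtain q s where q: "0 < s" "cube UNIV q s \<subseteq> cube UNIV p r" "\<forall>x\<in>cube UNIV q s. C x"
      using gC unfolding generic_def by blast
    have "dfn vc (\<lambda>x. x \<in> X)" by (intro definable_setD[OF X] dterm_vc)
    then obtain q' s' where q': "0 < s'" "cube UNIV q' s' \<subseteq> cube UNIV q s"
      "(\<forall>x\<in>cube UNIV q' s'. x \<in> X) \<or> (\<forall>x\<in>cube UNIV q' s'. x \<notin> X)"
      using decided_on_subcube_UNIV q(1) unfolding decided_on_subcube_def by blast
    have "x \<in> U" if "\<forall>x\<in>cube UNIV q' s'. x \<in> X" and x: "x \<in> cube UNIV q' s'" for x
    proof -
      obtain s where "0 < s" "cube UNIV x s \<subseteq> cube UNIV q' s'" using cube_subcube[OF x] .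
      then show ?thesis unfolding U_def using that(1) q(3) q'(2) by blast
    qed
    then have "\<forall>x\<in>cube UNIV q' s'. x \<in> X \<longrightarrow> x \<in> U" using q'(3) by blast
    then show "\<exists>q s. 0 < s \<and> cube UNIV q s \<subseteq> cube UNIV p r \<and> (\<forall>x\<in>cube UNIV q s. x \<in> X \<longrightarrow> x \<in> U)"
      using q(2) q'(1,2) by blast
  qed
  have G0: "G x $ j = 0" if x: "x \<in> U" for x
  proof -
    obtain r where r: "0 < r" "cube UNIV x r \<subseteq> X" using x unfolding U_def by blast
    let ?F = "\<lambda>y. upd y j (x $ j)"
    let ?D = "\<chi> i. if i = j then 0 else axis i 1 :: 'a ^ 'n ^ 'n"
    have g: "has_gradient a (G x) x" using UX[OF x] by (simp add: C_def)
    have "has_gradient (\<lambda>y. a (?F y)) (G x v* ?D) x"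
    proof (rule has_gradient_chain)
      show "has_gradient a (G x) (?F x)" using g by simp
      show "has_gradient (\<lambda>y. ?F y $ i) (?D $ i) x" for i
        by (cases "i = j") (simp_all add: has_gradient_const has_gradient_coord)
    qed
    moreover have "a y = a (?F y)" if "y \<in> cube UNIV x r" for y
      using v r that unfolding vertically_constant_def by (metis abs_zero diff_self)
    ultimately have "has_gradient a (G x v* ?D) x" by (rule has_gradient_local[OF _ r(1)])
    then have "G x = G x v* ?D" using g has_gradient_unique by blast
    then have "G x $ j = (G x v* ?D) $ j" by simp
    also have "\<dots> = 0" unfolding vector_matrix_mult_def
      by (auto intro!: sum.neutral simp: axis_def)
    finally show ?thesis .
  qed
  define D where "D x = (\<chi> i. if i = j then axis j 1 + G x else axis i 1)" for x
  have "C1_with_derivative U (shear a j) D" unfolding C1_with_derivative_def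
  proof (intro ballI allI conjI)
    fix x i assume x: "x \<in> U"
    have g: "has_gradient a (G x) x" and gc: "continuous_at (\<lambda>y. G y $ k) x" for k
      using UX[OF x] by (simp_all add: C_def)
    show "has_gradient (\<lambda>y. shear a j y $ i) (D x $ i) x"
      using has_gradient_add[OF has_gradient_coord g] has_gradient_coord
      by (cases "i = j") (simp_all add: shear_def D_def)
    fix k
    show "continuous_at (\<lambda>y. D y $ i $ k) x"
      using continuous_at_add[OF continuous_at_const gc] continuous_at_const
      by (cases "i = j") (simp_all add: D_def)
  qed
  moreover have "det (D x) = 1" if "x \<in> U" for x
    unfolding D_def using G0[OF that] by (rule det_shear_matrix)
  moreover have "\<exists>t>0. cube UNIV (shear a j x) t \<subseteq> shear a j ` cube UNIV x r"
    if x: "x \<in> U" and r: "0 < r" for x r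
  proof -
    obtain r0 where r0: "0 < r0" "cube UNIV x r0 \<subseteq> X" using x unfolding U_def by blast
    have "continuous_at a x" using UX[OF x] has_gradient_continuous by (auto simp: C_def)
    then show ?thesis using shear_open_map[OF v r0(2,1) _ r] by blast
  qed
  ultimately show ?thesis using that U oU UX gU by blast
qed

text \<open>
  A definable bijection between \<open>X\<close> and \<open>Y\<close> that is a shear in both directions. It suffices to discard
  the points where the shear or its inverse is not regular; these sets are negligible on both sides
  because regular shears are open maps.
\<close>

lemma iso_rel_shear:
  fixes X :: "('a ^ 'n::finite) set"
  assumes X: "X \<in> bounded_definable M" and Y: "Y \<in> bounded_definable M"
    and a: "dterm vc a" and b: "dterm vc b"
    and va: "vertically_constant X j a" and vb: "vertically_constant Y j b"
    and XY: "\<And>x. x \<in> X \<Longrightarrow> shear a j x \<in> Y \<and> b (shear a j x) = - a x"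
    and YX: "\<And>y. y \<in> Y \<Longrightarrow> shear b j y \<in> X \<and> a (shear b j y) = - b y"
  shows "(X, Y) \<in> iso_rel M"
proof -
  obtain U D where U: "definable_set M U" "open U" "U \<subseteq> X" "generic UNIV (\<lambda>x. x \<in> X \<longrightarrow> x \<in> U)"
    and D: "C1_with_derivative U (shear a j) D" "\<And>x. x \<in> U \<Longrightarrow> det (D x) = 1"
    and oU: "\<And>x r. x \<in> U \<Longrightarrow> 0 < r \<Longrightarrow> \<exists>t>0. cube UNIV (shear a j x) t \<subseteq> shear a j ` cube UNIV x r"
    using shear_regular_locus[OF bounded_definableD[OF X] a va] by blast
  obtain V E where V: "definable_set M V" "open V" "V \<subseteq> Y" "generic UNIV (\<lambda>x. x \<in> Y \<longrightarrow> x \<in> V)"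
    and E: "C1_with_derivative V (shear b j) E" "\<And>x. x \<in> V \<Longrightarrow> det (E x) = 1"
    and oV: "\<And>x r. x \<in> V \<Longrightarrow> 0 < r \<Longrightarrow> \<exists>t>0. cube UNIV (shear b j x) t \<subseteq> shear b j ` cube UNIV x r"
    using shear_regular_locus[OF bounded_definableD[OF Y] b vb] by blast
  have inv: "shear b j (shear a j x) = x" if "x \<in> X" for x
    using XY[OF that] by (simp add: shear_def vec_eq_iff)
  have inv': "shear a j (shear b j y) = y" if "y \<in> Y" for y
    using YX[OF that] by (simp add: shear_def vec_eq_iff)
  define P where "P = {x \<in> U. shear a j x \<in> V}"
  define Q where "Q = {y \<in> V. shear b j y \<in> U}"
  have PQ: "shear a j ` P = Q"
  proof
    show "shear a j ` P \<subseteq> Q" unfolding P_def Q_def using inv U(3) by auto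
    show "Q \<subseteq> shear a j ` P"
    proof
      fix y assume "y \<in> Q"
      then have "shear b j y \<in> P" "y = shear a j (shear b j y)"
        unfolding P_def Q_def using inv' V(3) by auto
      then show "y \<in> shear a j ` P" by blast
    qed
  qed
  have "open P" unfolding P_def by (rule open_preimage[OF C1_with_derivativeD(3)[OF D(1)] U(2) V(2)])
  moreover have "open Q" unfolding Q_def by (rule open_preimage[OF C1_with_derivativeD(3)[OF E(1)] V(2) U(2)])
  moreover have "C1_with_derivative P (shear a j) D" using D(1) by (rule C1_with_derivative_subset) (auto simp: P_def)
  moreover have "C1_with_derivative Q (shear b j) E" using E(1) by (rule C1_with_derivative_subset) (auto simp: Q_def)
  moreover have "\<forall>x\<in>P. \<bar>det (D x)\<bar> = 1" using D(2) by (simp add: P_def)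
  moreover have "\<forall>x\<in>P. shear b j (shear a j x) = x" using inv U(3) by (auto simp: P_def)
  ultimately have vd: "volume_diffeo P (shear a j) Q (shear b j)" unfolding volume_diffeo_def using PQ by blast
  have dP: "definable_set M P" unfolding definable_set_iff_dfn P_def mem_Collect_eq
    by (intro dfn_conj definable_setD[OF U(1)] definable_setD[OF V(1)] dterm_shear[OF a] dterm_vc)
  have "dfn (pr vc vc) (\<lambda>z :: ('a ^ 'n) \<times> ('a ^ 'n). fst z \<in> P \<and> (\<forall>i\<in>UNIV. shear a j (fst z) $ i = snd z $ i))"
    by (intro dfn_conj dfn_ball_fin dfn_eq definable_setD[OF dP] dterm_shear[OF a] dterm_fst dterm_snd dterm_vc)
  then have "definable_map M P (shear a j)" by (simp add: definable_map_iff_dfn vec_eq_iff)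
  then have n: "n_iso P (shear a j) Q (shear b j)" unfolding n_iso_def using dP vd by blast
  have "generic UNIV (\<lambda>x. x \<in> U \<longrightarrow> (shear a j x \<in> Y \<longrightarrow> shear a j x \<in> V))"
    by (rule generic_transport[OF V(4) U(2) C1_with_derivativeD(3)[OF D(1)] oU])
  from generic_conj[OF U(4) this] have gP: "generic UNIV (\<lambda>x. x \<in> X \<longrightarrow> x \<in> P)"
    by (rule generic_mono) (use XY in \<open>auto simp: P_def\<close>)
  have "generic UNIV (\<lambda>x. x \<in> V \<longrightarrow> (shear b j x \<in> X \<longrightarrow> shear b j x \<in> U))"
    by (rule generic_transport[OF U(4) V(2) C1_with_derivativeD(3)[OF E(1)] oV])
  from generic_conj[OF V(4) this] have gQ: "generic UNIV (\<lambda>x. x \<in> Y \<longrightarrow> x \<in> Q)"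
    by (rule generic_mono) (use YX in \<open>auto simp: Q_def\<close>)
  have "P \<subseteq> X" "Q \<subseteq> Y" using U(3) V(3) by (auto simp: P_def Q_def)
  then have "pieces {()} X Y (\<lambda>_. P) (\<lambda>_. shear a j) (\<lambda>_. Q) (\<lambda>_. shear b j)"
    unfolding pieces_def using n gP gQ by (simp add: disjoint_family_on_def)
  then show ?thesis by (rule iso_relI[OF X Y])
qed

text \<open>
  The identity map on the interior of the intersection, obtained as the regular locus of the zero shear.
\<close>

lemma iso_rel_generic_eq:
  fixes X :: "('a ^ 'n::finite) set"
  assumes X: "X \<in> bounded_definable M" and Y: "Y \<in> bounded_definable M"
    and g: "generic UNIV (\<lambda>x. x \<in> X \<longleftrightarrow> x \<in> Y)"
  shows "(X, Y) \<in> iso_rel M"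
proof -
  let ?Z = "X \<inter> Y"
  have zero: "shear (\<lambda>_. 0) j x = x" for j and x :: "'a ^ 'n" by (simp add: shear_def vec_eq_iff)
  have Z: "definable_set M ?Z"
  proof -
    have "dfn vc (\<lambda>x. x \<in> X \<and> x \<in> Y)"
      by (intro dfn_conj definable_setD[OF bounded_definableD[OF X]]
          definable_setD[OF bounded_definableD[OF Y]] dterm_vc)
    then show ?thesis by (simp add: definable_set_iff_dfn)
  qed
  have v: "vertically_constant ?Z undefined (\<lambda>_. 0)" by (simp add: vertically_constant_def)
  obtain U D where U: "definable_set M U" "open U" "U \<subseteq> ?Z" "generic UNIV (\<lambda>x. x \<in> ?Z \<longrightarrow> x \<in> U)"
    and D: "C1_with_derivative U (shear (\<lambda>_. 0) undefined) D" "\<And>x. x \<in> U \<Longrightarrow> det (D x) = 1"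
    by (rule shear_regular_locus[OF Z dterm_const v]) blast
  have D': "C1_with_derivative U (\<lambda>x. x) D" using D(1) unfolding zero .
  have "volume_diffeo U (\<lambda>x. x) U (\<lambda>x. x)" unfolding volume_diffeo_def
    using U(2) D' D(2) by (auto intro!: exI[of _ D])
  moreover have "definable_map M U (\<lambda>x. x)"
  proof -
    have "dfn (pr vc vc) (\<lambda>z :: ('a ^ 'n) \<times> ('a ^ 'n). fst z \<in> U \<and> (\<forall>i\<in>UNIV. fst z $ i = snd z $ i))"
      by (intro dfn_conj dfn_ball_fin dfn_eq definable_setD[OF U(1)] dterm_fst dterm_snd dterm_vc)
    then show ?thesis by (simp add: definable_map_iff_dfn vec_eq_iff)
  qed
  ultimately have n: "n_iso U (\<lambda>x. x) U (\<lambda>x. x)" unfolding n_iso_def using U(1) by blast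
  have "generic UNIV (\<lambda>x. x \<in> X \<longrightarrow> x \<in> U)" "generic UNIV (\<lambda>x. x \<in> Y \<longrightarrow> x \<in> U)"
    by (rule generic_mono[OF generic_conj[OF g U(4)]]; blast)+
  then have "pieces {()} X Y (\<lambda>_. U) (\<lambda>_ x. x) (\<lambda>_. U) (\<lambda>_ x. x)"
    unfolding pieces_def using n U(3) by (simp add: disjoint_family_on_def)
  then show ?thesis by (rule iso_relI[OF X Y])
qed

end

section \<open>Stretching a coordinate and halving a class\<close>

text \<open>
  On classes of sets this is multiplication by the scalar \<open>c\<close>, for positive \<open>c\<close>.
\<close>

definition stretch :: "'a::linordered_field \<Rightarrow> 'n \<Rightarrow> 'a ^ 'n \<Rightarrow> 'a ^ 'n" where
  "stretch c j x = upd x j (c * x $ j)"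

lemma stretch_nth: "stretch c j x $ i = (if i = j then c * x $ j else x $ i)"
  by (simp add: stretch_def)

lemma stretch_inverse: "c \<noteq> 0 \<Longrightarrow> stretch (1 / c) j (stretch c j x) = x"
  "c \<noteq> 0 \<Longrightarrow> stretch c j (stretch (1 / c) j x) = x"
  by (simp_all add: stretch_nth vec_eq_iff)

lemma mem_stretch: "c \<noteq> 0 \<Longrightarrow> y \<in> stretch c j ` X \<longleftrightarrow> stretch (1 / c) j y \<in> X"
  by (metis (no_types, lifting) image_iff stretch_inverse)

lemma C1_stretch:
  fixes U :: "('a::{linordered_field,linorder_topology} ^ 'n::finite) set"
  obtains D where "C1_with_derivative U (stretch c j) (\<lambda>_. D)" "det D = c"
proof -
  define D :: "'a ^ 'n ^ 'n" where "D = (\<chi> i. if i = j then c *s axis j 1 else axis i 1)"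
  have "C1_with_derivative U (stretch c j) (\<lambda>_. D)" unfolding C1_with_derivative_def
  proof (intro ballI allI conjI)
    fix x i
    show "has_gradient (\<lambda>y. stretch c j y $ i) (D $ i) x"
      using has_gradient_scale[OF has_gradient_coord] has_gradient_coord
      by (cases "i = j") (simp_all add: stretch_nth D_def)
  qed (rule continuous_at_const)
  moreover have "det D = c"
  proof -
    have "det D = prod (\<lambda>i. D $ i $ i) UNIV" by (rule det_diagonal) (auto simp: D_def axis_def)
    also have "\<dots> = (\<Prod>i\<in>UNIV. if i = j then c else 1)" by (rule prod.cong) (auto simp: D_def axis_def)
    finally show ?thesis by simp
  qed
  ultimately show ?thesis using that by blast
qed

lemma continuous_at_stretch:
  "continuous_at (\<lambda>y. stretch c j y $ i) (x :: 'a::{linordered_field,linorder_topology} ^ 'n::finite)"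
proof -
  obtain D where "C1_with_derivative UNIV (stretch c j :: 'a ^ 'n \<Rightarrow> 'a ^ 'n) (\<lambda>_. D)" using C1_stretch by blast
  then show ?thesis using C1_with_derivativeD(3) by blast
qed

lemma open_stretch:
  fixes U :: "('a::{linordered_field,linorder_topology} ^ 'n::finite) set"
  assumes "open U" "c \<noteq> 0"
  shows "open (stretch c j ` U)"
proof -
  have "stretch c j ` U = {y \<in> UNIV. stretch (1 / c) j y \<in> U}" using mem_stretch[OF assms(2)] by auto
  then show ?thesis
    using open_preimage[OF continuous_at_stretch open_UNIV assms(1)] by simp
qed

text \<open>
  The determinants \<open>c\<close> and \<open>1 / c\<close> of the two conjugating maps cancel.
\<close>

lemma volume_diffeo_stretch:
  fixes U :: "('a::{linordered_field,linorder_topology} ^ 'n::finite) set"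
  assumes d: "volume_diffeo U f V g" and c: "c \<noteq> 0"
  shows "volume_diffeo (stretch c j ` U) (\<lambda>x. stretch c j (f (stretch (1 / c) j x)))
    (stretch c j ` V) (\<lambda>x. stretch c j (g (stretch (1 / c) j x)))"
proof -
  obtain D E where U: "open U" "open V" "f ` U = V" and gf: "\<And>x. x \<in> U \<Longrightarrow> g (f x) = x"
    and D: "C1_with_derivative U f D" "\<And>x. x \<in> U \<Longrightarrow> \<bar>det (D x)\<bar> = 1"
    and E: "C1_with_derivative V g E"
    using d unfolding volume_diffeo_def by blast
  let ?S = "stretch c j" and ?T = "stretch (1 / c) j"
  have TS: "?T ` ?S ` W \<subseteq> W" for W :: "('a ^ 'n) set" by (auto simp: stretch_inverse[OF c])
  obtain A where A: "C1_with_derivative UNIV ?S (\<lambda>_. A)" "det A = c" using C1_stretch by blast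
  obtain B where B: "C1_with_derivative UNIV ?T (\<lambda>_. B)" "det B = 1 / c" using C1_stretch by blast
  have conj: "C1_with_derivative (?S ` W) (\<lambda>x. ?S (h (?T x))) (\<lambda>x. A ** (H (?T x) ** B))"
    if "C1_with_derivative W h H" for W h H
  proof -
    have "C1_with_derivative (?S ` W) (\<lambda>x. h (?T x)) (\<lambda>x. H (?T x) ** B)"
      by (rule C1_with_derivative_compose[OF C1_with_derivative_subset[OF B(1) subset_UNIV] that TS])
    from C1_with_derivative_compose[OF this A(1) subset_UNIV] show ?thesis .
  qed
  have "\<forall>x\<in>?S ` U. \<bar>det (A ** (D (?T x) ** B))\<bar> = 1"
  proof
    fix x assume "x \<in> ?S ` U"
    then have "\<bar>det (D (?T x))\<bar> = 1" using D(2) TS by blast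
    then show "\<bar>det (A ** (D (?T x) ** B))\<bar> = 1" using c by (simp add: det_mul A(2) B(2) abs_mult)
  qed
  with conj[OF D(1)] have "\<exists>D. C1_with_derivative (?S ` U) (\<lambda>x. ?S (f (?T x))) D \<and>
      (\<forall>x\<in>?S ` U. \<bar>det (D x)\<bar> = 1)"
    by (intro exI[of _ "\<lambda>x. A ** (D (?T x) ** B)"] conjI)
  moreover have "(\<lambda>x. ?S (f (?T x))) ` ?S ` U = ?S ` V"
    unfolding U(3)[symmetric] by (simp only: image_image stretch_inverse(1)[OF c])
  moreover have "\<forall>x\<in>?S ` U. ?S (g (?T (?S (f (?T x))))) = x"
    using gf by (auto simp: stretch_inverse[OF c])
  moreover have "\<exists>E. C1_with_derivative (?S ` V) (\<lambda>x. ?S (g (?T x))) E" using conj[OF E] by blast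
  ultimately show ?thesis unfolding volume_diffeo_def
    using open_stretch[OF U(1) c] open_stretch[OF U(2) c] by (simp only: simp_thms)
qed

lemma generic_stretch:
  fixes P :: "'a::{linordered_field,linorder_topology} ^ 'n::finite \<Rightarrow> bool"
  assumes P: "generic UNIV P" and c: "c \<noteq> 0"
  shows "generic UNIV (\<lambda>x. P (stretch c j x))"
proof -
  have "generic UNIV (\<lambda>x. x \<in> UNIV \<longrightarrow> P (stretch c j x))"
  proof (rule generic_transport[OF P open_UNIV continuous_at_stretch])
    fix x :: "'a ^ 'n" and r :: 'a assume r: "0 < r"
    obtain t where t: "0 < t" "\<forall>y\<in>cube UNIV (stretch c j x) t.
        stretch (1 / c) j y \<in> cube UNIV (stretch (1 / c) j (stretch c j x)) r"
      using continuous_near[OF continuous_at_stretch r] by blast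
    then have "cube UNIV (stretch c j x) t \<subseteq> stretch c j ` cube UNIV x r"
      by (simp add: subset_iff mem_stretch[OF c] stretch_inverse[OF c])
    then show "\<exists>t>0. cube UNIV (stretch c j x) t \<subseteq> stretch c j ` cube UNIV x r" using t(1) by blast
  qed
  then show ?thesis by simp
qed

context o_minimal_structure begin

lemma dterm_stretch:
  fixes u :: "'e \<Rightarrow> 'a ^ 'n::finite"
  assumes u: "\<And>i. dterm C (\<lambda>z. u z $ i)"
  shows "dterm C (\<lambda>z. stretch c j (u z) $ i)"
  unfolding stretch_def by (intro dterm_upd dterm_mult dterm_const u)

lemma definable_stretch:
  fixes X :: "('a ^ 'n::finite) set"
  assumes "definable_set M X" "c \<noteq> 0"
  shows "definable_set M (stretch c j ` X)"
  unfolding definable_set_iff_dfn mem_stretch[OF assms(2)]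
  by (intro definable_setD[OF assms(1)] dterm_stretch dterm_vc)

lemma n_iso_stretch:
  fixes U :: "('a ^ 'n::finite) set"
  assumes n: "n_iso U f V g" and c: "c \<noteq> 0"
  shows "n_iso (stretch c j ` U) (\<lambda>x. stretch c j (f (stretch (1 / c) j x)))
    (stretch c j ` V) (\<lambda>x. stretch c j (g (stretch (1 / c) j x)))"
proof -
  have "dfn (pr vc vc) (\<lambda>z :: ('a ^ 'n) \<times> ('a ^ 'n).
      stretch (1 / c) j (fst z) \<in> U \<and> f (stretch (1 / c) j (fst z)) = stretch (1 / c) j (snd z))"
    by (intro definable_mapD[OF n_isoD(2)[OF n]] dterm_stretch dterm_fst dterm_snd dterm_vc)
  moreover have "stretch (1 / c) j x \<in> U \<and> f (stretch (1 / c) j x) = stretch (1 / c) j y \<longleftrightarrow>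
      x \<in> stretch c j ` U \<and> stretch c j (f (stretch (1 / c) j x)) = y" for x y
    using mem_stretch[OF c] stretch_inverse[OF c] by metis
  ultimately have "definable_map M (stretch c j ` U) (\<lambda>x. stretch c j (f (stretch (1 / c) j x)))"
    by (simp add: definable_map_iff_dfn)
  then show ?thesis unfolding n_iso_def
    using definable_stretch[OF n_isoD(1)[OF n] c] volume_diffeo_stretch[OF n_isoD(3)[OF n] c] by blast
qed

lemma bounded_definable_stretch:
  fixes X :: "('a ^ 'n::finite) set"
  assumes X: "X \<in> bounded_definable M" and c: "0 < c" "c \<le> 1"
  shows "stretch c j ` X \<in> bounded_definable M"
proof -
  obtain r where r: "\<forall>x\<in>X. \<forall>i. - r \<le> x $ i \<and> x $ i \<le> r"
    using X unfolding bounded_definable_def by blast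
  have "\<bar>c * t\<bar> \<le> \<bar>t\<bar>" for t
    using mult_right_mono[of c 1 "\<bar>t\<bar>"] c by (simp add: abs_mult)
  then have "\<bar>stretch c j x $ i\<bar> \<le> \<bar>x $ i\<bar>" for x :: "'a ^ 'n" and i by (simp add: stretch_nth)
  moreover have "\<bar>x $ i\<bar> \<le> r" if "x \<in> X" for x i using r that by (auto simp: abs_le_iff minus_le_iff)
  ultimately have "\<bar>stretch c j x $ i\<bar> \<le> r" if "x \<in> X" for x i using that order_trans by blast
  then have "\<forall>x\<in>X. \<forall>i. - r \<le> stretch c j x $ i \<and> stretch c j x $ i \<le> r"
    by (simp add: abs_le_iff minus_le_iff)
  then have "\<forall>x\<in>stretch c j ` X. \<forall>i. - r \<le> x $ i \<and> x $ i \<le> r" by blast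
  then show ?thesis unfolding bounded_definable_def
    using definable_stretch[OF bounded_definableD[OF X]] c by auto
qed

lemma iso_rel_stretch:
  fixes X :: "('a ^ 'n::finite) set"
  assumes XY: "(X, Y) \<in> iso_rel M" and c: "0 < c" "c \<le> 1"
  shows "(stretch c j ` X, stretch c j ` Y) \<in> iso_rel M"
proof -
  obtain I :: "nat set" and P f Q g where X: "X \<in> bounded_definable M" and Y: "Y \<in> bounded_definable M"
    and p: "pieces I X Y P f Q g" using XY by (rule iso_relE)
  have c0: "c \<noteq> 0" using c by simp
  have disj: "disjoint_family_on (\<lambda>i. stretch c j ` R i) I" if "disjoint_family_on R I" for R :: "nat \<Rightarrow> ('a ^ 'n) set"
    using that unfolding disjoint_family_on_def by (auto simp: set_eq_iff mem_stretch[OF c0] simp del: image_iff)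
  have gen: "generic UNIV (\<lambda>x. x \<in> stretch c j ` Z \<longrightarrow> (\<exists>i\<in>I. x \<in> stretch c j ` R i))"
    if "generic UNIV (\<lambda>x. x \<in> Z \<longrightarrow> (\<exists>i\<in>I. x \<in> R i))" for Z :: "('a ^ 'n) set" and R
    unfolding mem_stretch[OF c0] using generic_stretch[OF that, of "1 / c" j] c0 by simp
  have "pieces I (stretch c j ` X) (stretch c j ` Y) (\<lambda>i. stretch c j ` P i)
      (\<lambda>i x. stretch c j (f i (stretch (1 / c) j x))) (\<lambda>i. stretch c j ` Q i)
      (\<lambda>i x. stretch c j (g i (stretch (1 / c) j x)))"
    using p unfolding pieces_def by (intro conjI ballI disj gen n_iso_stretch c0 image_mono) auto
  then show ?thesis by (rule iso_relI[OF bounded_definable_stretch[OF X c] bounded_definable_stretch[OF Y c]])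
qed

text \<open>
  The points of the line through \<open>x\<close> in direction \<open>j\<close> with coordinates between those of \<open>x\<close> and \<open>s\<close>
  lie in \<open>A\<close>; so, for \<open>x\<close> in \<open>A\<close>, the \<open>s\<close> with this property form the component of the fibre that
  contains \<open>x\<close>.
\<close>

definition fibre_connected :: "('a ^ 'n) set \<Rightarrow> 'n \<Rightarrow> 'a ^ 'n \<Rightarrow> 'a \<Rightarrow> bool" where
  "fibre_connected A j x s \<longleftrightarrow>
     (\<forall>u. x $ j \<le> u \<and> u \<le> s \<or> s \<le> u \<and> u \<le> x $ j \<longrightarrow> upd x j u \<in> A)"

lemma dfn_fibre_connected:
  fixes A :: "('a ^ 'n::finite) set"
  assumes A: "definable_set M A" and x: "\<And>i. dterm C (\<lambda>z. x z $ i)" and s: "dterm C s"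
  shows "dfn C (\<lambda>z. fibre_connected A j (x z) (s z))"
  unfolding fibre_connected_def
  by (intro dfn_intros definable_setD[OF A] dterm_upd dterm_intros dterm_fst x s)

lemma fibre_connected_upd:
  assumes "fibre_connected A j x u"
  shows "fibre_connected A j (upd x j u) t \<longleftrightarrow> fibre_connected A j x t"
proof
  assume *: "fibre_connected A j (upd x j u) t"
  show "fibre_connected A j x t" unfolding fibre_connected_def
  proof (intro allI impI)
    fix v assume "x $ j \<le> v \<and> v \<le> t \<or> t \<le> v \<and> v \<le> x $ j"
    then have "(x $ j \<le> v \<and> v \<le> u \<or> u \<le> v \<and> v \<le> x $ j) \<or> (u \<le> v \<and> v \<le> t \<or> t \<le> v \<and> v \<le> u)" by auto
    then show "upd x j v \<in> A" using assms * by (auto simp: fibre_connected_def)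
  qed
next
  assume *: "fibre_connected A j x t"
  show "fibre_connected A j (upd x j u) t" unfolding fibre_connected_def
  proof (intro allI impI)
    fix v assume "upd x j u $ j \<le> v \<and> v \<le> t \<or> t \<le> v \<and> v \<le> upd x j u $ j"
    then have "(x $ j \<le> v \<and> v \<le> u \<or> u \<le> v \<and> v \<le> x $ j) \<or> (x $ j \<le> v \<and> v \<le> t \<or> t \<le> v \<and> v \<le> x $ j)" by auto
    then show "upd (upd x j u) j v \<in> A" using assms * by (auto simp: fibre_connected_def)
  qed
qed

text \<open>
  The supremum exists by o-minimality; the infimum is obtained from it by reflection, which is the
  role of the sign \<open>c\<close> in the proof. Both depend only on the component, so they are constant along it.
\<close>

lemma fibre_component_ends:
  fixes A :: "('a ^ 'n::finite) set"
  assumes A: "A \<in> bounded_definable M"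
  obtains lo hi :: "'a ^ 'n \<Rightarrow> 'a" where "dterm vc lo" "dterm vc hi"
    "\<And>x u. fibre_connected A j x u \<Longrightarrow> lo (upd x j u) = lo x \<and> hi (upd x j u) = hi x"
    "\<And>x t. x \<in> A \<Longrightarrow> fibre_connected A j x t \<Longrightarrow> lo x \<le> t \<and> t \<le> hi x"
    "\<And>x t. x \<in> A \<Longrightarrow> lo x < t \<Longrightarrow> t < hi x \<Longrightarrow> fibre_connected A j x t"
proof -
  note dA = bounded_definableD[OF A]
  obtain r where r: "\<And>x i. x \<in> A \<Longrightarrow> - r \<le> x $ i \<and> x $ i \<le> r"
    using A unfolding bounded_definable_def by blast
  \<comment> \<open>\<open>s\<close> is the supremum of the component for \<open>c = 1\<close>, and minus its infimum for \<open>c = - 1\<close>\<close>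
  define H where "H c x s \<longleftrightarrow> (\<forall>y. s \<le> y \<longleftrightarrow> (\<forall>t. fibre_connected A j x (c * t) \<longrightarrow> t \<le> y))"
    for c :: 'a and x s
  define e where "e c x = (if \<exists>s. H c x s then THE s. H c x s else 0)" for c x
  have unique: "s = s'" if "H c x s" "H c x s'" for c x s s'
    using that unfolding H_def by (metis order_antisym order_refl)
  have de: "dterm vc (e c)" for c unfolding e_def
  proof (rule dterm_the)
    show "\<exists>!s. H c x s" if "\<exists>s. H c x s" for x using that unique by blast
    show "dfn (pr vc sc) (\<lambda>z. H c (fst z) (snd z))" unfolding H_def
      by (intro dfn_intros dfn_fibre_connected[OF dA] dterm_intros dterm_fst dterm_snd)
  qed
  have in_A: "upd x j t \<in> A" if "x \<in> A" "fibre_connected A j x t" for x t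
    using that unfolding fibre_connected_def by (metis linear order_refl)
  have He: "H c x (e c x)" if x: "x \<in> A" and c: "c = 1 \<or> c = - 1" for c x
  proof -
    have "dfn sc (\<lambda>t. fibre_connected A j x (c * t))"
      by (intro dfn_fibre_connected[OF dA] dterm_intros)
    moreover have "fibre_connected A j x (c * (c * x $ j))"
      using c x by (auto simp: fibre_connected_def dest: order_antisym)
    moreover have "\<forall>t. fibre_connected A j x (c * t) \<longrightarrow> t \<le> r"
    proof (intro allI impI)
      fix t assume "fibre_connected A j x (c * t)"
      then show "t \<le> r" using r[OF in_A[OF x], of "c * t" j] c by auto
    qed
    ultimately obtain s where "H c x s" unfolding H_def using dfn_lub_ex by blast
    moreover from this have "(THE s. H c x s) = s" using unique by blast
    ultimately show ?thesis unfolding e_def by auto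
  qed
  define lo where "lo x = - e (- 1) x" for x
  define hi where "hi = e 1"
  have "H c (upd x j u) = H c x" if "fibre_connected A j x u" for c x u
    unfolding H_def fun_eq_iff using fibre_connected_upd[OF that] by simp
  from this[THEN arg_cong[where f = "\<lambda>P. if \<exists>s. P s then THE s. P s else 0"]]
  have "e c (upd x j u) = e c x" if "fibre_connected A j x u" for c x u
    unfolding e_def using that by blast
  then have eq: "lo (upd x j u) = lo x \<and> hi (upd x j u) = hi x" if "fibre_connected A j x u" for x u
    using that by (simp add: lo_def hi_def)
  have ub: "t \<le> e c x" if "x \<in> A" "c = 1 \<or> c = - 1" "fibre_connected A j x (c * t)" for x t c
    using He[OF that(1,2)] that(3) unfolding H_def by blast
  have between: "lo x \<le> t \<and> t \<le> hi x" if "x \<in> A" "fibre_connected A j x t" for x t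
    using ub[OF that(1), of 1 t] ub[OF that(1), of "- 1" "- t"] that(2) by (auto simp: lo_def hi_def)
  have conn: "fibre_connected A j x t" if x: "x \<in> A" and t: "lo x < t" "t < hi x" for x t
  proof (cases "x $ j \<le> t")
    case True
    have "\<not> hi x \<le> t" using t(2) by simp
    then obtain s where "fibre_connected A j x s" "t < s"
      using He[OF x, of 1] unfolding hi_def H_def by auto
    then show ?thesis using True unfolding fibre_connected_def by (meson less_imp_le order_trans)
  next
    case False
    have "\<not> e (- 1) x \<le> - t" using t(1) by (simp add: lo_def)
    then obtain s where s: "fibre_connected A j x (- 1 * s)" "- t < s"
      using He[OF x, of "- 1"] unfolding H_def by auto
    then have "- s < t" by simp
    then show ?thesis using False s(1) unfolding fibre_connected_def
      by simp
  qed
  show ?thesis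
  proof (rule that[of lo hi])
    show "dterm vc lo" "dterm vc hi" unfolding lo_def hi_def by (intro dterm_uminus de)+
  qed (use eq between conn in blast)+
qed

text \<open>
  For \<open>e = lo\<close> the set on the left consists of the lower halves of the fibre components, for \<open>e = hi\<close>
  of the upper halves. In both cases \<open>2 t - e\<close> runs through the component while \<open>t\<close> runs through its
  half, so translation by \<open>- e / 2\<close> maps the half onto the component of the stretched set.
\<close>

lemma iso_rel_half:
  fixes A :: "('a ^ 'n::finite) set"
  assumes A: "A \<in> bounded_definable M" and d: "dterm vc lo" "dterm vc hi" "dterm vc e"
    and eq: "\<And>x u. fibre_connected A j x u \<Longrightarrow> lo (upd x j u) = lo x \<and> hi (upd x j u) = hi x \<and> e (upd x j u) = e x"
    and conn: "\<And>x t. x \<in> A \<Longrightarrow> lo x < t \<Longrightarrow> t < hi x \<Longrightarrow> fibre_connected A j x t"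
    and e: "\<And>x. lo x < hi x \<Longrightarrow> lo x \<le> e x \<and> e x \<le> hi x"
  defines "A0 \<equiv> {x \<in> A. lo x < x $ j \<and> x $ j < hi x}"
  shows "({x \<in> A0. lo x < 2 * x $ j - e x \<and> 2 * x $ j - e x < hi x}, stretch (1 / 2) j ` A0) \<in> iso_rel M"
    (is "(?L, ?Y) \<in> _")
proof -
  have two: "1 / (1 / 2) = (2 :: 'a)" by simp
  note mem = mem_stretch[of "1 / 2 :: 'a", unfolded two, simplified]
  note dA = bounded_definableD[OF A]
  have dA0: "definable_set M A0" unfolding definable_set_iff_dfn A0_def mem_Collect_eq
    by (intro dfn_conj dfn_less definable_setD[OF dA] d dterm_vc)
  have dL: "definable_set M ?L" unfolding definable_set_iff_dfn mem_Collect_eq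
    by (intro dfn_conj dfn_less definable_setD[OF dA0] d dterm_intros)
  have bd: "B \<in> bounded_definable M" if "definable_set M B" "B \<subseteq> A" for B
    using A that unfolding bounded_definable_def by blast
  have L: "?L \<in> bounded_definable M" and A0: "A0 \<in> bounded_definable M"
    using bd[OF dL] bd[OF dA0] by (auto simp: A0_def)
  have Y: "?Y \<in> bounded_definable M" by (rule bounded_definable_stretch[OF A0]) auto
  have in_A: "upd x j t \<in> A" if "fibre_connected A j x t" for x t
    using that unfolding fibre_connected_def by (metis linear order_refl)
  have slide: "upd x j t \<in> A0 \<and> lo (upd x j t) = lo x \<and> hi (upd x j t) = hi x \<and> e (upd x j t) = e x"
    if "x \<in> A0" "lo x < t" "t < hi x" for x t
  proof -
    have "fibre_connected A j x t" using that conn by (simp add: A0_def)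
    then show ?thesis using eq in_A that(2,3) by (simp add: A0_def)
  qed
  define a where "a x = - (e x / 2)" for x
  define b where "b y = e (stretch 2 j y) / 2" for y
  have da: "dterm vc a" unfolding a_def by (intro dterm_intros d)
  have db: "dterm vc b" unfolding b_def
    by (intro dterm_divide dterm_const dterm_vec_subst[OF d(3)] dterm_stretch dterm_vc)
  have line: "upd y j v \<in> cube UNIV x r" if "y \<in> cube UNIV x r" "\<bar>t - x $ j\<bar> < r"
    "y $ j \<le> v \<and> v \<le> t \<or> t \<le> v \<and> v \<le> y $ j" for x y :: "'a ^ 'n" and r t v
  proof -
    have "\<bar>y $ i - x $ i\<bar> < r" for i using that(1) by (simp add: cube_def)
    moreover from this[of j] have "\<bar>v - x $ j\<bar> < r" using that(2,3) by (auto simp: abs_less_iff)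
    ultimately show ?thesis by (simp add: cube_def)
  qed
  have va: "vertically_constant ?L j a" unfolding vertically_constant_def
  proof (intro allI impI)
    fix x y r t assume *: "cube UNIV x r \<subseteq> ?L" "y \<in> cube UNIV x r" "\<bar>t - x $ j\<bar> < r"
    have "fibre_connected A j y t" unfolding fibre_connected_def
      using line[OF *(2,3)] *(1) by (auto simp: A0_def)
    then show "a (upd y j t) = a y" using eq by (simp add: a_def)
  qed
  have vb: "vertically_constant ?Y j b" unfolding vertically_constant_def
  proof (intro allI impI)
    fix x y r t assume *: "cube UNIV x r \<subseteq> ?Y" "y \<in> cube UNIV x r" "\<bar>t - x $ j\<bar> < r"
    have "upd (stretch 2 j y) j u \<in> A"
      if "2 * y $ j \<le> u \<and> u \<le> 2 * t \<or> 2 * t \<le> u \<and> u \<le> 2 * y $ j" for u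
    proof -
      have "upd y j (u / 2) \<in> ?Y" using line[OF *(2,3), of "u / 2"] *(1) that by auto
      then have "stretch 2 j (upd y j (u / 2)) \<in> A0" unfolding mem .
      moreover have "stretch 2 j (upd y j (u / 2)) = upd (stretch 2 j y) j u"
        by (simp add: stretch_nth vec_eq_iff)
      ultimately show ?thesis by (simp add: A0_def)
    qed
    then have "fibre_connected A j (stretch 2 j y) (2 * t)"
      by (simp add: fibre_connected_def stretch_nth)
    moreover have "stretch 2 j (upd y j t) = upd (stretch 2 j y) j (2 * t)"
      by (simp add: stretch_nth vec_eq_iff)
    ultimately show "b (upd y j t) = b y" using eq by (simp add: b_def)
  qed
  show ?thesis
  proof (rule iso_rel_shear[OF L Y da db va vb])
    fix x assume x: "x \<in> ?L"
    have st: "stretch 2 j (shear a j x) = upd x j (2 * x $ j - e x)"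
      by (simp add: stretch_nth shear_def a_def vec_eq_iff algebra_simps)
    then show "shear a j x \<in> ?Y \<and> b (shear a j x) = - a x"
      using slide[of x "2 * x $ j - e x"] x unfolding mem by (simp add: b_def a_def)
  next
    fix y assume "y \<in> ?Y"
    then have w: "stretch 2 j y \<in> A0" unfolding mem .
    define w where "w = stretch 2 j y"
    define t where "t = (w $ j + e w) / 2"
    have wj: "lo w < w $ j" "w $ j < hi w" using w by (simp_all add: A0_def w_def)
    then have "lo w \<le> e w" "e w \<le> hi w" using e[of w] by auto
    then have t: "lo w < t" "t < hi w" using wj by (auto simp: t_def field_simps)
    have sh: "shear b j y = upd w j t"
      by (simp add: shear_def b_def t_def w_def stretch_nth vec_eq_iff add_divide_distrib)
    have "2 * t - e w = w $ j" by (simp add: t_def field_simps)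
    then show "shear b j y \<in> ?L \<and> a (shear b j y) = - b y"
      using slide[OF w[folded w_def] t] wj unfolding sh by (simp add: a_def b_def flip: w_def)
  qed
qed

text \<open>
  The lower and the upper halves miss only end points, midpoints and isolated points of the fibres.
\<close>

lemma iso_rel_double:
  fixes A :: "('a ^ 'n::finite) set"
  assumes A: "A \<in> bounded_definable M"
  obtains L U where "L \<inter> U = {}" "(A, L \<union> U) \<in> iso_rel M"
    "(L, stretch (1 / 2) j ` A) \<in> iso_rel M" "(U, stretch (1 / 2) j ` A) \<in> iso_rel M"
proof -
  obtain lo hi where d: "dterm vc lo" "dterm vc hi"
    and eq: "\<And>x u. fibre_connected A j x u \<Longrightarrow> lo (upd x j u) = lo x \<and> hi (upd x j u) = hi x"
    and btw: "\<And>x t. x \<in> A \<Longrightarrow> fibre_connected A j x t \<Longrightarrow> lo x \<le> t \<and> t \<le> hi x"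
    and conn: "\<And>x t. x \<in> A \<Longrightarrow> lo x < t \<Longrightarrow> t < hi x \<Longrightarrow> fibre_connected A j x t"
    using fibre_component_ends[OF A] by blast
  define A0 where "A0 = {x \<in> A. lo x < x $ j \<and> x $ j < hi x}"
  define L where "L = {x \<in> A0. lo x < 2 * x $ j - lo x \<and> 2 * x $ j - lo x < hi x}"
  define U where "U = {x \<in> A0. lo x < 2 * x $ j - hi x \<and> 2 * x $ j - hi x < hi x}"
  have L: "(L, stretch (1 / 2) j ` A0) \<in> iso_rel M" unfolding L_def A0_def
    by (rule iso_rel_half[OF A d d(1)]) (use eq conn in auto)
  have U: "(U, stretch (1 / 2) j ` A0) \<in> iso_rel M" unfolding U_def A0_def
    by (rule iso_rel_half[OF A d d(2)]) (use eq conn in auto)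
  have disj: "L \<inter> U = {}" by (auto simp: L_def U_def)
  have bL: "L \<in> bounded_definable M" "U \<in> bounded_definable M"
    using L U by (auto elim: iso_relE)
  have dA0: "definable_set M A0" unfolding definable_set_iff_dfn A0_def mem_Collect_eq
    by (intro dfn_conj dfn_less definable_setD[OF bounded_definableD[OF A]] d dterm_vc)
  have A0: "A0 \<in> bounded_definable M"
    using A dA0 unfolding bounded_definable_def by (auto simp: A0_def)
  have LU: "L \<union> U \<subseteq> A0" "A0 \<subseteq> A" by (auto simp: L_def U_def A0_def)
  have "generic UNIV (\<lambda>x. x \<in> A \<longrightarrow> x \<in> L \<union> U)"
  proof (rule decided_on_subcube_generic[OF decided_on_subcube_UNIV], rule_tac [2] ccontr)
    have "dfn vc (\<lambda>x. x \<in> A \<longrightarrow> x \<in> L \<or> x \<in> U)"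
      using A bL by (intro dfn_imp dfn_disj definable_setD dterm_vc bounded_definableD)
    then show "dfn vc (\<lambda>x. x \<in> A \<longrightarrow> x \<in> L \<union> U)" by simp
  next
    fix q :: "'a ^ 'n" and s :: 'a assume s: "0 < s" and "\<not> (\<exists>x\<in>cube UNIV q s. x \<in> A \<longrightarrow> x \<in> L \<union> U)"
    then have bad: "x \<in> A" "x \<notin> L" "x \<notin> U" if "x \<in> cube UNIV q s" for x using that by blast+
    have q: "q \<in> cube UNIV q s" using s by (rule cube_center)
    have fc: "fibre_connected A j q t" if "\<bar>t - q $ j\<bar> < s" for t
      unfolding fibre_connected_def using that by (auto intro!: bad(1) simp: cube_def abs_less_iff s)
    have "lo q \<le> q $ j - s / 2" "q $ j + s / 2 \<le> hi q"
      using btw[OF bad(1)[OF q] fc, of "q $ j - s / 2"] btw[OF bad(1)[OF q] fc, of "q $ j + s / 2"] s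
      by auto
    then have lh: "lo q < t \<and> t < hi q" if "\<bar>t - q $ j\<bar> < s / 2" for t using that by linarith
    have mid: "2 * t = lo q + hi q" if t: "\<bar>t - q $ j\<bar> < s / 2" for t
    proof -
      let ?x = "upd q j t"
      have "s / 2 < s" using s by simp
      then have ts: "\<bar>t - q $ j\<bar> < s" using t by (rule order_less_trans[rotated])
      have x: "?x \<in> cube UNIV q s" using ts s by (auto simp: cube_def)
      have e: "lo ?x = lo q" "hi ?x = hi q" using eq[OF fc[OF ts]] by auto
      have "?x \<in> A0" using bad(1)[OF x] lh[OF t] by (simp add: A0_def e)
      then show ?thesis using bad(2,3)[OF x] lh[OF t] by (auto simp: L_def U_def e algebra_simps)
    qed
    have "2 * q $ j = lo q + hi q" "2 * (q $ j + s / 4) = lo q + hi q" using s by (intro mid; simp)+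
    then show False using s by simp
  qed
  then have g: "generic UNIV (\<lambda>x. x \<in> A \<longleftrightarrow> x \<in> L \<union> U)" by (rule generic_mono) (use LU in blast)
  then have 1: "(A, L \<union> U) \<in> iso_rel M" by (rule iso_rel_generic_eq[OF A bounded_definable_Un[OF bL]])
  have "(A0, A) \<in> iso_rel M" by (rule iso_rel_generic_eq[OF A0 A]) (rule generic_mono[OF g], use LU in blast)
  then have "(stretch (1 / 2) j ` A0, stretch (1 / 2) j ` A) \<in> iso_rel M" by (rule iso_rel_stretch) auto
  then show ?thesis using that disj 1 iso_rel_trans L U by blast
qed

text \<open>
  Translate by more than the diameter.
\<close>

lemma disjoint_copy:
  fixes A :: "('a ^ 'n::finite) set"
  assumes A: "A \<in> bounded_definable M"
  obtains A' where "(A, A') \<in> iso_rel M" "A \<inter> A' = {}"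
proof -
  obtain r where r: "\<And>x i. x \<in> A \<Longrightarrow> - r \<le> x $ i \<and> x $ i \<le> r"
    using A unfolding bounded_definable_def by blast
  define c where "c = 2 * \<bar>r\<bar> + 1"
  define j where "j = (undefined :: 'n)"
  define A' where "A' = {y. shear (\<lambda>_. - c) j y \<in> A}"
  have inv: "shear (\<lambda>_. - c) j (shear (\<lambda>_. c) j x) = x" "shear (\<lambda>_. c) j (shear (\<lambda>_. - c) j x) = x"
    for x :: "'a ^ 'n" by (simp_all add: shear_def vec_eq_iff)
  have dA': "definable_set M A'" unfolding definable_set_iff_dfn A'_def mem_Collect_eq
    by (intro definable_setD[OF bounded_definableD[OF A]] dterm_shear dterm_const dterm_vc)
  have "- (r + c) \<le> y $ i \<and> y $ i \<le> r + c" if "y \<in> A'" for y i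
  proof -
    have "- r \<le> shear (\<lambda>_. - c) j y $ i \<and> shear (\<lambda>_. - c) j y $ i \<le> r" using r that by (simp add: A'_def)
    then show ?thesis by (cases "i = j") (auto simp: shear_def c_def)
  qed
  then have A': "A' \<in> bounded_definable M" unfolding bounded_definable_def using dA' by blast
  have "(A, A') \<in> iso_rel M"
    by (rule iso_rel_shear[OF A A' dterm_const[of _ c] dterm_const[of _ "- c"], where j = j])
      (auto simp: vertically_constant_def A'_def inv)
  moreover have "A \<inter> A' = {}"
  proof (rule ccontr)
    assume "A \<inter> A' \<noteq> {}"
    then obtain x where "x \<in> A" "shear (\<lambda>_. - c) j x \<in> A" by (auto simp: A'_def)
    then have "x $ j \<le> r" "- r \<le> x $ j - c" using r[of x j] r[of "shear (\<lambda>_. - c) j x" j] by (auto simp: shear_def)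
    then show False by (auto simp: c_def)
  qed
  ultimately show ?thesis using that by blast
qed

text \<open>
  Here the sum of classes is computed: every choice of disjoint representatives gives the same class,
  as \<open>iso_rel\<close> is an equivalence relation compatible with disjoint unions. Then \<open>A\<close> splits into
  two sets equivalent to the stretched copies of \<open>A\<close> and \<open>A'\<close>, whose union is the stretched copy of a
  representative of the double class.
\<close>

lemma half_of_double:
  fixes \<alpha> :: "('a ^ 'n::finite) set set"
  assumes \<alpha>: "\<alpha> \<in> iso_classes M" and X: "X \<in> class_add M \<alpha> \<alpha>"
  shows "stretch (1 / 2) j ` X \<in> \<alpha>"
proof -
  obtain A where A: "A \<in> bounded_definable M" and \<alpha>A: "\<alpha> = iso_rel M `` {A}"
    using \<alpha> unfolding iso_classes_def by (auto elim: quotientE)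
  obtain A' where A': "(A, A') \<in> iso_rel M" "A \<inter> A' = {}" using disjoint_copy[OF A] .
  have refl: "(A, A) \<in> iso_rel M" using iso_rel_trans[OF A'(1) iso_rel_sym[OF A'(1)]] .
  have "class_add M \<alpha> \<alpha> = iso_rel M `` {A \<union> A'}" unfolding class_add_def
  proof (rule the_equality)
    show "\<exists>X\<in>\<alpha>. \<exists>Y\<in>\<alpha>. X \<inter> Y = {} \<and> iso_rel M `` {A \<union> A'} = iso_rel M `` {X \<union> Y}"
      using refl A' unfolding \<alpha>A by blast
  next
    fix \<gamma> assume "\<exists>X\<in>\<alpha>. \<exists>Y\<in>\<alpha>. X \<inter> Y = {} \<and> \<gamma> = iso_rel M `` {X \<union> Y}"
    then obtain X Y where XY: "(A, X) \<in> iso_rel M" "(A, Y) \<in> iso_rel M" "X \<inter> Y = {}"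
      and \<gamma>: "\<gamma> = iso_rel M `` {X \<union> Y}" unfolding \<alpha>A by blast
    have "(A', Y) \<in> iso_rel M" using iso_rel_trans[OF iso_rel_sym[OF A'(1)] XY(2)] .
    then have u: "(A \<union> A', X \<union> Y) \<in> iso_rel M" using iso_rel_Un[OF XY(1) _ A'(2) XY(3)] by blast
    show "\<gamma> = iso_rel M `` {A \<union> A'}" unfolding \<gamma>
      using iso_rel_trans[OF u] iso_rel_trans[OF iso_rel_sym[OF u]] by blast
  qed
  then have AX: "(A \<union> A', X) \<in> iso_rel M" using X by simp
  obtain L U where LU: "L \<inter> U = {}" "(A, L \<union> U) \<in> iso_rel M"
    "(L, stretch (1 / 2) j ` A) \<in> iso_rel M" "(U, stretch (1 / 2) j ` A) \<in> iso_rel M"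
    using iso_rel_double[OF A] .
  have half: "(Y, Z) \<in> iso_rel M \<Longrightarrow> (stretch (1 / 2) j ` Y, stretch (1 / 2) j ` Z) \<in> iso_rel M" for Y Z :: "('a ^ 'n) set"
    by (rule iso_rel_stretch) auto
  have U: "(U, stretch (1 / 2) j ` A') \<in> iso_rel M" using iso_rel_trans[OF LU(4) half[OF A'(1)]] .
  have "stretch (1 / 2) j ` A \<inter> stretch (1 / 2) j ` A' = {}"
    using A'(2) by (simp add: disjoint_iff mem_stretch)
  from iso_rel_Un[OF LU(3) U LU(1) this]
  have "(L \<union> U, stretch (1 / 2) j ` (A \<union> A')) \<in> iso_rel M" by (simp add: image_Un)
  then have "(A, stretch (1 / 2) j ` X) \<in> iso_rel M"
    using iso_rel_trans[OF LU(2)] iso_rel_trans half[OF AX] by blast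
  then show ?thesis unfolding \<alpha>A by simp
qed

end

lemma standard_part_half:
  fixes t :: "'a::linordered_field"
  assumes "t \<in> \<O>"
  shows "standard_part (1 / 2 * t) = 1 / 2 * standard_part t"
proof -
  have half: "(1 / 2 :: 'a) = of_rat (1 / 2)" "(1 / 2 :: real) = of_rat (1 / 2)"
    by (simp_all add: of_rat_divide)
  have "(1 / 2 :: 'a) \<in> \<O>" unfolding half(1) \<O>_def by blast
  then show ?thesis using standard_part_mult[OF _ assms, of "1 / 2"] standard_part_of_rat[of "1 / 2", where ?'a = 'a]
    by (simp only: half)
qed

text \<open>
  \<open>measure\<close> is \<open>0\<close> also on sets that are not measurable or have infinite measure, and stretching
  neither creates nor destroys measurability.
\<close>

lemma measure_stretch_eq_0:
  fixes T :: "(real ^ 'n::finite) set"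
  assumes "measure lebesgue T = 0" "c \<noteq> 0"
  shows "measure lebesgue (stretch c j ` T) = 0"
proof (cases "stretch c j ` T \<in> lmeasurable")
  case True
  define m where "m k = (if k = j then 1 / c else 1)" for k
  have "(\<lambda>x. \<chi> k. m k * x $ k) ` stretch c j ` T = T"
  proof -
    have "(\<chi> k. m k * stretch c j x $ k) = x" for x using assms(2) by (simp add: m_def stretch_nth vec_eq_iff)
    then show ?thesis by (simp add: image_image)
  qed
  then have "measure lebesgue T = \<bar>prod m UNIV\<bar> * measure lebesgue (stretch c j ` T)"
    using measure_stretch[OF True, of m] by simp
  moreover have "prod m UNIV = 1 / c" by (simp add: m_def)
  ultimately show ?thesis using assms by simp
next
  case False
  show ?thesis
  proof (cases "stretch c j ` T \<in> sets lebesgue")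
    case True
    then have "\<not> emeasure lebesgue (stretch c j ` T) < \<infinity>" using False fmeasurableI by blast
    then have "emeasure lebesgue (stretch c j ` T) = top"
      by (metis infinity_ennreal_def top.not_eq_extremum)
    then show ?thesis by (simp only: measure_def enn2real_top)
  qed (rule measure_notin_sets)
qed

theorem theorem1p3:
  fixes M :: "('a::{linordered_field,linorder_topology}, 'f, 'r) expansion"
    and \<alpha> \<beta> :: "('a ^ 'n::finite) set set"
  assumes "o_minimal M"
    and "saturated (cardSuc (card_of (UNIV :: nat set set))) M"
    and "\<alpha> \<in> iso_classes M" and "\<beta> \<in> iso_classes M"
    and "class_almost_eq M (class_add M \<alpha> \<alpha>) (class_add M \<beta> \<beta>)"
  shows "class_almost_eq M \<alpha> \<beta>"
proof -
  interpret o_minimal_structure M using assms(1,2) by unfold_locales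
  define j where "j = (undefined :: 'n)"
  let ?S = "stretch (1 / 2 :: 'a) j"
  obtain X Y where XY: "X \<in> class_add M \<alpha> \<alpha>" "Y \<in> class_add M \<beta> \<beta>"
    and sX: "X \<in> strongly_bounded_definable M" and sY: "Y \<in> strongly_bounded_definable M"
    and ae: "almost_eq X Y"
    using assms(5) unfolding class_almost_eq_def by blast
  have sb: "?S ` Z \<in> strongly_bounded_definable M" if Z: "Z \<in> strongly_bounded_definable M" for Z
  proof -
    obtain m :: nat where m: "\<forall>x\<in>Z. \<forall>i. - of_nat m \<le> x $ i \<and> x $ i \<le> of_nat m"
      using Z unfolding strongly_bounded_definable_def by blast
    have "- of_nat m \<le> ?S x $ i \<and> ?S x $ i \<le> of_nat m" if "x \<in> Z" for x i
    proof -
      have "- of_nat m \<le> x $ i \<and> x $ i \<le> of_nat m" using m that by blast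
      moreover have "(0 :: 'a) \<le> of_nat m" by simp
      ultimately show ?thesis by (auto simp: stretch_nth field_simps)
    qed
    then have "\<forall>x\<in>?S ` Z. \<forall>i. - of_nat m \<le> x $ i \<and> x $ i \<le> of_nat m" by blast
    moreover have "?S ` Z \<in> bounded_definable M"
      using Z unfolding strongly_bounded_definable_def by (intro bounded_definable_stretch) auto
    ultimately show ?thesis unfolding strongly_bounded_definable_def by blast
  qed
  have fin: "x $ i \<in> \<O>" if "x \<in> X \<union> Y" for x i
  proof -
    have "\<exists>m::nat. \<bar>x $ i\<bar> \<le> of_nat m" if z: "x \<in> Z" "Z \<in> strongly_bounded_definable M" for Z
    proof -
      obtain m :: nat where "\<forall>x\<in>Z. \<forall>i. - of_nat m \<le> x $ i \<and> x $ i \<le> of_nat m"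
        using z(2) unfolding strongly_bounded_definable_def by blast
      then show ?thesis using z(1) by (auto simp: abs_le_iff minus_le_iff)
    qed
    then have "\<exists>m::nat. \<bar>x $ i\<bar> \<le> of_nat m" using that sX sY by blast
    then obtain m :: nat where "\<bar>x $ i\<bar> \<le> of_nat m" by blast
    then show ?thesis unfolding \<O>_iff_abs
      by (intro exI[of _ "of_nat m + 1"]) (auto simp: of_rat_add intro: add_increasing2)
  qed
  let ?Z = "sym_diff X Y"
  have "sym_diff (?S ` X) (?S ` Y) = ?S ` ?Z"
    using mem_stretch[of "1 / 2 :: 'a" _ j] by (auto simp: set_eq_iff simp del: image_iff)
  moreover have "st ` ?S ` ?Z = stretch (1 / 2) j ` st ` ?Z"
  proof -
    have "st (?S x) = stretch (1 / 2) j (st x)" if "x \<in> X \<union> Y" for x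
      using standard_part_half[OF fin[OF that]] by (simp add: st_def stretch_nth vec_eq_iff)
    then show ?thesis unfolding image_image by (intro image_cong) auto
  qed
  moreover have "\<mu> ?Z = 0"
  proof -
    have small: "\<mu> ?Z < \<epsilon>" if "0 < \<epsilon>" for \<epsilon>
      using ae that unfolding almost_eq_def eq_eps_def by blast
    have "\<not> 0 < \<mu> ?Z" using small[of "\<mu> ?Z"] by blast
    moreover have "0 \<le> \<mu> ?Z" unfolding \<mu>_def by (rule measure_nonneg)
    ultimately show ?thesis by linarith
  qed
  ultimately have "\<mu> (sym_diff (?S ` X) (?S ` Y)) = 0"
    using measure_stretch_eq_0[of "st ` ?Z" "1 / 2" j] by (simp add: \<mu>_def)
  then have "almost_eq (?S ` X) (?S ` Y)" unfolding almost_eq_def eq_eps_def by simp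
  then show ?thesis unfolding class_almost_eq_def
    using half_of_double[OF assms(3) XY(1)] half_of_double[OF assms(4) XY(2)] sb[OF sX] sb[OF sY] by blast
qed

end
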